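(* Let $d\ge2$ and let $F\colon[0,\infty)\to\mathbb R$ be such that $\mathcal R_dF$ is positive definite on $\mathbb R^d$. Then $F$ is $\lfloor\frac{d-2}2\rfloor$ times continuously differentiable on $(0,\infty)$. Moreover, $$f=\mathcal F_1\mathcal R_d^\star\mathcal F_d^{-1}[\mathcal R_dF]$$ is (generated by) a positive definite function on $\mathbb R$ and fulfills the slicing formula $$F(\|x\|)=\mathbb E_{\xi\sim\mathcal U_{\mathbb S^{d-1}}}\big[f(|\langle x,\xi\rangle|)\big]\qquad\text{for all }x\in\mathbb R^d.$$ Conversely, for every even, positive definite function $f$ on $\mathbb R$, the radial function $\mathcal R_dF$ given by $\mathcal R_dF(x)=\mathbb E_{\xi\sim\mathcal U_{\mathbb S^{d-1}}}[f(|\langle x,\xi\rangle|)]$, $x\in\mathbb R^d$, is positive definite on $\mathbb R^d$.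
   Context: $\|\cdot\|$ and $\langle\cdot,\cdot\rangle$ are the Euclidean norm and inner product; $\mathcal U_{\mathbb S^{d-1}}$ is the uniform distribution on the unit sphere $\mathbb S^{d-1}\subset\mathbb R^d$. A continuous function $\Phi\colon\mathbb R^d\to\mathbb C$ is positive definite if for all $N\in\mathbb N$, all pairwise distinct $x_1,\dots,x_N\in\mathbb R^d$ and all $\alpha_1,\dots,\alpha_N\in\mathbb C$ one has $\sum_{j,k=1}^N\alpha_j\overline{\alpha_k}\,\Phi(x_j-x_k)\ge0$ (continuity is part of the definition; strict positivity is not required). $\mathcal S(\mathbb R^d)$ is the Schwartz space, $\mathcal S'(\mathbb R^d)$ the tempered distributions. Bounded continuous functions $T$ are identified with tempered distributions via $\langle T,\varphi\rangle=\int T\varphi\,\mathrm dx$, and finite Borel measures $\mu$ via $\langle\mu,\varphi\rangle=\int\varphi\,\mathrm d\mu$. Fourier transform: $\mathcal F_d[\varphi](v)=\int_{\mathbb R^d}e^{-2\pi i\langle x,v\rangle}\varphi(x)\,\mathrm dx$ on $\mathcal S(\mathbb R^d)$, and $\langle\mathcal F_dT,\varphi\rangle:=\langle T,\mathcal F_d\varphi\rangle$ on $\mathcal S'(\mathbb R^d)$, with inverse $\mathcal F_d^{-1}$. Rotation operator: $\mathcal R_dF(x):=F(\|x\|)$, $x\in\mathbb R^d$, for $F$ on $[0,\infty)$ or $F$ an even function on $\mathbb R$. For $\psi\in\mathcal S(\mathbb R)$, $\mathcal A_1\psi(r):=\frac12(\psi(r)+\psi(-r))$. The operator $\mathcal R_d^\star\colon\mathcal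 S'(\mathbb R^d)\to\mathcal S'(\mathbb R)$ is defined by $\langle\mathcal R_d^\star T,\psi\rangle:=\langle T,(\mathcal R_d\circ\mathcal A_1)\psi\rangle$ for all $\psi\in\mathcal S(\mathbb R)$. *)

theory Defs
  imports "HOL-Analysis.Analysis"
begin

section \<open>Positive definite functions\<close>

definition positive_definite :: "('a::euclidean_space \<Rightarrow> complex) \<Rightarrow> bool" where
  "positive_definite \<Phi> \<longleftrightarrow>
     continuous_on UNIV \<Phi> \<and>
     (\<forall>(N::nat) (x :: nat \<Rightarrow> 'a) (\<alpha> :: nat \<Rightarrow> complex). inj_on x {1..N} \<longrightarrow>
        (\<Sum>j=1..N. \<Sum>k=1..N. \<alpha> j * cnj (\<alpha> k) * \<Phi> (x j - x k)) \<in> \<real>\<^sub>\<ge>\<^sub>0)"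


section \<open>Schwartz functions and tempered distributions\<close>

definition partial_deriv :: "'a::euclidean_space \<Rightarrow> ('a \<Rightarrow> complex) \<Rightarrow> 'a \<Rightarrow> complex" where
  "partial_deriv b \<phi> x = frechet_derivative \<phi> (at x) b"

text \<open>A multi-index is represented by a list of standard basis vectors, one entry for each
  differentiation.\<close>

definition partial_derivs :: "'a::euclidean_space list \<Rightarrow> ('a \<Rightarrow> complex) \<Rightarrow> 'a \<Rightarrow> complex" where
  "partial_derivs bs \<phi> = foldr partial_deriv bs \<phi>"

text \<open>Smoothness is expressed by total differentiability of all iterated partial derivatives; these
  are then automatically continuous.\<close>

definition schwartz :: "('a::euclidean_space \<Rightarrow> complex) set" where
  "schwartz = {\<phi>. \<forall>bs\<in>lists Basis.
     partial_derivs bs \<phi> differentiable_on UNIV \<and>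
     (\<forall>k::nat. bounded (range (\<lambda>x. (1 + norm x) ^ k * norm (partial_derivs bs \<phi> x))))}"

text \<open>The norms below (increasing in \<open>N\<close>) generate the topology of the Schwartz space.\<close>

definition schwartz_norm :: "nat \<Rightarrow> ('a::euclidean_space \<Rightarrow> complex) \<Rightarrow> real" where
  "schwartz_norm N \<phi> =
     (SUP (bs, x) \<in> {bs \<in> lists Basis. length bs \<le> N} \<times> UNIV.
        (1 + norm x) ^ N * norm (partial_derivs bs \<phi> x))"

text \<open>Continuous complex-linear functionals on the Schwartz space. They are taken to be extensional,
  i.e. \<open>undefined\<close> off the Schwartz space, so that equality of distributions is equality in HOL.\<close>

definition tempered_distributions :: "(('a::euclidean_space \<Rightarrow> complex) \<Rightarrow> complex) set" where
  "tempered_distributions = {T \<in> extensional schwartz.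
     (\<forall>\<phi>\<in>schwartz. \<forall>\<psi>\<in>schwartz. T (\<lambda>x. \<phi> x + \<psi> x) = T \<phi> + T \<psi>) \<and>
     (\<forall>c. \<forall>\<phi>\<in>schwartz. T (\<lambda>x. c * \<phi> x) = c * T \<phi>) \<and>
     (\<exists>C N. \<forall>\<phi>\<in>schwartz. norm (T \<phi>) \<le> C * schwartz_norm N \<phi>)}"

definition regular_distribution ::
    "('a::euclidean_space \<Rightarrow> complex) \<Rightarrow> ('a \<Rightarrow> complex) \<Rightarrow> complex" where
  "regular_distribution g = (\<lambda>\<phi>\<in>schwartz. \<integral>x. g x * \<phi> x \<partial>lborel)"


section \<open>Fourier transform\<close>

definition fourier :: "('a::euclidean_space \<Rightarrow> complex) \<Rightarrow> 'a \<Rightarrow> complex" where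
  "fourier \<phi> v = (\<integral>x. exp (- 2 * of_real pi * \<i> * of_real (x \<bullet> v)) * \<phi> x \<partial>lborel)"

definition fourier_distribution ::
    "(('a::euclidean_space \<Rightarrow> complex) \<Rightarrow> complex) \<Rightarrow> ('a \<Rightarrow> complex) \<Rightarrow> complex" where
  "fourier_distribution T = (\<lambda>\<phi>\<in>schwartz. T (fourier \<phi>))"

definition inv_fourier_distribution ::
    "(('a::euclidean_space \<Rightarrow> complex) \<Rightarrow> complex) \<Rightarrow> ('a \<Rightarrow> complex) \<Rightarrow> complex" where
  "inv_fourier_distribution = the_inv_into tempered_distributions fourier_distribution"


section \<open>Rotation operator, its dual, and the uniform distribution on the sphere\<close>

text \<open>The values of \<open>F\<close> at negative arguments are irrelevant here.\<close>

definition rotation :: "(real \<Rightarrow> complex) \<Rightarrow> 'a::euclidean_space \<Rightarrow> complex" where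
  "rotation F x = F (norm x)"

definition even_part :: "(real \<Rightarrow> complex) \<Rightarrow> real \<Rightarrow> complex" where
  "even_part \<psi> r = (\<psi> r + \<psi> (- r)) / 2"

definition rotation_dual ::
    "(('a::euclidean_space \<Rightarrow> complex) \<Rightarrow> complex) \<Rightarrow> (real \<Rightarrow> complex) \<Rightarrow> complex" where
  "rotation_dual T = (\<lambda>\<psi>\<in>schwartz. T (rotation (even_part \<psi>)))"

text \<open>Normalized surface measure, obtained by radially projecting the uniform distribution on the
  unit ball to the sphere. It is a Borel measure on the ambient space carried by the sphere; the
  exceptional point \<open>0\<close> of the projection is a null set.\<close>

definition uniform_sphere :: "'a::euclidean_space measure" where
  "uniform_sphere = distr (uniform_measure lborel (ball 0 1)) borel (\<lambda>x. x /\<^sub>R norm x)"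


section \<open>Continuous differentiability on an open set\<close>

definition times_continuously_differentiable_on :: "nat \<Rightarrow> (real \<Rightarrow> real) \<Rightarrow> real set \<Rightarrow> bool" where
  "times_continuously_differentiable_on k F S \<longleftrightarrow>
     (\<forall>j<k. ((deriv ^^ j) F) differentiable_on S) \<and> continuous_on S ((deriv ^^ k) F)"

end

theory Submission
  imports Defs "HOL-Probability.Probability"
begin

text \<open>Multiplying a positive definite \<open>\<Phi>(x) = F(\<parallel>x\<parallel>)\<close> by wide Gaussians produces
  functions with nonnegative Fourier transform; pushing the resulting measures forward under the norm
  gives a tight sequence on the line, and a weak limit \<open>\<nu>\<close> satisfies
  \<open>F(\<parallel>x\<parallel>) = F(0) \<integral> E\<^sub>\<xi>[cos(2\<pi>r\<langle>x,\<xi>\<rangle>)] d\<nu>(r)\<close>. Hence \<open>\<F>\<^sub>d\<^sup>-\<^sup>1\<Phi>\<close> is \<open>F(0)\<close>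
  times the law \<open>\<mu>\<close> of \<open>r\<xi>\<close>, and \<open>f(t) = F(0) \<integral> cos(2\<pi>tr) d\<nu>(r)\<close> is the even positive definite function
  of the theorem. The Fourier transform is injective on tempered distributions because it maps the
  Schwartz space onto itself, and \<open>\<R>\<^sub>d\<^sup>\<star>\<mu>\<close> makes sense because \<open>h'(r)/r\<close> is Schwartz for every
  even Schwartz function \<open>h\<close>.

  For the smoothness, integrating the slicing formula over balls shows that \<open>F\<close> is a multiple of
  \<open>H\<^sub>b(s) = \<integral>\<^sub>0\<^sup>1 f(st) (1 - t\<^sup>2)\<^sup>b dt\<close> with \<open>b = (d - 3)/2\<close>. For merely continuous \<open>f\<close> one has
  \<open>s H\<^sub>b'(s) = 2b H\<^sub>b\<^sub>-\<^sub>1(s) - (2b + 1) H\<^sub>b(s)\<close>, so each unit of \<open>b\<close> gives one derivative.\<close>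

section \<open>Gaussians and Fourier inversion\<close>

text \<open>Positivity of the windowed transform comes from two independent Gaussian points:
  positive definiteness makes the double integral of \<open>\<Phi>(x - y)\<close> times a character
  nonnegative, and since the difference of the points is again Gaussian, this double integral is the
  transform of \<open>\<Phi>\<close> times a Gaussian. As \<open>\<Phi>\<close> need not be
  integrable, one Gaussian is used on the space side; a second one on the frequency side makes the
  densities integrable. Radiality reduces the weak limit to laws on the line: the spherical mean of
  \<open>cos (2 pi r <x, \<xi>>)\<close> for \<open>r = |v|\<close> is symmetric in
  \<open>|x|\<close> and \<open>|v|\<close>, so the law of \<open>|v|\<close> determines the
  averages of the transform over spheres, and \<open>\<Phi>\<close> is constant on spheres. The
  inverse transform of the distribution is evaluated by exhibiting one preimage and using
  injectivity. The order of smoothness comes from the weight \<open>(1 - t^2)^b\<close>: it is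
  integrable for \<open>b > -1\<close>, so \<open>H_b\<close> can be differentiated \<open>k\<close>
  times when \<open>b > k - 1\<close>, which for \<open>b = (d - 3)/2\<close> means
  \<open>2 k \<le> d - 2\<close>. Integrating over balls replaces the surface density of the sphere
  by volumes of balls and of their sections.\<close>

lemma cis_measurable [measurable]: "cis \<in> borel_measurable borel"
  by (intro borel_measurable_continuous_onI continuous_intros)

section \<open>Interchange of integrals and affine substitutions\<close>

text \<open>The product is dominated by a multiple of \<open>f x * g y\<close>, which is integrable
  on the product space. Most later interchanges have this shape, with a bounded trigonometric kernel
  and factors that are integrable or constant on a probability space.\<close>

lemma (in pair_sigma_finite) Fubini_kernel:
  fixes f :: "'a \<Rightarrow> 'c::{real_normed_field, banach, second_countable_topology}" and g :: "'b \<Rightarrow> 'c"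
  assumes f: "integrable M1 f" and g: "integrable M2 g"
    and K [measurable]: "case_prod K \<in> borel_measurable (M1 \<Otimes>\<^sub>M M2)"
    and B: "\<And>x y. x \<in> space M1 \<Longrightarrow> y \<in> space M2 \<Longrightarrow> norm (K x y) \<le> B"
  shows "(\<integral>x. (\<integral>y. K x y * f x * g y \<partial>M2) \<partial>M1) = (\<integral>y. (\<integral>x. K x y * f x * g y \<partial>M1) \<partial>M2)"
proof -
  note [measurable] = borel_measurable_integrable[OF f] borel_measurable_integrable[OF g]
  have "integrable (M1 \<Otimes>\<^sub>M M2) (\<lambda>z. f (fst z) * g (snd z))"
  proof (rule Fubini_integrable)
    show "integrable M1 (\<lambda>x. \<integral>y. norm (f (fst (x, y)) * g (snd (x, y))) \<partial>M2)"
      using f g by (simp add: norm_mult)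
    show "AE x in M1. integrable M2 (\<lambda>y. f (fst (x, y)) * g (snd (x, y)))"
      using g by simp
  qed measurable
  then have fg: "integrable (M1 \<Otimes>\<^sub>M M2) (\<lambda>z. B *\<^sub>R (f (fst z) * g (snd z)))"
    by simp
  have *: "integrable (M1 \<Otimes>\<^sub>M M2) (\<lambda>(x, y). K x y * f x * g y)"
  proof (rule Bochner_Integration.integrable_bound[OF fg])
    show "AE z in M1 \<Otimes>\<^sub>M M2. norm (case z of (x, y) \<Rightarrow> K x y * f x * g y)
        \<le> norm (B *\<^sub>R (f (fst z) * g (snd z)))"
    proof (rule AE_I2)
      fix z assume "z \<in> space (M1 \<Otimes>\<^sub>M M2)"
      then obtain x y where z: "z = (x, y)" "x \<in> space M1" "y \<in> space M2"
        by (auto simp: space_pair_measure)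
      have "norm (K x y) \<le> \<bar>B\<bar>"
        using B[OF z(2,3)] by simp
      then show "norm (case z of (x, y) \<Rightarrow> K x y * f x * g y) \<le> norm (B *\<^sub>R (f (fst z) * g (snd z)))"
        unfolding z by (simp add: norm_mult mult.assoc mult_right_mono)
    qed
  qed measurable
  show "(\<integral>x. (\<integral>y. K x y * f x * g y \<partial>M2) \<partial>M1) = (\<integral>y. (\<integral>x. K x y * f x * g y \<partial>M1) \<partial>M2)"
    by (rule Fubini_integral[OF *, symmetric])
qed

lemma lborel_integral_affine:
  fixes f :: "'a::euclidean_space \<Rightarrow> 'b::{banach, second_countable_topology}"
  assumes c: "c \<noteq> 0" and [measurable]: "f \<in> borel_measurable borel"
  shows "(\<integral>x. f x \<partial>lborel) = \<bar>c\<bar> ^ DIM('a) *\<^sub>R (\<integral>x. f (t + c *\<^sub>R x) \<partial>lborel)"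
  by (subst lborel_affine[OF c, of t]) (simp add: integral_density integral_distr)

lemma lborel_integrable_affine_iff:
  fixes f :: "'a::euclidean_space \<Rightarrow> 'b::{banach, second_countable_topology}"
  assumes c: "c \<noteq> 0" and [measurable]: "f \<in> borel_measurable borel"
  shows "integrable lborel (\<lambda>x. f (t + c *\<^sub>R x)) \<longleftrightarrow> integrable lborel f"
proof -
  have "integrable lborel f \<longleftrightarrow>
      integrable (density (distr lborel borel (\<lambda>x. t + c *\<^sub>R x)) (\<lambda>_. \<bar>c\<bar> ^ DIM('a))) f"
    using lborel_affine[OF c, of t] by simp
  also have "\<dots> \<longleftrightarrow> integrable lborel (\<lambda>x. f (t + c *\<^sub>R x))"
    using c integrable_scaleR_right[of "inverse (\<bar>c\<bar> ^ DIM('a))" lborel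
      "\<lambda>x. \<bar>c\<bar> ^ DIM('a) *\<^sub>R f (t + c *\<^sub>R x)"]
    by (subst integrable_density) (auto simp: integrable_distr_eq)
  finally show ?thesis by simp
qed

lemma lborel_integral_translate:
  fixes f :: "'a::euclidean_space \<Rightarrow> 'b::{banach, second_countable_topology}"
  assumes "f \<in> borel_measurable borel"
  shows "(\<integral>x. f (t + x) \<partial>lborel) = (\<integral>x. f x \<partial>lborel)"
  using lborel_integral_affine[of 1 f t] assms by simp

lemma lborel_integral_reflect:
  fixes f :: "'a::euclidean_space \<Rightarrow> 'b::{banach, second_countable_topology}"
  assumes "f \<in> borel_measurable borel"
  shows "(\<integral>x. f (- x) \<partial>lborel) = (\<integral>x. f x \<partial>lborel)"
  using lborel_integral_affine[of "-1" f 0] assms by simp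

text \<open>\<open>lborel\<close> is the image of the product measure over \<open>Basis\<close>.
  This reduces Gaussians and decay weights to one dimension.\<close>

lemma
  fixes f :: "'a::euclidean_space \<Rightarrow> real \<Rightarrow> 'c::{real_normed_field, banach, second_countable_topology}"
  assumes f: "\<And>b. b \<in> Basis \<Longrightarrow> integrable lborel (f b)"
  shows integrable_lborel_prod: "integrable lborel (\<lambda>x::'a. \<Prod>b\<in>Basis. f b (x \<bullet> b))"
    and integral_lborel_prod:
      "(\<integral>x. (\<Prod>b\<in>Basis. f b (x \<bullet> b)) \<partial>lborel) = (\<Prod>b\<in>(Basis :: 'a set). (\<integral>x. f b x \<partial>lborel))"
proof -
  interpret product_sigma_finite "\<lambda>_::'a. lborel :: real measure" by standard
  have [measurable]: "f b \<in> borel_measurable borel" if "b \<in> Basis" for b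
    using borel_measurable_integrable[OF f[OF that]] by simp
  have eq: "(\<Prod>b\<in>Basis. f b ((\<Sum>a\<in>Basis. x a *\<^sub>R a) \<bullet> b)) = (\<Prod>b\<in>Basis. f b (x b))" for x
    by (intro prod.cong refl) simp
  show "integrable lborel (\<lambda>x::'a. \<Prod>b\<in>Basis. f b (x \<bullet> b))"
    by (subst lborel_eq, subst integrable_distr_eq)
       (auto simp: eq intro!: product_integrable_prod f)
  show "(\<integral>x. (\<Prod>b\<in>Basis. f b (x \<bullet> b)) \<partial>lborel) = (\<Prod>b\<in>(Basis :: 'a set). (\<integral>x. f b x \<partial>lborel))"
    by (subst lborel_eq, subst integral_distr)
       (auto simp: eq intro!: product_integral_prod f)
qed

section \<open>The Gaussian and its Fourier transform\<close>

text \<open>With the factor \<open>pi\<close> in the exponent the Gaussian has integral 1 and equals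
  its own transform for the kernel \<open>cis (2 * pi * (x \<bullet> v))\<close>.\<close>

definition gauss :: "'a::euclidean_space \<Rightarrow> real" where
  "gauss x = exp (- pi * (norm x)\<^sup>2)"

lemma continuous_gauss [continuous_intros]: "continuous_on S (\<lambda>x. gauss x)"
  unfolding gauss_def by (intro continuous_intros)

lemma gauss_measurable [measurable]: "gauss \<in> borel_measurable borel"
  by (intro borel_measurable_continuous_onI continuous_intros)

lemma gauss_pos [simp]: "gauss x > 0" "gauss x \<ge> 0"
  by (simp_all add: gauss_def)

lemma gauss_le_1: "gauss x \<le> 1"
  by (simp add: gauss_def)

lemma gauss_0 [simp]: "gauss 0 = 1"
  by (simp add: gauss_def)

lemma gauss_minus [simp]: "gauss (- x) = gauss x"
  by (simp add: gauss_def)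

lemma std_normal_density_gauss:
  "std_normal_density (sqrt (2 * pi) * x) = gauss x / sqrt (2 * pi)"
  by (simp add: std_normal_density_def gauss_def power_mult_distrib)

lemma integrable_gauss_real: "integrable lborel (gauss :: real \<Rightarrow> real)"
proof -
  have "integrable lborel (\<lambda>x. std_normal_density (0 + sqrt (2 * pi) * x))"
    by (subst lborel_integrable_real_affine_iff) auto
  then have "integrable lborel (\<lambda>x. sqrt (2 * pi) * std_normal_density (sqrt (2 * pi) * x))"
    by simp
  then show ?thesis
    by (simp add: std_normal_density_gauss)
qed

text \<open>This is the characteristic function of the standard normal law after the substitution
  \<open>x \<mapsto> sqrt (2 * pi) * x\<close>.\<close>

lemma fourier_gauss_real:
  "(\<integral>x. cis (2 * pi * (x * v)) * of_real (gauss x) \<partial>lborel) = of_real (gauss (v::real))"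
proof -
  define c where "c = sqrt (2 * pi)"
  have c: "c > 0" "c * c = 2 * pi" "c\<^sup>2 = 2 * pi" by (simp_all add: c_def)
  have "of_real (gauss v) = complex_of_real (exp (- ((c * v)\<^sup>2) / 2))"
    by (simp add: gauss_def power_mult_distrib c)
  also have "\<dots> = char std_normal_distribution (c * v)"
    by (simp add: char_std_normal_distribution)
  also have "\<dots> = (\<integral>x. cis (c * v * x) * of_real (std_normal_density x) \<partial>lborel)"
    unfolding char_def
    by (subst integral_density) (auto simp: cis_conv_exp scaleR_conv_of_real mult_ac)
  also have "\<dots> = c *\<^sub>R (\<integral>x. cis (c * v * (c * x)) * of_real (std_normal_density (c * x)) \<partial>lborel)"
    using c by (subst lborel_integral_real_affine[where c = c and t = 0]) auto
  also have "\<dots> = (\<integral>x. c *\<^sub>R (cis (c * v * (c * x)) * of_real (std_normal_density (c * x))) \<partial>lborel)"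
    by simp
  also have "\<dots> = (\<integral>x. cis (2 * pi * (x * v)) * of_real (gauss x) \<partial>lborel)"
  proof (intro Bochner_Integration.integral_cong refl)
    fix x
    have "c * v * (c * x) = (c * c) * (x * v)"
      by (simp add: mult_ac)
    then have *: "c * v * (c * x) = 2 * pi * (x * v)"
      by (simp only: c(2))
    have "std_normal_density (c * x) = gauss x / c"
      using std_normal_density_gauss[of x] by (simp only: c_def)
    then show "c *\<^sub>R (cis (c * v * (c * x)) * of_real (std_normal_density (c * x)))
       = cis (2 * pi * (x * v)) * of_real (gauss x)"
      unfolding * using c(1) by (simp add: scaleR_conv_of_real)
  qed
  finally show ?thesis by simp
qed

lemma gauss_prod: "gauss (x::'a::euclidean_space) = (\<Prod>b\<in>Basis. gauss (x \<bullet> b))"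
proof -
  have "(norm x)\<^sup>2 = (\<Sum>b\<in>Basis. (x \<bullet> b)\<^sup>2)"
    unfolding power2_norm_eq_inner by (subst euclidean_inner) (simp add: power2_eq_square)
  then show ?thesis
    by (simp add: gauss_def exp_sum[symmetric] sum_distrib_left sum_negf)
qed

lemma integrable_gauss: "integrable lborel (gauss :: 'a::euclidean_space \<Rightarrow> real)"
proof -
  have "(gauss :: 'a \<Rightarrow> real) = (\<lambda>x. \<Prod>b\<in>Basis. gauss (x \<bullet> b))"
    by (rule ext) (rule gauss_prod)
  moreover have "integrable lborel (\<lambda>x::'a. \<Prod>b\<in>Basis. gauss (x \<bullet> b))"
    by (intro integrable_lborel_prod integrable_gauss_real)
  ultimately show ?thesis by simp
qed

lemma cis_sum: "finite A \<Longrightarrow> cis (sum f A) = (\<Prod>a\<in>A. cis (f a))"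
  by (induction A rule: finite_induct) (simp_all flip: cis_mult)

lemma integrable_cis_mult:
  assumes "integrable M \<phi>" and [measurable]: "f \<in> borel_measurable M"
  shows "integrable M (\<lambda>x. cis (f x) * \<phi> x)"
proof (rule Bochner_Integration.integrable_bound[OF assms(1)])
  have [measurable]: "\<phi> \<in> borel_measurable M" using assms by auto
  show "(\<lambda>x. cis (f x) * \<phi> x) \<in> borel_measurable M" by measurable
qed (simp add: norm_mult)

lemma fourier_gauss:
  "(\<integral>x. cis (2 * pi * (x \<bullet> v)) * of_real (gauss x) \<partial>lborel)
     = of_real (gauss (v::'a::euclidean_space))"
proof -
  have "(\<integral>x. cis (2 * pi * (x \<bullet> v)) * of_real (gauss x) \<partial>lborel)
     = (\<integral>x. (\<Prod>b\<in>Basis. cis (2 * pi * ((x \<bullet> b) * (v \<bullet> b))) * of_real (gauss (x \<bullet> b))) \<partial>lborel)"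
    by (intro Bochner_Integration.integral_cong refl)
       (subst euclidean_inner, subst gauss_prod,
        simp add: prod.distrib sum_distrib_left cis_sum)
  also have "\<dots> = (\<Prod>b\<in>(Basis::'a set).
      (\<integral>x. cis (2 * pi * (x * (v \<bullet> b))) * of_real (gauss x) \<partial>lborel))"
    using integrable_gauss_real
    by (intro integral_lborel_prod) (auto intro!: integrable_cis_mult)
  also have "\<dots> = of_real (gauss v)"
    by (simp only: fourier_gauss_real) (subst (2) gauss_prod, simp)
  finally show ?thesis .
qed

lemma integral_gauss [simp]: "(\<integral>x. gauss x \<partial>(lborel :: 'a::euclidean_space measure)) = 1"
proof -
  have "complex_of_real (\<integral>x. gauss x \<partial>(lborel :: 'a::euclidean_space measure)) = 1"
    using fourier_gauss[of "0::'a"] by (simp flip: integral_complex_of_real)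
  then show ?thesis by (simp only: of_real_eq_1_iff)
qed

lemma integrable_gauss_scaled:
  assumes "t \<noteq> 0"
  shows "integrable lborel (\<lambda>x::'a::euclidean_space. gauss (t *\<^sub>R x))"
  using lborel_integrable_affine_iff[of t "gauss :: 'a \<Rightarrow> real" 0] assms integrable_gauss by simp

lemma fourier_gauss_scaled:
  assumes t: "t > 0"
  shows "(\<integral>x. cis (2 * pi * (x \<bullet> v)) * of_real (gauss (inverse t *\<^sub>R x)) \<partial>lborel)
     = of_real (t ^ DIM('a) * gauss (t *\<^sub>R (v::'a::euclidean_space)))"
proof -
  have "(\<integral>x. cis (2 * pi * (x \<bullet> v)) * of_real (gauss (inverse t *\<^sub>R x)) \<partial>lborel)
    = t ^ DIM('a) *\<^sub>R (\<integral>x. cis (2 * pi * (x \<bullet> (t *\<^sub>R v))) * of_real (gauss x) \<partial>lborel)"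
    using t by (subst lborel_integral_affine[where c = t and t = 0]) auto
  then show ?thesis by (simp only: fourier_gauss) (simp add: scaleR_conv_of_real)
qed

section \<open>Gaussian smoothing and Fourier inversion\<close>

text \<open>An approximate identity, written after rescaling so that \<open>B * gauss y\<close>
  dominates for every \<open>n\<close>.\<close>

lemma gauss_average_tendsto:
  fixes \<phi> :: "'a::euclidean_space \<Rightarrow> complex"
  assumes cont: "continuous_on UNIV \<phi>" and B: "\<And>x. norm (\<phi> x) \<le> B"
  shows "(\<lambda>n. \<integral>y. \<phi> (x + inverse (real (Suc n)) *\<^sub>R y) * of_real (gauss y) \<partial>lborel) \<longlonglongrightarrow> \<phi> x"
proof -
  have [measurable]: "\<phi> \<in> borel_measurable borel"
    using cont by (rule borel_measurable_continuous_onI)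
  have "(\<lambda>n. \<integral>y. \<phi> (x + inverse (real (Suc n)) *\<^sub>R y) * of_real (gauss y) \<partial>lborel)
     \<longlonglongrightarrow> (\<integral>y. \<phi> x * of_real (gauss y) \<partial>(lborel :: 'a measure))"
  proof (rule integral_dominated_convergence)
    show "integrable lborel (\<lambda>x::'a. B * gauss x)"
      using integrable_gauss[where 'a = 'a] by simp
    show "AE y in lborel. (\<lambda>n. \<phi> (x + inverse (real (Suc n)) *\<^sub>R y) * of_real (gauss y))
        \<longlonglongrightarrow> \<phi> x * of_real (gauss y)"
    proof (rule AE_I2, intro tendsto_intros)
      fix y
      have "(\<lambda>n. x + inverse (real (Suc n)) *\<^sub>R y) \<longlonglongrightarrow> x + 0 *\<^sub>R y"
        by (intro tendsto_intros LIMSEQ_inverse_real_of_nat)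
      then show "(\<lambda>n. \<phi> (x + inverse (real (Suc n)) *\<^sub>R y)) \<longlonglongrightarrow> \<phi> x"
        using cont by (intro continuous_on_tendsto_compose[OF cont]) auto
    qed
    show "AE y in lborel. norm (\<phi> (x + inverse (real (Suc n)) *\<^sub>R y) * of_real (gauss y)) \<le> B * gauss y" for n
      using B by (intro AE_I2) (auto simp: norm_mult intro!: mult_right_mono)
  qed measurable
  then show ?thesis
    by simp
qed

lemma fourier_eq_cis:
  "fourier \<phi> v = (\<integral>x. cis (- 2 * pi * (x \<bullet> v)) * \<phi> x \<partial>lborel)"
  unfolding fourier_def by (simp add: cis_conv_exp mult_ac)

lemma gauss_smoothing_tendsto:
  fixes \<phi> :: "'a::euclidean_space \<Rightarrow> complex"
  assumes "integrable lborel \<phi>"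
  shows "(\<lambda>n. \<integral>x. of_real (gauss (inverse (real (Suc n)) *\<^sub>R x)) * \<phi> x \<partial>lborel)
    \<longlonglongrightarrow> (\<integral>x. \<phi> x \<partial>lborel)"
proof (rule integral_dominated_convergence)
  have [measurable]: "\<phi> \<in> borel_measurable borel"
    using borel_measurable_integrable[OF assms] by simp
  show "(\<lambda>x. of_real (gauss (inverse (real (Suc n)) *\<^sub>R x)) * \<phi> x) \<in> borel_measurable lborel" for n
    by measurable
  show "\<phi> \<in> borel_measurable lborel" by measurable
  show "integrable lborel (\<lambda>x. norm (\<phi> x))" using assms by simp
  show "AE x in lborel. (\<lambda>n. of_real (gauss (inverse (real (Suc n)) *\<^sub>R x)) * \<phi> x) \<longlonglongrightarrow> \<phi> x"
  proof (rule AE_I2)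
    fix x
    have "(\<lambda>n. of_real (gauss (inverse (real (Suc n)) *\<^sub>R x)) * \<phi> x)
      \<longlonglongrightarrow> of_real (gauss (0 *\<^sub>R x)) * \<phi> x"
      unfolding gauss_def by (intro tendsto_intros LIMSEQ_inverse_real_of_nat)
    then show "(\<lambda>n. of_real (gauss (inverse (real (Suc n)) *\<^sub>R x)) * \<phi> x) \<longlonglongrightarrow> \<phi> x" by simp
  qed
  show "AE x in lborel. norm (of_real (gauss (inverse (real (Suc n)) *\<^sub>R x)) * \<phi> x) \<le> norm (\<phi> x)" for n
    by (intro AE_I2) (auto simp: norm_mult gauss_le_1 intro!: mult_left_le_one_le)
qed

text \<open>The cut-off makes the double integral absolutely convergent, and its own transform is a
  Gaussian concentrated near \<open>x\<close>. Only \<open>\<phi>\<close> has to be integrable, so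
  the identity serves for inversion and later for windowed positive definite functions
  alike.\<close>

lemma integral_fourier_gauss:
  fixes \<phi> :: "'a::euclidean_space \<Rightarrow> complex"
  assumes int: "integrable lborel \<phi>" and t: "t > 0"
  shows "(\<integral>v. cis (2 * pi * (x \<bullet> v)) * of_real (gauss (inverse t *\<^sub>R v)) * fourier \<phi> v \<partial>lborel)
    = (\<integral>y. \<phi> (x + inverse t *\<^sub>R y) * of_real (gauss y) \<partial>lborel)"
proof -
  have [measurable]: "\<phi> \<in> borel_measurable borel"
    using borel_measurable_integrable[OF int] by simp
  have gi: "integrable lborel (\<lambda>v::'a. complex_of_real (gauss (inverse t *\<^sub>R v)))"
    using integrable_gauss_scaled[of "inverse t", where 'a = 'a] t by auto
  have "(\<integral>v. cis (2 * pi * (x \<bullet> v)) * of_real (gauss (inverse t *\<^sub>R v)) * fourier \<phi> v \<partial>lborel)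
    = (\<integral>v. (\<integral>z. cis (2 * pi * (v \<bullet> (x - z))) * of_real (gauss (inverse t *\<^sub>R v)) * \<phi> z \<partial>lborel) \<partial>lborel)"
  proof (intro Bochner_Integration.integral_cong refl)
    fix v
    have "cis (2 * pi * (x \<bullet> v)) * of_real (gauss (inverse t *\<^sub>R v)) * fourier \<phi> v
       = (\<integral>z. cis (2 * pi * (x \<bullet> v)) * of_real (gauss (inverse t *\<^sub>R v)) *
            (cis (- 2 * pi * (z \<bullet> v)) * \<phi> z) \<partial>lborel)"
      unfolding fourier_eq_cis by simp
    also have "\<dots> = (\<integral>z. cis (2 * pi * (v \<bullet> (x - z))) * of_real (gauss (inverse t *\<^sub>R v)) * \<phi> z \<partial>lborel)"
    proof (intro Bochner_Integration.integral_cong refl)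
      fix z
      have eq: "cis (2 * pi * (x \<bullet> v)) * cis (- 2 * pi * (z \<bullet> v)) = cis (2 * pi * (v \<bullet> (x - z)))"
        by (simp add: cis_mult inner_diff_right inner_commute algebra_simps)
      show "cis (2 * pi * (x \<bullet> v)) * of_real (gauss (inverse t *\<^sub>R v)) *
            (cis (- 2 * pi * (z \<bullet> v)) * \<phi> z)
          = cis (2 * pi * (v \<bullet> (x - z))) * of_real (gauss (inverse t *\<^sub>R v)) * \<phi> z"
        unfolding eq[symmetric] by (simp only: mult_ac)
    qed
    finally show "cis (2 * pi * (x \<bullet> v)) * of_real (gauss (inverse t *\<^sub>R v)) * fourier \<phi> v = \<dots>" .
  qed
  also have "\<dots> = (\<integral>z. (\<integral>v. cis (2 * pi * (v \<bullet> (x - z))) * of_real (gauss (inverse t *\<^sub>R v)) * \<phi> z \<partial>lborel) \<partial>lborel)"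
    by (rule lborel_pair.Fubini_kernel[OF gi int, where B = 1]) auto
  also have "\<dots> = (\<integral>z. of_real (t ^ DIM('a) * gauss (t *\<^sub>R (x - z))) * \<phi> z \<partial>lborel)"
    using t by (subst fourier_gauss_scaled[symmetric]) auto
  \<comment> \<open>Substitute \<open>z = x + y / t\<close>; the Jacobian cancels the factor
    \<open>t ^ DIM('a)\<close> of the transformed cut-off.\<close>
  also have "\<dots> = inverse t ^ DIM('a) *\<^sub>R
      (\<integral>y. of_real (t ^ DIM('a) * gauss (t *\<^sub>R (x - (x + inverse t *\<^sub>R y)))) * \<phi> (x + inverse t *\<^sub>R y) \<partial>lborel)"
    using t by (subst lborel_integral_affine[where c = "inverse t" and t = x]) auto
  also have "\<dots> = (\<integral>y. inverse t ^ DIM('a) *\<^sub>R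
      (of_real (t ^ DIM('a) * gauss (t *\<^sub>R (x - (x + inverse t *\<^sub>R y)))) * \<phi> (x + inverse t *\<^sub>R y)) \<partial>lborel)"
    by simp
  also have "\<dots> = (\<integral>y. \<phi> (x + inverse t *\<^sub>R y) * of_real (gauss y) \<partial>lborel)"
    using t by (intro Bochner_Integration.integral_cong refl)
      (simp add: scaleR_conv_of_real field_simps)
  finally show ?thesis .
qed

theorem fourier_inversion:
  fixes \<phi> :: "'a::euclidean_space \<Rightarrow> complex"
  assumes int: "integrable lborel \<phi>" and cont: "continuous_on UNIV \<phi>" and B: "\<And>x. norm (\<phi> x) \<le> B"
    and intF: "integrable lborel (fourier \<phi>)"
  shows "(\<integral>v. cis (2 * pi * (x \<bullet> v)) * fourier \<phi> v \<partial>lborel) = \<phi> x"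
proof (rule LIMSEQ_unique)
  show "(\<lambda>n. \<integral>y. \<phi> (x + inverse (real (Suc n)) *\<^sub>R y) * of_real (gauss y) \<partial>lborel) \<longlonglongrightarrow> \<phi> x"
    by (rule gauss_average_tendsto[OF cont B])
  have "(\<lambda>n. \<integral>v. of_real (gauss (inverse (real (Suc n)) *\<^sub>R v)) * (cis (2 * pi * (x \<bullet> v)) * fourier \<phi> v) \<partial>lborel)
     \<longlonglongrightarrow> (\<integral>v. cis (2 * pi * (x \<bullet> v)) * fourier \<phi> v \<partial>lborel)"
    by (rule gauss_smoothing_tendsto) (auto intro!: integrable_cis_mult intF)
  moreover have "(\<integral>v. of_real (gauss (inverse (real (Suc n)) *\<^sub>R v)) * (cis (2 * pi * (x \<bullet> v)) * fourier \<phi> v) \<partial>lborel)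
     = (\<integral>y. \<phi> (x + inverse (real (Suc n)) *\<^sub>R y) * of_real (gauss y) \<partial>lborel)" for n
    by (subst integral_fourier_gauss[OF int, symmetric]) (auto simp: mult_ac)
  ultimately show "(\<lambda>n. \<integral>y. \<phi> (x + inverse (real (Suc n)) *\<^sub>R y) * of_real (gauss y) \<partial>lborel)
     \<longlonglongrightarrow> (\<integral>v. cis (2 * pi * (x \<bullet> v)) * fourier \<phi> v \<partial>lborel)"
    by simp
qed

section \<open>Schwartz functions and the Fourier transform\<close>

definition rapidly_decreasing :: "('a::real_normed_vector \<Rightarrow> complex) \<Rightarrow> bool" where
  "rapidly_decreasing \<phi> \<longleftrightarrow> (\<forall>k::nat. \<exists>B. \<forall>x. (1 + norm x) ^ k * norm (\<phi> x) \<le> B)"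

lemma rapidly_decreasing_iff_bounded:
  "rapidly_decreasing \<phi> \<longleftrightarrow> (\<forall>k::nat. bounded (range (\<lambda>x. (1 + norm x) ^ k * norm (\<phi> x))))"
proof -
  have *: "bounded (range f) \<longleftrightarrow> (\<exists>B. \<forall>x. f x \<le> B)" if "\<And>x. f x \<ge> 0" for f :: "'a \<Rightarrow> real"
    unfolding bounded_iff using that by simp
  show ?thesis
    unfolding rapidly_decreasing_def by (subst *) auto
qed

lemma rapidly_decreasingE:
  assumes "rapidly_decreasing \<phi>"
  obtains B where "B \<ge> 0" "\<And>x. (1 + norm x) ^ k * norm (\<phi> x) \<le> B"
proof -
  obtain B where B: "\<And>x. (1 + norm x) ^ k * norm (\<phi> x) \<le> B"
    using assms unfolding rapidly_decreasing_def by blast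
  have "B \<ge> 0" by (rule order_trans[OF _ B[of undefined]]) simp
  then show thesis using B that by blast
qed

lemma rapidly_decreasing_lincomb:
  assumes "rapidly_decreasing \<phi>" "rapidly_decreasing \<psi>"
  shows "rapidly_decreasing (\<lambda>x. a * \<phi> x + c * \<psi> x)"
  unfolding rapidly_decreasing_def
proof
  fix k :: nat
  obtain A B where AB: "\<And>x. (1 + norm x) ^ k * norm (\<phi> x) \<le> A" "\<And>x. (1 + norm x) ^ k * norm (\<psi> x) \<le> B"
    using assms unfolding rapidly_decreasing_def by metis
  have "(1 + norm x) ^ k * norm (a * \<phi> x + c * \<psi> x) \<le> norm a * A + norm c * B" for x
  proof -
    have "(1 + norm x) ^ k * norm (a * \<phi> x + c * \<psi> x)
        \<le> (1 + norm x) ^ k * (norm a * norm (\<phi> x) + norm c * norm (\<psi> x))"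
      using norm_triangle_ineq[of "a * \<phi> x" "c * \<psi> x"]
      by (intro mult_left_mono) (auto simp: norm_mult)
    also have "\<dots> = norm a * ((1 + norm x) ^ k * norm (\<phi> x)) + norm c * ((1 + norm x) ^ k * norm (\<psi> x))"
      by (simp add: algebra_simps)
    also have "\<dots> \<le> norm a * A + norm c * B"
      by (intro add_mono mult_left_mono AB) auto
    finally show ?thesis .
  qed
  then show "\<exists>B. \<forall>x. (1 + norm x) ^ k * norm (a * \<phi> x + c * \<psi> x) \<le> B"
    by blast
qed

lemma rapidly_decreasing_mult:
  assumes \<phi>: "rapidly_decreasing \<phi>" and p: "\<And>x. norm (p x) \<le> 1 + norm x"
  shows "rapidly_decreasing (\<lambda>x. p x * \<phi> x)"
  unfolding rapidly_decreasing_def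
proof
  fix k :: nat
  obtain B where B: "\<And>x. (1 + norm x) ^ Suc k * norm (\<phi> x) \<le> B"
    using \<phi> unfolding rapidly_decreasing_def by metis
  have "(1 + norm x) ^ k * norm (p x * \<phi> x) \<le> B" for x
  proof -
    have "(1 + norm x) ^ k * norm (p x * \<phi> x) \<le> (1 + norm x) ^ k * ((1 + norm x) * norm (\<phi> x))"
      unfolding norm_mult using p by (intro mult_left_mono mult_right_mono) auto
    also have "\<dots> \<le> B" using B[of x] by (simp add: mult_ac)
    finally show ?thesis .
  qed
  then show "\<exists>B. \<forall>x. (1 + norm x) ^ k * norm (p x * \<phi> x) \<le> B" by blast
qed

section \<open>Closure properties of the Schwartz space\<close>

lemma partial_deriv_eqI:
  assumes "(\<phi> has_derivative D) (at x)"
  shows "partial_deriv b \<phi> x = D b"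
  using frechet_derivative_at[OF assms] by (simp add: partial_deriv_def)

text \<open>The Schwartz space is the largest class of differentiable, rapidly decreasing functions
  that is closed under partial derivatives. To place a function in it, a class containing it is
  exhibited, in place of formulas for its iterated derivatives.\<close>

lemma schwartz_coinduct:
  assumes diff: "\<And>\<phi> x. \<phi> \<in> C \<Longrightarrow> \<phi> differentiable (at x)"
    and rapid: "\<And>\<phi>. \<phi> \<in> C \<Longrightarrow> rapidly_decreasing \<phi>"
    and closed: "\<And>\<phi> b. \<phi> \<in> C \<Longrightarrow> b \<in> Basis \<Longrightarrow> partial_deriv b \<phi> \<in> C"
  shows "C \<subseteq> schwartz"
proof
  fix \<phi> assume "\<phi> \<in> C"
  have "partial_derivs bs \<phi> \<in> C" if "bs \<in> lists Basis" for bs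
    using that by (induction bs) (auto simp: partial_derivs_def \<open>\<phi> \<in> C\<close> closed)
  then show "\<phi> \<in> schwartz"
    unfolding schwartz_def rapidly_decreasing_iff_bounded[symmetric]
    using diff rapid by (auto simp: differentiable_on_def differentiable_at_withinI)
qed

lemma schwartz_differentiable: "\<phi> \<in> schwartz \<Longrightarrow> \<phi> differentiable (at x)"
  unfolding schwartz_def differentiable_on_def
  by (force simp: partial_derivs_def dest: bspec[of _ _ "[]"])

lemma schwartz_rapidly_decreasing: "\<phi> \<in> schwartz \<Longrightarrow> rapidly_decreasing \<phi>"
  unfolding schwartz_def rapidly_decreasing_iff_bounded
  by (auto simp: partial_derivs_def dest: bspec[of _ _ "[]"])

lemma schwartz_partial_deriv:
  assumes "\<phi> \<in> schwartz" "b \<in> Basis" shows "partial_deriv b \<phi> \<in> schwartz"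
proof -
  have "partial_derivs bs (partial_deriv b \<phi>) = partial_derivs (bs @ [b]) \<phi>" for bs
    by (simp add: partial_derivs_def)
  then show ?thesis
    using assms by (auto simp: schwartz_def)
qed

lemma schwartz_has_derivative:
  "\<phi> \<in> schwartz \<Longrightarrow> (\<phi> has_derivative frechet_derivative \<phi> (at x)) (at x)"
  using schwartz_differentiable frechet_derivative_works by blast

lemma schwartz_continuous: "\<phi> \<in> schwartz \<Longrightarrow> continuous_on S \<phi>"
  by (meson continuous_at_imp_continuous_on differentiable_imp_continuous_within schwartz_differentiable)

lemma schwartz_measurable: "\<phi> \<in> schwartz \<Longrightarrow> \<phi> \<in> borel_measurable borel"
  by (intro borel_measurable_continuous_onI schwartz_continuous)

lemma schwartz_bounded:
  assumes "\<phi> \<in> schwartz"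
  obtains B where "\<And>x. norm (\<phi> x) \<le> B"
  using rapidly_decreasingE[OF schwartz_rapidly_decreasing[OF assms], of 0] by auto

lemma schwartz_lincomb:
  assumes "\<phi> \<in> schwartz" "\<psi> \<in> schwartz"
  shows "(\<lambda>x. a * \<phi> x + c * \<psi> x) \<in> schwartz"
proof -
  define C where "C = {\<lambda>x. a * \<phi> x + c * \<psi> x |\<phi> \<psi>. \<phi> \<in> schwartz \<and> \<psi> \<in> (schwartz :: ('a \<Rightarrow> complex) set)}"
  have "C \<subseteq> schwartz"
  proof (rule schwartz_coinduct)
    fix \<theta> and x b :: 'a assume "\<theta> \<in> C"
    then obtain \<phi> \<psi> where \<theta>: "\<theta> = (\<lambda>x. a * \<phi> x + c * \<psi> x)" and S: "\<phi> \<in> schwartz" "\<psi> \<in> schwartz"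
      unfolding C_def by auto
    have D: "(\<theta> has_derivative (\<lambda>h. a * frechet_derivative \<phi> (at x) h + c * frechet_derivative \<psi> (at x) h)) (at x)" for x
      unfolding \<theta> by (intro derivative_intros S schwartz_has_derivative)
    show "\<theta> differentiable (at x)" using D differentiable_def by blast
    show "rapidly_decreasing \<theta>"
      unfolding \<theta> by (intro rapidly_decreasing_lincomb schwartz_rapidly_decreasing S)
    assume b: "b \<in> Basis"
    have "partial_deriv b \<theta> = (\<lambda>x. a * partial_deriv b \<phi> x + c * partial_deriv b \<psi> x)"
      by (rule ext) (simp add: partial_deriv_eqI[OF D], simp add: partial_deriv_def)
    then show "partial_deriv b \<theta> \<in> C"
      unfolding C_def using S b schwartz_partial_deriv by blast
  qed
  then show ?thesis using assms unfolding C_def by blast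
qed

lemma schwartz_scale: "\<phi> \<in> schwartz \<Longrightarrow> (\<lambda>x. c * \<phi> x) \<in> schwartz"
  using schwartz_lincomb[of \<phi> \<phi> c 0] by simp

lemma schwartz_coordinate_mult:
  assumes "\<phi> \<in> schwartz" "b \<in> Basis"
  shows "(\<lambda>x. of_real (x \<bullet> b) * \<phi> x) \<in> schwartz"
proof -
  \<comment> \<open>The free summand \<open>\<psi>\<close> makes the class closed: the product rule
    yields a coordinate times a derivative of \<open>\<phi>\<close>, plus a multiple of
    \<open>\<phi>\<close> itself.\<close>
  define C where "C = {\<lambda>x. of_real (x \<bullet> b) * \<phi> x + \<psi> x |\<phi> \<psi>. \<phi> \<in> schwartz \<and> \<psi> \<in> (schwartz :: ('a \<Rightarrow> complex) set)}"
  have "C \<subseteq> schwartz"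
  proof (rule schwartz_coinduct)
    fix \<theta> and x c :: 'a assume "\<theta> \<in> C"
    then obtain \<phi> \<psi> where \<theta>: "\<theta> = (\<lambda>x. of_real (x \<bullet> b) * \<phi> x + \<psi> x)" and S: "\<phi> \<in> schwartz" "\<psi> \<in> schwartz"
      unfolding C_def by auto
    have D: "(\<theta> has_derivative (\<lambda>h. of_real (x \<bullet> b) * frechet_derivative \<phi> (at x) h
        + of_real (h \<bullet> b) * \<phi> x + frechet_derivative \<psi> (at x) h)) (at x)" for x
      unfolding \<theta> by (auto intro!: derivative_eq_intros S schwartz_has_derivative)
    show "\<theta> differentiable (at x)" using D differentiable_def by blast
    have r1: "rapidly_decreasing (\<lambda>x. of_real (x \<bullet> b) * \<phi> x)"
      using Basis_le_norm[OF assms(2)]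
      by (intro rapidly_decreasing_mult schwartz_rapidly_decreasing S) (auto simp: add_increasing)
    show "rapidly_decreasing \<theta>"
      unfolding \<theta> using rapidly_decreasing_lincomb[OF r1 schwartz_rapidly_decreasing[OF S(2)], of 1 1] by simp
    assume c: "c \<in> Basis"
    have "partial_deriv c \<theta> = (\<lambda>x. of_real (x \<bullet> b) * partial_deriv c \<phi> x
        + (of_real (c \<bullet> b) * \<phi> x + 1 * partial_deriv c \<psi> x))"
      by (rule ext) (simp add: partial_deriv_eqI[OF D], simp add: partial_deriv_def)
    then show "partial_deriv c \<theta> \<in> C"
      unfolding C_def using S schwartz_partial_deriv[OF _ c]
      by (intro CollectI exI[of _ "partial_deriv c \<phi>"]
          exI[of _ "\<lambda>x. of_real (c \<bullet> b) * \<phi> x + 1 * partial_deriv c \<psi> x"] conjI schwartz_lincomb) auto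
  qed
  moreover have "(\<lambda>x. of_real (x \<bullet> b) * \<phi> x + 0 * \<phi> x) \<in> C"
    unfolding C_def using assms(1) schwartz_scale[OF assms(1), of 0]
    by (intro CollectI exI[of _ \<phi>] exI[of _ "\<lambda>x. 0 * \<phi> x"]) auto
  ultimately show ?thesis by auto
qed

lemma schwartz_reflect:
  assumes "\<phi> \<in> schwartz" shows "(\<lambda>x. \<phi> (- x)) \<in> schwartz"
proof -
  define C where "C = {\<lambda>x. \<phi> (- x) |\<phi>. \<phi> \<in> (schwartz :: ('a \<Rightarrow> complex) set)}"
  have "C \<subseteq> schwartz"
  proof (rule schwartz_coinduct)
    fix \<theta> and x b :: 'a assume "\<theta> \<in> C"
    then obtain \<phi> where \<theta>: "\<theta> = (\<lambda>x. \<phi> (- x))" and S: "\<phi> \<in> schwartz"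
      unfolding C_def by auto
    have D: "(\<theta> has_derivative (\<lambda>h. frechet_derivative \<phi> (at (- x)) (- h))) (at x)" for x
      unfolding \<theta>
      by (rule has_derivative_compose[of uminus uminus, OF _ schwartz_has_derivative[OF S]])
         (auto intro!: derivative_eq_intros)
    show "\<theta> differentiable (at x)" using D differentiable_def by blast
    show "rapidly_decreasing \<theta>"
      using schwartz_rapidly_decreasing[OF S] unfolding \<theta> rapidly_decreasing_def
      by (metis norm_minus_cancel)
    assume b: "b \<in> Basis"
    have "frechet_derivative \<phi> (at y) (- b) = - frechet_derivative \<phi> (at y) b" for y
      using has_derivative_bounded_linear[OF schwartz_has_derivative[OF S]]
      by (simp add: linear_simps)
    then have "partial_deriv b \<theta> = (\<lambda>x. - 1 * partial_deriv b \<phi> (- x))"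
      by (intro ext) (simp add: partial_deriv_eqI[OF D], simp add: partial_deriv_def)
    then show "partial_deriv b \<theta> \<in> C"
      unfolding C_def using schwartz_scale[OF schwartz_partial_deriv[OF S b], of "-1"]
      by (intro CollectI exI[of _ "\<lambda>x. - 1 * partial_deriv b \<phi> x"]) simp
  qed
  then show ?thesis using assms unfolding C_def by blast
qed

section \<open>Integrability by decay\<close>

text \<open>Each coordinate satisfies \<open>1 + (x \<bullet> b)^2 \<le> (1 + norm x)^2\<close>, so
  two powers per dimension are enough to be dominated by a product of one-dimensional functions
  \<open>1 / (1 + t^2)\<close>.\<close>

lemma integrable_weight:
  "integrable lborel (\<lambda>x::'a::euclidean_space. 1 / (1 + norm x) ^ (2 * DIM('a)))"
proof -
  have "integrable lborel (\<lambda>x::real. 1 / (1 + x\<^sup>2))"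
    using integrable_inverse_1_plus_square
    by (simp add: set_integrable_def einterval_eq inverse_eq_divide)
  then have *: "integrable lborel (\<lambda>x::'a. \<Prod>b\<in>Basis. 1 / (1 + (x \<bullet> b)\<^sup>2))"
    by (intro integrable_lborel_prod)
  show ?thesis
  proof (rule Bochner_Integration.integrable_bound[OF *], simp, rule AE_I2)
    fix x :: 'a
    have "1 / (1 + norm x) ^ (2 * DIM('a)) = (\<Prod>b\<in>(Basis::'a set). 1 / (1 + norm x)\<^sup>2)"
      by (simp add: power_mult power_one_over)
    also have "\<dots> \<le> (\<Prod>b\<in>Basis. 1 / (1 + (x \<bullet> b)\<^sup>2))"
    proof (intro prod_mono conjI divide_left_mono)
      fix b :: 'a assume "b \<in> Basis"
      then have "(x \<bullet> b)\<^sup>2 \<le> (norm x)\<^sup>2"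
        using Basis_le_norm[of b x] by (metis norm_ge_zero power2_abs power_mono abs_ge_zero)
      then show "1 + (x \<bullet> b)\<^sup>2 \<le> (1 + norm x)\<^sup>2"
        by (simp add: power2_sum) (smt (verit) norm_ge_zero)
      show "0 < (1 + norm x)\<^sup>2 * (1 + (x \<bullet> b)\<^sup>2)"
        by (intro mult_pos_pos zero_less_power add_pos_nonneg) auto
    qed auto
    finally show "norm (1 / (1 + norm x) ^ (2 * DIM('a))) \<le> norm (\<Prod>b\<in>Basis. 1 / (1 + (x \<bullet> b)\<^sup>2))"
      by (simp add: abs_of_nonneg prod_nonneg)
  qed
qed

lemma integrable_weight_bound:
  fixes f :: "'a::euclidean_space \<Rightarrow> 'b::{banach, second_countable_topology}"
  assumes "f \<in> borel_measurable borel" and B: "\<And>x. (1 + norm x) ^ (2 * DIM('a)) * norm (f x) \<le> B"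
  shows "integrable lborel f"
proof (rule Bochner_Integration.integrable_bound)
  show "integrable lborel (\<lambda>x::'a. B * (1 / (1 + norm x) ^ (2 * DIM('a))))"
    using integrable_weight by (rule integrable_mult_right)
  show "AE x in lborel. norm (f x) \<le> norm (B * (1 / (1 + norm x) ^ (2 * DIM('a))))"
  proof (rule AE_I2)
    fix x :: 'a
    have "0 < (1 + norm x) ^ (2 * DIM('a))" by (simp add: add_pos_nonneg)
    then have "norm (f x) \<le> B * (1 / (1 + norm x) ^ (2 * DIM('a)))"
      using B[of x] by (simp add: field_simps)
    then show "norm (f x) \<le> norm (B * (1 / (1 + norm x) ^ (2 * DIM('a))))"
      by (simp only: real_norm_def)
  qed
qed (use assms in simp)

lemma schwartz_integrable_weighted:
  fixes \<phi> :: "'a::euclidean_space \<Rightarrow> complex"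
  assumes "\<phi> \<in> schwartz"
  shows "integrable lborel (\<lambda>x. (1 + norm x) ^ k * norm (\<phi> x))"
proof -
  obtain B where B: "\<And>x. (1 + norm x) ^ (2 * DIM('a) + k) * norm (\<phi> x) \<le> B"
    using rapidly_decreasingE[OF schwartz_rapidly_decreasing[OF assms]] by metis
  note [measurable] = schwartz_measurable[OF assms]
  show ?thesis
    by (rule integrable_weight_bound[where B = B]) (use B in \<open>auto simp: power_add mult_ac\<close>)
qed

lemma schwartz_integrable:
  assumes "\<phi> \<in> schwartz" shows "integrable lborel \<phi>"
  using schwartz_integrable_weighted[OF assms, of 0] schwartz_measurable[OF assms]
  by (simp add: integrable_norm_iff)

section \<open>The Fourier transform on the Schwartz space\<close>

lemma has_derivative_quadratic:
  assumes D: "bounded_linear D" and K: "\<And>h. norm (f (x + h) - f x - D h) \<le> K * (norm h)\<^sup>2"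
  shows "(f has_derivative D) (at x)"
  unfolding has_derivative_at_alt
proof (intro conjI D allI impI)
  fix e :: real assume "e > 0"
  have "norm (f y - f x - D (y - x)) \<le> e * norm (y - x)" if "norm (y - x) < e / (\<bar>K\<bar> + 1)" for y
  proof -
    have "norm (f y - f x - D (y - x)) \<le> K * (norm (y - x))\<^sup>2"
      using K[of "y - x"] by simp
    also have "\<dots> \<le> (\<bar>K\<bar> + 1) * norm (y - x) * norm (y - x)"
      by (simp add: power2_eq_square mult.assoc mult_right_mono)
    also have "\<dots> \<le> e * norm (y - x)"
      using that by (intro mult_right_mono) (auto simp: field_simps)
    finally show ?thesis .
  qed
  then show "\<exists>d>0. \<forall>y. norm (y - x) < d \<longrightarrow> norm (f y - f x - D (y - x)) \<le> e * norm (y - x)"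
    using \<open>e > 0\<close> by (intro exI[of _ "e / (\<bar>K\<bar> + 1)"]) auto
qed

lemma norm_cis_minus_linear: "norm (cis t - 1 - \<i> * of_real t) \<le> t\<^sup>2"
  using iexp_approx1[of t 1] by (simp add: cis_conv_exp power2_eq_square algebra_simps)
    (smt (verit) norm_ge_zero abs_mult_self_eq)

text \<open>The second-order estimate of \<open>cis\<close> bounds the remainder by a second moment
  of \<open>\<phi>\<close> times \<open>(norm h)^2\<close>, so differentiability follows from an
  inequality between integrals, with no limit taken inside one.\<close>

lemma fourier_has_derivative:
  fixes \<phi> :: "'a::euclidean_space \<Rightarrow> complex"
  assumes S: "\<phi> \<in> schwartz"
  shows "(fourier \<phi> has_derivative
    (\<lambda>h. \<Sum>b\<in>Basis. of_real (h \<bullet> b) * (- 2 * pi * \<i> * fourier (\<lambda>x. of_real (x \<bullet> b) * \<phi> x) v))) (at v)"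
proof (rule has_derivative_quadratic)
  show "bounded_linear (\<lambda>h. \<Sum>b\<in>Basis. complex_of_real (h \<bullet> b) *
      (- 2 * pi * \<i> * fourier (\<lambda>x. complex_of_real (x \<bullet> b) * \<phi> x) v))"
    by (intro bounded_linear_sum bounded_linear_compose[OF bounded_linear_mult_left]
        bounded_linear_compose[OF bounded_linear_of_real] bounded_linear_inner_left)
  fix h :: 'a
  note [measurable] = schwartz_measurable[OF S]
  have int: "integrable lborel (\<lambda>x. cis (- 2 * pi * (x \<bullet> v)) * \<phi> x)" for v
    by (intro integrable_cis_mult schwartz_integrable S) auto
  have intb: "integrable lborel (\<lambda>x. cis (- 2 * pi * (x \<bullet> v)) * (of_real (x \<bullet> b) * \<phi> x))" if "b \<in> Basis" for v b
    by (intro integrable_cis_mult schwartz_integrable schwartz_coordinate_mult S that) auto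
  have inth: "integrable lborel (\<lambda>x. (- 2 * pi * \<i>) * (cis (- 2 * pi * (x \<bullet> v)) * (of_real (x \<bullet> h) * \<phi> x)))"
    and Dh: "(\<Sum>b\<in>Basis. of_real (h \<bullet> b) * (- 2 * pi * \<i> * fourier (\<lambda>x. of_real (x \<bullet> b) * \<phi> x) v))
     = (\<integral>x. (- 2 * pi * \<i>) * (cis (- 2 * pi * (x \<bullet> v)) * (of_real (x \<bullet> h) * \<phi> x)) \<partial>lborel)"
  proof -
    have eq: "(- 2 * pi * \<i>) * (cis (- 2 * pi * (x \<bullet> v)) * (of_real (x \<bullet> h) * \<phi> x))
       = (\<Sum>b\<in>Basis. of_real (h \<bullet> b) * (- 2 * pi * \<i>) * (cis (- 2 * pi * (x \<bullet> v)) * (of_real (x \<bullet> b) * \<phi> x)))" for x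
      by (subst (2) euclidean_inner) (simp add: sum_distrib_left sum_distrib_right mult_ac)
    show "integrable lborel (\<lambda>x. (- 2 * pi * \<i>) * (cis (- 2 * pi * (x \<bullet> v)) * (of_real (x \<bullet> h) * \<phi> x)))"
      unfolding eq using intb by (intro Bochner_Integration.integrable_sum integrable_mult_right) auto
    show "(\<Sum>b\<in>Basis. of_real (h \<bullet> b) * (- 2 * pi * \<i> * fourier (\<lambda>x. of_real (x \<bullet> b) * \<phi> x) v))
     = (\<integral>x. (- 2 * pi * \<i>) * (cis (- 2 * pi * (x \<bullet> v)) * (of_real (x \<bullet> h) * \<phi> x)) \<partial>lborel)"
      unfolding eq fourier_eq_cis
      using intb
      by (subst Bochner_Integration.integral_sum)
        (auto intro!: integrable_mult_right simp del: of_real_mult simp: mult.assoc)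
  qed
  have eq: "fourier \<phi> (v + h) - fourier \<phi> v -
      (\<Sum>b\<in>Basis. of_real (h \<bullet> b) * (- 2 * pi * \<i> * fourier (\<lambda>x. of_real (x \<bullet> b) * \<phi> x) v))
    = (\<integral>x. cis (- 2 * pi * (x \<bullet> (v + h))) * \<phi> x - cis (- 2 * pi * (x \<bullet> v)) * \<phi> x -
        (- 2 * pi * \<i>) * (cis (- 2 * pi * (x \<bullet> v)) * (of_real (x \<bullet> h) * \<phi> x)) \<partial>lborel)"
    unfolding Dh unfolding fourier_eq_cis
    using Bochner_Integration.integral_diff[OF Bochner_Integration.integrable_diff[OF int[of "v + h"] int[of v]] inth]
      Bochner_Integration.integral_diff[OF int[of "v + h"] int[of v]] by (simp only:)
  have le: "norm (\<integral>x. cis (- 2 * pi * (x \<bullet> (v + h))) * \<phi> x - cis (- 2 * pi * (x \<bullet> v)) * \<phi> x -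
        (- 2 * pi * \<i>) * (cis (- 2 * pi * (x \<bullet> v)) * (of_real (x \<bullet> h) * \<phi> x)) \<partial>lborel)
      \<le> (\<integral>x. (2 * pi)\<^sup>2 * (norm h)\<^sup>2 * ((1 + norm x) ^ 2 * norm (\<phi> x)) \<partial>lborel)"
  proof (rule Bochner_Integration.integral_norm_bound_integral)
    fix x
    let ?t = "- 2 * pi * (x \<bullet> h)"
    have c: "cis (- 2 * pi * (x \<bullet> (v + h))) = cis (- 2 * pi * (x \<bullet> v)) * cis ?t"
      by (simp add: cis_mult inner_add_right algebra_simps)
    have "cis (- 2 * pi * (x \<bullet> (v + h))) * \<phi> x - cis (- 2 * pi * (x \<bullet> v)) * \<phi> x -
        (- 2 * pi * \<i>) * (cis (- 2 * pi * (x \<bullet> v)) * (of_real (x \<bullet> h) * \<phi> x))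
      = cis (- 2 * pi * (x \<bullet> v)) * (cis ?t - 1 - \<i> * of_real ?t) * \<phi> x"
      unfolding c by (simp add: algebra_simps)
    then have "norm (cis (- 2 * pi * (x \<bullet> (v + h))) * \<phi> x - cis (- 2 * pi * (x \<bullet> v)) * \<phi> x -
        (- 2 * pi * \<i>) * (cis (- 2 * pi * (x \<bullet> v)) * (of_real (x \<bullet> h) * \<phi> x)))
      = norm (cis ?t - 1 - \<i> * of_real ?t) * norm (\<phi> x)"
      by (simp only: norm_mult norm_cis)
    also have "\<dots> \<le> ?t\<^sup>2 * norm (\<phi> x)"
      by (intro mult_right_mono norm_cis_minus_linear) auto
    also have "?t\<^sup>2 \<le> (2 * pi)\<^sup>2 * ((norm h)\<^sup>2 * (1 + norm x)\<^sup>2)"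
    proof -
      have "\<bar>x \<bullet> h\<bar> \<le> norm h * (1 + norm x)"
        using Cauchy_Schwarz_ineq2[of x h] by (simp add: algebra_simps add_increasing)
      then have "\<bar>x \<bullet> h\<bar>\<^sup>2 \<le> (norm h * (1 + norm x))\<^sup>2"
        by (intro power_mono) auto
      then show ?thesis
        by (simp add: power_mult_distrib)
    qed
    finally show "norm (cis (- 2 * pi * (x \<bullet> (v + h))) * \<phi> x - cis (- 2 * pi * (x \<bullet> v)) * \<phi> x -
        (- 2 * pi * \<i>) * (cis (- 2 * pi * (x \<bullet> v)) * (of_real (x \<bullet> h) * \<phi> x)))
        \<le> (2 * pi)\<^sup>2 * (norm h)\<^sup>2 * ((1 + norm x) ^ 2 * norm (\<phi> x))"
      by (simp add: mult_right_mono mult.assoc)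
  qed (intro Bochner_Integration.integrable_diff int inth integrable_mult_right
         schwartz_integrable_weighted S)+
  have "(\<integral>x. (2 * pi)\<^sup>2 * (norm h)\<^sup>2 * ((1 + norm x) ^ 2 * norm (\<phi> x)) \<partial>lborel)
      = (2 * pi)\<^sup>2 * (\<integral>x. (1 + norm x) ^ 2 * norm (\<phi> x) \<partial>lborel) * (norm h)\<^sup>2"
    by (subst integral_mult_right_zero) (simp only: mult_ac)
  with le show "norm (fourier \<phi> (v + h) - fourier \<phi> v -
      (\<Sum>b\<in>Basis. of_real (h \<bullet> b) * (- 2 * pi * \<i> * fourier (\<lambda>x. of_real (x \<bullet> b) * \<phi> x) v)))
     \<le> (2 * pi)\<^sup>2 * (\<integral>x. (1 + norm x) ^ 2 * norm (\<phi> x) \<partial>lborel) * (norm h)\<^sup>2"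
    by (simp only: eq)
qed

lemma fourier_bounded:
  assumes "integrable lborel \<phi>"
  shows "norm (fourier \<phi> v) \<le> (\<integral>x. norm (\<phi> x) \<partial>lborel)"
  unfolding fourier_eq_cis
  by (rule order_trans[OF integral_norm_bound]) (simp add: norm_mult)

lemma fourier_scale: "fourier (\<lambda>x. c * \<phi> x) v = c * fourier \<phi> v"
  unfolding fourier_eq_cis by (simp add: mult.left_commute)

lemma norm_partial_difference_le:
  fixes \<phi> :: "'a::euclidean_space \<Rightarrow> complex"
  assumes S: "\<phi> \<in> schwartz" and t: "t \<ge> 0" and B: "\<And>s. s \<in> {0..t} \<Longrightarrow> norm (partial_deriv b \<phi> (x + s *\<^sub>R b)) \<le> B"
  shows "norm (\<phi> (x + t *\<^sub>R b) - \<phi> x) \<le> B * t"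
proof -
  have "norm (\<phi> (x + t *\<^sub>R b) - \<phi> (x + 0 *\<^sub>R b)) \<le> B * norm (t - 0)"
  proof (rule differentiable_bound[where f = "\<lambda>s. \<phi> (x + s *\<^sub>R b)" and S = "{0..t}"
        and f' = "\<lambda>s h. h *\<^sub>R partial_deriv b \<phi> (x + s *\<^sub>R b)"])
    fix s assume s: "s \<in> {0..t}"
    have "((\<lambda>s. \<phi> (x + s *\<^sub>R b)) has_derivative (\<lambda>h. frechet_derivative \<phi> (at (x + s *\<^sub>R b)) (h *\<^sub>R b))) (at s within {0..t})"
      by (rule has_derivative_compose[OF _ schwartz_has_derivative[OF S]])
         (auto intro!: derivative_eq_intros)
    moreover have "frechet_derivative \<phi> (at y) (h *\<^sub>R b) = h *\<^sub>R partial_deriv b \<phi> y" for y h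
      using has_derivative_bounded_linear[OF schwartz_has_derivative[OF S]]
      by (simp add: linear_simps partial_deriv_def)
    ultimately show "((\<lambda>s. \<phi> (x + s *\<^sub>R b)) has_derivative (\<lambda>h. h *\<^sub>R partial_deriv b \<phi> (x + s *\<^sub>R b))) (at s within {0..t})"
      by simp
    show "onorm (\<lambda>h. h *\<^sub>R partial_deriv b \<phi> (x + s *\<^sub>R b)) \<le> B"
      using B[OF s] by (intro onorm_le) (simp add: mult.commute[of B] mult_left_mono)
  qed (use t in auto)
  then show ?thesis using t by simp
qed

lemma has_vector_derivative_difference_quotient:
  fixes f :: "real \<Rightarrow> 'a::real_normed_vector"
  assumes "(f has_vector_derivative D) (at 0)"
  shows "(\<lambda>n. (f (inverse (real (Suc n))) - f 0) /\<^sub>R inverse (real (Suc n))) \<longlonglongrightarrow> D"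
proof -
  let ?t = "\<lambda>n. inverse (real (Suc n))"
  have "(\<lambda>h. norm (f h - f 0 - h *\<^sub>R D) / norm h) \<midarrow>0\<rightarrow> 0"
    using assms by (simp add: has_vector_derivative_def has_derivative_at)
  then have "(\<lambda>n. norm (f (?t n) - f 0 - ?t n *\<^sub>R D) / norm (?t n)) \<longlonglongrightarrow> 0"
    by (rule filterlim_compose) (use LIMSEQ_inverse_real_of_nat in \<open>auto simp: filterlim_at simp del: of_nat_Suc\<close>)
  moreover have "norm (f t - f 0 - t *\<^sub>R D) / norm t = norm ((f t - f 0) /\<^sub>R t - D)" if "t > 0" for t
  proof -
    have "(f t - f 0) /\<^sub>R t - D = (f t - f 0 - t *\<^sub>R D) /\<^sub>R t"
      using that by (simp add: scaleR_diff_right)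
    then show ?thesis using that by (simp add: divide_inverse)
  qed
  ultimately have "(\<lambda>n. norm ((f (?t n) - f 0) /\<^sub>R ?t n - D)) \<longlonglongrightarrow> 0"
    by simp
  then show ?thesis
    by (rule LIM_zero_cancel[OF tendsto_norm_zero_cancel])
qed

text \<open>A translate of \<open>\<phi>\<close> has its transform multiplied by a character; the
  difference quotients of both sides are compared in the limit. This takes the place of an
  integration by parts.\<close>

lemma fourier_partial_deriv:
  fixes \<phi> :: "'a::euclidean_space \<Rightarrow> complex"
  assumes S: "\<phi> \<in> schwartz" and b: "b \<in> Basis"
  shows "fourier (partial_deriv b \<phi>) v = 2 * pi * \<i> * of_real (v \<bullet> b) * fourier \<phi> v"
proof (rule LIMSEQ_unique)
  let ?t = "\<lambda>n. inverse (real (Suc n))"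
  have S': "partial_deriv b \<phi> \<in> schwartz" using schwartz_partial_deriv S b by blast
  note [measurable] = schwartz_measurable[OF S] schwartz_measurable[OF S']
  obtain B where "B \<ge> 0" and B: "\<And>x. (1 + norm x) ^ (2 * DIM('a)) * norm (partial_deriv b \<phi> x) \<le> B"
    using rapidly_decreasingE[OF schwartz_rapidly_decreasing[OF S']] by metis
  define q where "q n x = cis (- 2 * pi * (x \<bullet> v)) * ((\<phi> (x + ?t n *\<^sub>R b) - \<phi> x) /\<^sub>R ?t n)"
    for n and x :: 'a
  have t: "?t n > 0" "?t n \<le> 1" for n by (auto simp: field_simps)
  show "(\<lambda>n. \<integral>x. q n x \<partial>lborel) \<longlonglongrightarrow> fourier (partial_deriv b \<phi>) v"
    unfolding fourier_eq_cis
  proof (rule integral_dominated_convergence)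
    \<comment> \<open>The mean value theorem evaluates the derivative at a point at most one unit
      away, where \<open>1 + norm\<close> differs by at most a factor 2; hence the constant
      \<open>2 ^ (2 * DIM('a))\<close>.\<close>
    show "integrable lborel (\<lambda>x::'a. (2 ^ (2 * DIM('a)) * B) * (1 / (1 + norm x) ^ (2 * DIM('a))))"
      using integrable_weight by (rule integrable_mult_right)
    show "AE x in lborel. norm (q n x) \<le> (2 ^ (2 * DIM('a)) * B) * (1 / (1 + norm x) ^ (2 * DIM('a)))" for n
    proof (rule AE_I2)
      fix x :: 'a
      let ?M = "(2 ^ (2 * DIM('a)) * B) * (1 / (1 + norm x) ^ (2 * DIM('a)))"
      have "norm (\<phi> (x + ?t n *\<^sub>R b) - \<phi> x) \<le> ?M * ?t n"
      proof (rule norm_partial_difference_le[OF S])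
        fix s assume s: "s \<in> {0..?t n}"
        define y where "y = x + s *\<^sub>R b"
        have "norm x \<le> norm y + norm (s *\<^sub>R b)"
          unfolding y_def by (metis add_diff_cancel_right' norm_triangle_ineq4)
        moreover have "norm (s *\<^sub>R b) \<le> 1" using s t[of n] b by simp
        ultimately have "norm x \<le> norm y + 1" by (meson add_left_mono order_trans)
        then have "1 + norm x \<le> 2 * (1 + norm y)" using norm_ge_zero[of y] by argo
        then have "(1 + norm x) ^ (2 * DIM('a)) \<le> 2 ^ (2 * DIM('a)) * (1 + norm y) ^ (2 * DIM('a))"
          unfolding power_mult_distrib[symmetric] by (intro power_mono) auto
        then have "(1 + norm x) ^ (2 * DIM('a)) * norm (partial_deriv b \<phi> y)
          \<le> 2 ^ (2 * DIM('a)) * ((1 + norm y) ^ (2 * DIM('a)) * norm (partial_deriv b \<phi> y))"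
          by (simp add: mult_right_mono flip: mult.assoc)
        also have "\<dots> \<le> 2 ^ (2 * DIM('a)) * B"
          by (intro mult_left_mono B) auto
        finally have *: "(1 + norm x) ^ (2 * DIM('a)) * norm (partial_deriv b \<phi> y) \<le> 2 ^ (2 * DIM('a)) * B" .
        have "0 < (1 + norm x) ^ (2 * DIM('a))" by (simp add: add_pos_nonneg)
        with * show "norm (partial_deriv b \<phi> (x + s *\<^sub>R b)) \<le> ?M"
          unfolding y_def[symmetric] by (simp add: field_simps)
      qed (use t in \<open>auto simp: less_imp_le\<close>)
      then have "norm (\<phi> (x + ?t n *\<^sub>R b) - \<phi> x) / ?t n \<le> ?M"
        using t(1)[of n] by (simp only: pos_divide_le_eq)
      moreover have "norm (q n x) = norm (\<phi> (x + ?t n *\<^sub>R b) - \<phi> x) / ?t n"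
        unfolding q_def norm_mult norm_cis norm_scaleR divide_inverse by simp
      ultimately show "norm (q n x) \<le> ?M"
        by simp
    qed
    show "AE x in lborel. (\<lambda>n. q n x) \<longlonglongrightarrow> cis (- 2 * pi * (x \<bullet> v)) * partial_deriv b \<phi> x"
    proof (rule AE_I2)
      fix x
      have "((\<lambda>s. \<phi> (x + s *\<^sub>R b)) has_derivative (\<lambda>h. frechet_derivative \<phi> (at (x + 0 *\<^sub>R b)) (h *\<^sub>R b))) (at 0)"
        by (rule has_derivative_compose[OF _ schwartz_has_derivative[OF S]])
           (auto intro!: derivative_eq_intros)
      moreover have "frechet_derivative \<phi> (at x) (h *\<^sub>R b) = h *\<^sub>R partial_deriv b \<phi> x" for h
        using has_derivative_bounded_linear[OF schwartz_has_derivative[OF S]]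
        by (simp add: linear_simps partial_deriv_def)
      ultimately have "((\<lambda>s. \<phi> (x + s *\<^sub>R b)) has_vector_derivative partial_deriv b \<phi> x) (at 0)"
        by (simp add: has_vector_derivative_def)
      from has_vector_derivative_difference_quotient[OF this]
      show "(\<lambda>n. q n x) \<longlonglongrightarrow> cis (- 2 * pi * (x \<bullet> v)) * partial_deriv b \<phi> x"
        unfolding q_def by (intro tendsto_intros) simp
    qed
  qed (unfold q_def, measurable)
  have q: "(\<integral>x. q n x \<partial>lborel) = ((cis (?t n * (2 * pi * (b \<bullet> v))) - 1) /\<^sub>R ?t n) * fourier \<phi> v" for n
  proof -
    have i1: "integrable lborel (\<lambda>x. cis (- 2 * pi * (x \<bullet> v)) * \<phi> x)"
      by (intro integrable_cis_mult schwartz_integrable S) auto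
    have "integrable lborel (\<lambda>x. \<phi> (?t n *\<^sub>R b + 1 *\<^sub>R x))"
      by (subst lborel_integrable_affine_iff) (auto intro: schwartz_integrable S)
    then have i2: "integrable lborel (\<lambda>x. cis (- 2 * pi * (x \<bullet> v)) * \<phi> (x + ?t n *\<^sub>R b))"
      by (intro integrable_cis_mult) (auto simp: add.commute)
    have "(\<integral>x. q n x \<partial>lborel) =
       ((\<integral>x. cis (- 2 * pi * (x \<bullet> v)) * \<phi> (x + ?t n *\<^sub>R b) \<partial>lborel) - fourier \<phi> v) /\<^sub>R ?t n"
      unfolding fourier_eq_cis q_def
      by (subst Bochner_Integration.integral_diff[OF i2 i1, symmetric])
         (simp only: integral_scaleR_right[symmetric], simp add: algebra_simps scaleR_diff_right)
    also have "(\<integral>x. cis (- 2 * pi * (x \<bullet> v)) * \<phi> (x + ?t n *\<^sub>R b) \<partial>lborel)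
      = (\<integral>x. cis (- 2 * pi * ((- (?t n) *\<^sub>R b + x) \<bullet> v)) * \<phi> (- (?t n) *\<^sub>R b + x + ?t n *\<^sub>R b) \<partial>lborel)"
      by (rule lborel_integral_translate[symmetric]) measurable
    also have "\<dots> = (\<integral>x. cis (?t n * (2 * pi * (b \<bullet> v))) * (cis (- 2 * pi * (x \<bullet> v)) * \<phi> x) \<partial>lborel)"
    proof (intro Bochner_Integration.integral_cong refl)
      fix x
      have a: "- (?t n) *\<^sub>R b + x + ?t n *\<^sub>R b = x" by simp
      have "- 2 * pi * ((- (?t n) *\<^sub>R b + x) \<bullet> v) = ?t n * (2 * pi * (b \<bullet> v)) + - 2 * pi * (x \<bullet> v)"
        by (simp only: inner_add_left inner_scaleR_left) (simp only: algebra_simps)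
      then have c: "cis (- 2 * pi * ((- (?t n) *\<^sub>R b + x) \<bullet> v)) = cis (?t n * (2 * pi * (b \<bullet> v))) * cis (- 2 * pi * (x \<bullet> v))"
        by (simp only: cis_mult)
      show "cis (- 2 * pi * ((- (?t n) *\<^sub>R b + x) \<bullet> v)) * \<phi> (- (?t n) *\<^sub>R b + x + ?t n *\<^sub>R b)
          = cis (?t n * (2 * pi * (b \<bullet> v))) * (cis (- 2 * pi * (x \<bullet> v)) * \<phi> x)"
        unfolding a c by (rule mult.assoc)
    qed
    also have "\<dots> = cis (?t n * (2 * pi * (b \<bullet> v))) * fourier \<phi> v"
      unfolding fourier_eq_cis by simp
    finally show ?thesis
      by (simp add: algebra_simps scaleR_conv_of_real)
  qed
  have "((\<lambda>t. cis (t * (2 * pi * (b \<bullet> v)))) has_vector_derivative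
      (2 * pi * (b \<bullet> v)) *\<^sub>R (\<i> * cis (0 * (2 * pi * (b \<bullet> v))))) (at 0)"
    unfolding has_vector_derivative_def
    by (auto intro!: derivative_eq_intros simp: scaleR_conv_of_real)
  from has_vector_derivative_difference_quotient[OF this]
  have "(\<lambda>n. (cis (?t n * (2 * pi * (b \<bullet> v))) - 1) /\<^sub>R ?t n) \<longlonglongrightarrow> 2 * pi * \<i> * of_real (v \<bullet> b)"
    by (simp add: scaleR_conv_of_real mult_ac inner_commute)
  then show "(\<lambda>n. \<integral>x. q n x \<partial>lborel) \<longlonglongrightarrow> 2 * pi * \<i> * of_real (v \<bullet> b) * fourier \<phi> v"
    unfolding q by (intro tendsto_intros)
qed

text \<open>One power of \<open>1 + norm v\<close> is traded, via the l1 bound on the norm, for one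
  partial derivative of \<open>\<phi>\<close>. The induction therefore has to range over all
  Schwartz functions.\<close>

lemma rapidly_decreasing_fourier:
  fixes \<phi> :: "'a::euclidean_space \<Rightarrow> complex"
  assumes "\<phi> \<in> schwartz" shows "rapidly_decreasing (fourier \<phi>)"
proof -
  have "\<exists>B. \<forall>v. (1 + norm v) ^ k * norm (fourier \<phi> v) \<le> B" for k
    using assms
  proof (induction k arbitrary: \<phi>)
    case 0
    then show ?case
      by (intro exI[of _ "\<integral>x. norm (\<phi> x) \<partial>lborel"]) (simp add: fourier_bounded schwartz_integrable)
  next
    case (Suc k)
    obtain B where B: "\<And>v. (1 + norm v) ^ k * norm (fourier \<phi> v) \<le> B"
      using Suc by blast
    have "\<forall>b\<in>Basis. \<exists>C. \<forall>v. (1 + norm v) ^ k * norm (fourier (partial_deriv b \<phi>) v) \<le> C"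
      using Suc schwartz_partial_deriv by blast
    then obtain C where C: "\<And>b v. b \<in> Basis \<Longrightarrow> (1 + norm v) ^ k * norm (fourier (partial_deriv b \<phi>) v) \<le> C b"
      by metis
    have "(1 + norm v) ^ Suc k * norm (fourier \<phi> v) \<le> B + (\<Sum>b\<in>Basis. C b)" for v
    proof -
      have n: "\<bar>v \<bullet> b\<bar> * norm (fourier \<phi> v) \<le> norm (fourier (partial_deriv b \<phi>) v)" if "b \<in> Basis" for b
      proof -
        have "norm (fourier (partial_deriv b \<phi>) v) = (2 * pi) * (\<bar>v \<bullet> b\<bar> * norm (fourier \<phi> v))"
          by (simp add: fourier_partial_deriv[OF Suc.prems that] norm_mult)
        moreover have "1 * (\<bar>v \<bullet> b\<bar> * norm (fourier \<phi> v)) \<le> (2 * pi) * (\<bar>v \<bullet> b\<bar> * norm (fourier \<phi> v))"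
          using pi_gt3 by (intro mult_right_mono) auto
        ultimately show ?thesis by simp
      qed
      have "(1 + norm v) ^ Suc k * norm (fourier \<phi> v) = (1 + norm v) ^ k * ((1 + norm v) * norm (fourier \<phi> v))"
        by simp
      also have "\<dots> \<le> (1 + norm v) ^ k * ((1 + (\<Sum>b\<in>Basis. \<bar>v \<bullet> b\<bar>)) * norm (fourier \<phi> v))"
        using norm_le_l1[of v] by (intro mult_left_mono mult_right_mono) auto
      also have "\<dots> = (1 + norm v) ^ k * (norm (fourier \<phi> v) + (\<Sum>b\<in>Basis. \<bar>v \<bullet> b\<bar> * norm (fourier \<phi> v)))"
        by (simp only: distrib_right sum_distrib_right mult_1)
      also have "\<dots> \<le> (1 + norm v) ^ k * (norm (fourier \<phi> v) + (\<Sum>b\<in>Basis. norm (fourier (partial_deriv b \<phi>) v)))"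
        by (intro mult_left_mono add_left_mono sum_mono n) auto
      also have "\<dots> = (1 + norm v) ^ k * norm (fourier \<phi> v) +
          (\<Sum>b\<in>Basis. (1 + norm v) ^ k * norm (fourier (partial_deriv b \<phi>) v))"
        by (simp add: distrib_left sum_distrib_left)
      also have "\<dots> \<le> B + (\<Sum>b\<in>Basis. C b)"
        by (intro add_mono sum_mono B C)
      finally show ?thesis .
    qed
    then show ?case by blast
  qed
  then show ?thesis unfolding rapidly_decreasing_def by blast
qed

text \<open>The set of all transforms is a class fit for \<open>schwartz_coinduct\<close>, since a
  derivative of \<open>fourier \<phi>\<close> is the transform of a multiple of a coordinate times
  \<open>\<phi>\<close>.\<close>

theorem fourier_schwartz:
  fixes \<phi> :: "'a::euclidean_space \<Rightarrow> complex"
  assumes "\<phi> \<in> schwartz" shows "fourier \<phi> \<in> schwartz"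
proof -
  define C where "C = fourier ` (schwartz :: ('a \<Rightarrow> complex) set)"
  have "C \<subseteq> schwartz"
  proof (rule schwartz_coinduct)
    fix \<theta> and v b :: 'a assume "\<theta> \<in> C"
    then obtain \<phi> where \<theta>: "\<theta> = fourier \<phi>" and S: "\<phi> \<in> schwartz"
      unfolding C_def by auto
    show "\<theta> differentiable (at v)"
      using fourier_has_derivative[OF S] differentiable_def \<theta> by blast
    show "rapidly_decreasing \<theta>" unfolding \<theta> by (rule rapidly_decreasing_fourier[OF S])
    assume b: "b \<in> Basis"
    have "partial_deriv b (fourier \<phi>) v = - 2 * pi * \<i> * fourier (\<lambda>x. of_real (x \<bullet> b) * \<phi> x) v" for v
    proof -
      have "partial_deriv b (fourier \<phi>) v = (\<Sum>c\<in>Basis. of_real (b \<bullet> c) *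
          (- 2 * pi * \<i> * fourier (\<lambda>x. of_real (x \<bullet> c) * \<phi> x) v))"
        by (rule partial_deriv_eqI[OF fourier_has_derivative[OF S]])
      also have "\<dots> = (\<Sum>c\<in>Basis. if c = b then - 2 * pi * \<i> * fourier (\<lambda>x. of_real (x \<bullet> c) * \<phi> x) v else 0)"
        using b by (intro sum.cong refl) (auto simp: inner_Basis)
      finally show ?thesis using b by simp
    qed
    then have "partial_deriv b \<theta> = fourier (\<lambda>x. (- 2 * pi * \<i>) * (of_real (x \<bullet> b) * \<phi> x))"
      unfolding \<theta> fourier_scale by auto
    then show "partial_deriv b \<theta> \<in> C"
      unfolding C_def using schwartz_scale schwartz_coordinate_mult[OF S b] by blast
  qed
  then show ?thesis using assms unfolding C_def by blast
qed

text \<open>By inversion, the reflected transform of \<open>\<phi>\<close> is a preimage of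
  \<open>\<phi>\<close>.\<close>

theorem fourier_schwartz_surj:
  fixes \<phi> :: "'a::euclidean_space \<Rightarrow> complex"
  assumes S: "\<phi> \<in> schwartz"
  obtains \<psi> where "\<psi> \<in> schwartz" "fourier \<psi> = \<phi>"
proof
  show "(\<lambda>x. fourier \<phi> (- x)) \<in> schwartz"
    by (intro schwartz_reflect fourier_schwartz S)
  show "fourier (\<lambda>x. fourier \<phi> (- x)) = \<phi>"
  proof
    fix v
    note [measurable] = schwartz_measurable[OF fourier_schwartz[OF S]]
    obtain B where B: "\<And>x. norm (\<phi> x) \<le> B" using schwartz_bounded[OF S] by blast
    have "fourier (\<lambda>x. fourier \<phi> (- x)) v
        = (\<integral>x. cis (- 2 * pi * (- x \<bullet> v)) * fourier \<phi> (- (- x)) \<partial>lborel)"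
      unfolding fourier_eq_cis[of "\<lambda>x. fourier \<phi> (- x)"]
      by (rule lborel_integral_reflect[symmetric]) measurable
    also have "\<dots> = (\<integral>x. cis (2 * pi * (v \<bullet> x)) * fourier \<phi> x \<partial>lborel)"
      by (simp add: inner_commute)
    also have "\<dots> = \<phi> v"
      by (rule fourier_inversion[OF schwartz_integrable[OF S] schwartz_continuous[OF S] B
            schwartz_integrable[OF fourier_schwartz[OF S]]])
    finally show "fourier (\<lambda>x. fourier \<phi> (- x)) v = \<phi> v" .
  qed
qed

section \<open>Even Schwartz functions on the line and the quotient h'(r)/r\<close>

lemma schwartz_has_vector_derivative:
  fixes \<phi> :: "real \<Rightarrow> complex"
  assumes "\<phi> \<in> schwartz"
  shows "(\<phi> has_vector_derivative partial_deriv 1 \<phi> r) (at r)"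
proof -
  have "frechet_derivative \<phi> (at r) h = h *\<^sub>R partial_deriv 1 \<phi> r" for h
    using linear_cmul[OF has_derivative_linear[OF schwartz_has_derivative[OF assms]], of r h 1]
    by (simp add: partial_deriv_def)
  then have "frechet_derivative \<phi> (at r) = (\<lambda>h. h *\<^sub>R partial_deriv 1 \<phi> r)"
    by (rule ext)
  then show ?thesis
    using schwartz_has_derivative[OF assms, of r] by (simp add: has_vector_derivative_def)
qed

lemma schwartz_dilation_has_vector_derivative:
  assumes "\<phi> \<in> schwartz"
  shows "((\<lambda>r. \<phi> (t * r)) has_vector_derivative t *\<^sub>R partial_deriv 1 \<phi> (t * r)) (at r)"
proof -
  have "((\<lambda>r. t * r) has_vector_derivative t) (at r)"
    unfolding has_real_derivative_iff_has_vector_derivative[symmetric]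
    by (auto intro!: derivative_eq_intros)
  from vector_diff_chain_at[OF this schwartz_has_vector_derivative[OF assms]]
  show ?thesis by (simp add: o_def)
qed

text \<open>For \<open>k = 0\<close> this is the mean of \<open>\<phi>\<close> over the segment from
  0 to \<open>r\<close>; applied to \<open>h''\<close> it expresses \<open>(h' r - h' 0) / r\<close>
  by a formula that is smooth at 0 too. The weights \<open>t ^ k\<close> arise on differentiating in
  \<open>r\<close>.\<close>

definition dilation_average :: "nat \<Rightarrow> (real \<Rightarrow> complex) \<Rightarrow> real \<Rightarrow> complex" where
  "dilation_average k \<phi> r = integral {0..1} (\<lambda>t. t ^ k *\<^sub>R \<phi> (t * r))"

lemma dilation_average_has_vector_derivative:
  assumes S: "\<phi> \<in> schwartz"
  shows "(dilation_average k \<phi> has_vector_derivative dilation_average (Suc k) (partial_deriv 1 \<phi>) r) (at r)"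
proof -
  have S': "partial_deriv 1 \<phi> \<in> schwartz" using S by (rule schwartz_partial_deriv) simp
  have "((\<lambda>r. integral (cbox 0 1) (\<lambda>t. t ^ k *\<^sub>R \<phi> (t * r))) has_vector_derivative
      integral (cbox 0 1) (\<lambda>t. t ^ Suc k *\<^sub>R partial_deriv 1 \<phi> (t * r))) (at r within UNIV)"
  proof (rule leibniz_rule_vector_derivative)
    fix r t :: real
    have "((\<lambda>r. \<phi> (t * r)) has_vector_derivative t *\<^sub>R partial_deriv 1 \<phi> (t * r)) (at r)"
      by (rule schwartz_dilation_has_vector_derivative[OF S])
    then show "((\<lambda>r. t ^ k *\<^sub>R \<phi> (t * r)) has_vector_derivative t ^ Suc k *\<^sub>R partial_deriv 1 \<phi> (t * r)) (at r within UNIV)"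
      by (auto intro!: derivative_eq_intros simp: mult.commute)
    show "(\<lambda>t. t ^ k *\<^sub>R \<phi> (t * r)) integrable_on cbox 0 1"
      by (intro integrable_continuous continuous_intros continuous_on_compose2[OF schwartz_continuous[OF S]]) auto
  next
    show "continuous_on (UNIV \<times> cbox 0 1) (\<lambda>(r, t). t ^ Suc k *\<^sub>R partial_deriv 1 \<phi> (t * r))"
      unfolding case_prod_beta
      by (intro continuous_intros continuous_on_compose2[OF schwartz_continuous[OF S']]) auto
  qed auto
  then show ?thesis
    by (simp add: dilation_average_def[abs_def])
qed

text \<open>Integrate the \<open>t\<close>-derivative of \<open>t ^ Suc k * \<phi> (t * r)\<close>
  over the unit interval. The formula hands rapid decrease from an average on to its
  derivative.\<close>

lemma dilation_average_recurrence:
  assumes S: "\<phi> \<in> schwartz"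
  shows "of_real r * dilation_average (Suc k) (partial_deriv 1 \<phi>) r
     = \<phi> r - of_nat (Suc k) * dilation_average k \<phi> r"
proof -
  have S': "partial_deriv 1 \<phi> \<in> schwartz" using S by (rule schwartz_partial_deriv) simp
  have i1: "(\<lambda>t. t ^ k *\<^sub>R \<phi> (t * r)) integrable_on {0..1}"
    unfolding cbox_interval[symmetric]
    by (intro integrable_continuous continuous_intros continuous_on_compose2[OF schwartz_continuous[OF S]]) auto
  have i2: "(\<lambda>t. t ^ Suc k *\<^sub>R partial_deriv 1 \<phi> (t * r)) integrable_on {0..1}"
    unfolding cbox_interval[symmetric]
    by (intro integrable_continuous continuous_intros continuous_on_compose2[OF schwartz_continuous[OF S']]) auto
  have "((\<lambda>t. of_nat (Suc k) * (t ^ k *\<^sub>R \<phi> (t * r)) + of_real r * (t ^ Suc k *\<^sub>R partial_deriv 1 \<phi> (t * r)))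
      has_integral (1 ^ Suc k *\<^sub>R \<phi> (1 * r) - 0 ^ Suc k *\<^sub>R \<phi> (0 * r))) {0..1}"
  proof (rule fundamental_theorem_of_calculus)
    fix t :: real
    have "((\<lambda>t. \<phi> (t * r)) has_vector_derivative r *\<^sub>R partial_deriv 1 \<phi> (t * r)) (at t within {0..1})"
      using schwartz_dilation_has_vector_derivative[OF S, of r t]
      by (simp add: mult.commute has_vector_derivative_at_within)
    moreover have "((\<lambda>t. t ^ Suc k) has_field_derivative real (Suc k) * t ^ k) (at t within {0..1})"
      using DERIV_pow[of "Suc k" t] by (simp add: has_field_derivative_at_within del: power_Suc)
    ultimately show "((\<lambda>t. t ^ Suc k *\<^sub>R \<phi> (t * r)) has_vector_derivative
        of_nat (Suc k) * (t ^ k *\<^sub>R \<phi> (t * r)) + of_real r * (t ^ Suc k *\<^sub>R partial_deriv 1 \<phi> (t * r))) (at t within {0..1})"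
      by (auto dest: has_vector_derivative_scaleR simp del: power_Suc simp: scaleR_conv_of_real mult_ac add_ac)
  qed simp
  then have "\<phi> r = integral {0..1} (\<lambda>t. of_nat (Suc k) * (t ^ k *\<^sub>R \<phi> (t * r)) + of_real r * (t ^ Suc k *\<^sub>R partial_deriv 1 \<phi> (t * r)))"
    by (simp add: integral_unique)
  also have "\<dots> = of_nat (Suc k) * dilation_average k \<phi> r + of_real r * dilation_average (Suc k) (partial_deriv 1 \<phi>) r"
    unfolding dilation_average_def
    by (subst Henstock_Kurzweil_Integration.integral_add
          [OF integrable_on_mult_right[OF i1] integrable_on_mult_right[OF i2]])
       (simp only: Henstock_Kurzweil_Integration.integral_mult_right)
  finally show ?thesis by simp
qed

lemma dilation_average_0:
  assumes S: "\<phi> \<in> schwartz"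
  shows "of_real r * dilation_average 0 (partial_deriv 1 \<phi>) r = \<phi> r - \<phi> 0"
proof -
  have "((\<lambda>t. of_real r * partial_deriv 1 \<phi> (t * r)) has_integral (\<phi> (1 * r) - \<phi> (0 * r))) {0..1}"
  proof (rule fundamental_theorem_of_calculus)
    fix t :: real
    show "((\<lambda>t. \<phi> (t * r)) has_vector_derivative of_real r * partial_deriv 1 \<phi> (t * r)) (at t within {0..1})"
      using schwartz_dilation_has_vector_derivative[OF S, of r t]
      by (simp add: mult.commute has_vector_derivative_at_within scaleR_conv_of_real)
  qed simp
  then show ?thesis
    by (simp add: dilation_average_def integral_unique flip: integral_mult_right)
qed

lemma dilation_average_bounded:
  assumes S: "\<phi> \<in> schwartz" and B: "\<And>r. norm (\<phi> r) \<le> B"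
  shows "norm (dilation_average k \<phi> r) \<le> B"
proof -
  have "norm (dilation_average k \<phi> r) \<le> integral {0..1} (\<lambda>t::real. B)"
    unfolding dilation_average_def
  proof (rule integral_norm_bound_integral)
    show "(\<lambda>t. t ^ k *\<^sub>R \<phi> (t * r)) integrable_on {0..1}"
      unfolding cbox_interval[symmetric]
      by (intro integrable_continuous continuous_intros continuous_on_compose2[OF schwartz_continuous[OF S]]) auto
    fix t :: real assume "t \<in> {0..1}"
    then have "\<bar>t ^ k\<bar> \<le> 1" by (simp add: power_le_one)
    then have "\<bar>t ^ k\<bar> * norm (\<phi> (t * r)) \<le> 1 * norm (\<phi> (t * r))"
      by (intro mult_right_mono) auto
    then show "norm (t ^ k *\<^sub>R \<phi> (t * r)) \<le> B"
      using B[of "t * r"] by simp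
  qed auto
  then show ?thesis by simp
qed

text \<open>For \<open>\<bar>r\<bar> > 1\<close> the factor \<open>r\<close> only helps, and on the
  remaining interval a bound on \<open>u\<close> suffices.\<close>

lemma rapidly_decreasing_cancel:
  fixes u :: "real \<Rightarrow> complex"
  assumes r: "rapidly_decreasing (\<lambda>r. of_real r * u r)" and B: "\<And>r. norm (u r) \<le> B"
  shows "rapidly_decreasing u"
  unfolding rapidly_decreasing_def
proof
  fix k :: nat
  obtain A where "A \<ge> 0" and A: "\<And>r. (1 + norm r) ^ k * norm (of_real r * u r) \<le> A"
    using rapidly_decreasingE[OF r] by metis
  have "B \<ge> 0" using B[of 0] norm_ge_zero order_trans by blast
  have "(1 + norm r) ^ k * norm (u r) \<le> A + 2 ^ k * B" for r
  proof (cases "\<bar>r\<bar> \<le> 1")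
    case True
    then have "(1 + norm r) ^ k * norm (u r) \<le> 2 ^ k * B"
      by (intro mult_mono power_mono B) auto
    then show ?thesis using \<open>A \<ge> 0\<close> by simp
  next
    case False
    then have "1 * norm (u r) \<le> norm (of_real r * u r)"
      unfolding norm_mult by (intro mult_right_mono) auto
    then have "(1 + norm r) ^ k * norm (u r) \<le> (1 + norm r) ^ k * norm (of_real r * u r)"
      by (intro mult_left_mono) auto
    also have "\<dots> \<le> A" by (rule A)
    finally show ?thesis using \<open>B \<ge> 0\<close> by (simp add: add_increasing2)
  qed
  then show "\<exists>B. \<forall>r. (1 + norm r) ^ k * norm (u r) \<le> B" by blast
qed

text \<open>Rapid decrease is made part of the class because it is not automatic: for
  \<open>k = 0\<close> the average in general decays only like \<open>1 / r\<close>. Once one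
  average has it, the recurrence and \<open>rapidly_decreasing_cancel\<close> give it to the
  derivative.\<close>

lemma dilation_average_schwartz:
  assumes "\<phi> \<in> schwartz" "rapidly_decreasing (dilation_average k \<phi>)"
  shows "dilation_average k \<phi> \<in> schwartz"
proof -
  define C where "C = {dilation_average k \<phi> |k \<phi>. \<phi> \<in> schwartz \<and> rapidly_decreasing (dilation_average k \<phi>)}"
  have "C \<subseteq> schwartz"
  proof (rule schwartz_coinduct)
    fix \<theta> and r b :: real assume "\<theta> \<in> C"
    then obtain k \<phi> where \<theta>: "\<theta> = dilation_average k \<phi>" and S: "\<phi> \<in> schwartz" and r: "rapidly_decreasing \<theta>"
      unfolding C_def by auto
    have S': "partial_deriv 1 \<phi> \<in> schwartz" using S by (rule schwartz_partial_deriv) simp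
    note D = dilation_average_has_vector_derivative[OF S, of k, folded \<theta>, unfolded has_vector_derivative_def]
    show "\<theta> differentiable (at r)" using D differentiable_def by blast
    show "rapidly_decreasing \<theta>" by fact
    assume b: "b \<in> Basis"
    have eq: "partial_deriv b \<theta> = dilation_average (Suc k) (partial_deriv 1 \<phi>)"
      using b by (intro ext) (simp add: partial_deriv_eqI[OF D])
    obtain B where B: "\<And>r. norm (partial_deriv 1 \<phi> r) \<le> B" using schwartz_bounded[OF S'] by blast
    have "rapidly_decreasing (\<lambda>r. of_real r * dilation_average (Suc k) (partial_deriv 1 \<phi>) r)"
      unfolding dilation_average_recurrence[OF S]
      using rapidly_decreasing_lincomb[OF schwartz_rapidly_decreasing[OF S] r, of 1 "- of_nat (Suc k)"]
      by (simp add: \<theta> algebra_simps)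
    then have "rapidly_decreasing (dilation_average (Suc k) (partial_deriv 1 \<phi>))"
      by (rule rapidly_decreasing_cancel[OF _ dilation_average_bounded[OF S' B]])
    then show "partial_deriv b \<theta> \<in> C"
      unfolding eq C_def using S' by blast
  qed
  then show ?thesis using assms unfolding C_def by blast
qed

text \<open>The derivative of an even function is odd and vanishes at 0, so averaging
  \<open>h''\<close> over the segment from 0 to \<open>r\<close> recovers the quotient.\<close>

lemma even_schwartz_derivative_quotient:
  fixes h :: "real \<Rightarrow> complex"
  assumes S: "h \<in> schwartz" and even: "\<And>r. h (- r) = h r"
  obtains u where "u \<in> schwartz" "\<And>r. u (- r) = u r" "\<And>r. partial_deriv 1 h r = of_real r * u r"
proof
  let ?h' = "partial_deriv 1 h"
  let ?u = "dilation_average 0 (partial_deriv 1 ?h')"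
  have S': "?h' \<in> schwartz" using S by (rule schwartz_partial_deriv) simp
  have S'': "partial_deriv 1 ?h' \<in> schwartz" using S' by (rule schwartz_partial_deriv) simp
  have odd: "?h' (- r) = - ?h' r" for r
  proof -
    have "(h \<circ> uminus has_vector_derivative (- 1) *\<^sub>R ?h' (- r)) (at r)"
      by (rule vector_diff_chain_at[OF _ schwartz_has_vector_derivative[OF S]])
         (auto intro!: derivative_eq_intros)
    moreover have "h \<circ> uminus = h" using even by auto
    ultimately have "(h has_vector_derivative - ?h' (- r)) (at r)" by simp
    from vector_derivative_unique_at[OF this schwartz_has_vector_derivative[OF S]]
    show ?thesis by (simp add: minus_equation_iff)
  qed
  from odd[of 0] have "?h' 0 = 0" by (simp add: complex_eq_iff)
  then show eq: "?h' r = of_real r * ?u r" for r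
    using dilation_average_0[OF S', of r] by simp
  obtain B where B: "\<And>r. norm (partial_deriv 1 ?h' r) \<le> B" using schwartz_bounded[OF S''] by blast
  have "rapidly_decreasing (\<lambda>r. of_real r * ?u r)"
    using schwartz_rapidly_decreasing[OF S'] eq by (metis (no_types, lifting) ext)
  then have "rapidly_decreasing ?u"
    by (rule rapidly_decreasing_cancel[OF _ dilation_average_bounded[OF S'' B]])
  then show "?u \<in> schwartz"
    by (rule dilation_average_schwartz[OF S''])
  show "?u (- r) = ?u r" for r
  proof (cases "r = 0")
    case False
    have "of_real (- r) * ?u (- r) = - (of_real r * ?u r)"
      using odd[of r] eq[of r] eq[of "- r"] by metis
    then have "of_real r * ?u (- r) = of_real r * ?u r" by simp
    then show ?thesis using False by simp
  qed simp
qed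

section \<open>Radial Schwartz functions\<close>

text \<open>The partial derivatives of \<open>h (norm x)\<close> are coordinates times
  \<open>u (norm x)\<close>, with \<open>u\<close> again even and Schwartz. Coordinate multiples and
  linear combinations of radial functions are thus what closure under differentiation calls
  for.\<close>

inductive_set radial_class :: "('a::euclidean_space \<Rightarrow> complex) set" where
  radial: "h \<in> schwartz \<Longrightarrow> (\<And>r. h (- r) = h r) \<Longrightarrow> (\<lambda>x. h (norm x)) \<in> radial_class"
| mult: "g \<in> radial_class \<Longrightarrow> b \<in> Basis \<Longrightarrow> (\<lambda>x. of_real (x \<bullet> b) * g x) \<in> radial_class"
| lincomb: "g \<in> radial_class \<Longrightarrow> g' \<in> radial_class \<Longrightarrow> (\<lambda>x. c * g x + g' x) \<in> radial_class"

lemma even_schwartz_norm_has_derivative: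
  fixes x :: "'a::euclidean_space"
  assumes S: "h \<in> schwartz" and u: "\<And>r. partial_deriv 1 h r = of_real r * u r"
  shows "((\<lambda>x. h (norm x)) has_derivative (\<lambda>y. of_real (x \<bullet> y) * u (norm x))) (at x)"
proof (cases "x = 0")
  case True
  \<comment> \<open>The norm is not differentiable at the origin; there \<open>h' 0 = 0\<close>
    gives the derivative directly.\<close>
  have "(h has_derivative (\<lambda>_. 0)) (at 0)"
    using schwartz_has_vector_derivative[OF S, of 0] u[of 0] by (simp add: has_vector_derivative_def)
  then have h: "\<exists>d>0. \<forall>r. norm (r - 0) < d \<longrightarrow> norm (h r - h 0 - 0) \<le> e * norm (r - 0)" if "e > 0" for e
    using that unfolding has_derivative_at_alt by blast
  have "\<exists>d>0. \<forall>y::'a. norm (y - 0) < d \<longrightarrow> norm (h (norm y) - h (norm (0::'a)) - 0) \<le> e * norm (y - 0)" if e: "e > 0" for e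
  proof -
    obtain d where "d > 0" and d: "\<And>r. norm (r - 0) < d \<Longrightarrow> norm (h r - h 0 - 0) \<le> e * norm (r - 0)"
      using h[OF e] by blast
    show ?thesis
      using d[of "norm _"] \<open>d > 0\<close> by (intro exI[of _ d]) auto
  qed
  then have "((\<lambda>x::'a. h (norm x)) has_derivative (\<lambda>_. 0)) (at 0)"
    unfolding has_derivative_at_alt by simp
  then show ?thesis using True by simp
next
  case False
  have "((\<lambda>x. h (norm x)) has_derivative (\<lambda>y. (y \<bullet> sgn x) *\<^sub>R partial_deriv 1 h (norm x))) (at x)"
    using has_derivative_compose[OF has_derivative_norm[OF False]
        schwartz_has_vector_derivative[OF S, unfolded has_vector_derivative_def]] .
  moreover have "(y \<bullet> sgn x) *\<^sub>R partial_deriv 1 h (norm x) = of_real (x \<bullet> y) * u (norm x)" for y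
    using False by (simp add: u sgn_div_norm scaleR_conv_of_real inner_commute)
  ultimately show ?thesis by simp
qed

lemma radial_class_props:
  assumes "g \<in> radial_class"
  shows "(\<forall>x. g differentiable (at x)) \<and> rapidly_decreasing g \<and> (\<forall>c\<in>Basis. partial_deriv c g \<in> radial_class)"
  using assms
proof induction
  case (radial h)
  obtain u where u: "u \<in> schwartz" "\<And>r. u (- r) = u r" "\<And>r. partial_deriv 1 h r = of_real r * u r"
    using even_schwartz_derivative_quotient[OF radial] by blast
  note D = even_schwartz_norm_has_derivative[OF radial(1) u(3), where 'a = 'a]
  have "rapidly_decreasing (\<lambda>x::'a. h (norm x))"
    unfolding rapidly_decreasing_def
  proof
    fix k :: nat
    obtain B where B: "\<And>r. (1 + norm r) ^ k * norm (h r) \<le> B"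
      using rapidly_decreasingE[OF schwartz_rapidly_decreasing[OF radial(1)]] by metis
    have "(1 + norm x) ^ k * norm (h (norm x)) \<le> B" for x :: 'a
      using B[of "norm x"] by simp
    then show "\<exists>B. \<forall>x::'a. (1 + norm x) ^ k * norm (h (norm x)) \<le> B" by blast
  qed
  moreover have "partial_deriv c (\<lambda>x. h (norm x)) \<in> radial_class" if "c \<in> Basis" for c :: 'a
  proof -
    have "partial_deriv c (\<lambda>x. h (norm x)) = (\<lambda>x. of_real (x \<bullet> c) * u (norm x))"
      by (rule ext) (simp add: partial_deriv_eqI[OF D])
    then show ?thesis
      using radial_class.mult[OF radial_class.radial[OF u(1,2)] that] by simp
  qed
  ultimately show ?case using D differentiable_def by blast
next
  case (mult g b)
  have D: "((\<lambda>x. of_real (x \<bullet> b) * g x) has_derivative (\<lambda>h. of_real (x \<bullet> b) * frechet_derivative g (at x) h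
        + of_real (h \<bullet> b) * g x)) (at x)" for x
    using mult.IH by (auto intro!: derivative_eq_intros simp flip: frechet_derivative_works)
  have "rapidly_decreasing (\<lambda>x. of_real (x \<bullet> b) * g x)"
    using Basis_le_norm[OF mult(2)] mult.IH
    by (intro rapidly_decreasing_mult) (auto simp: add_increasing)
  moreover have "partial_deriv c (\<lambda>x. of_real (x \<bullet> b) * g x) \<in> radial_class" if c: "c \<in> Basis" for c
  proof -
    have "partial_deriv c (\<lambda>x. of_real (x \<bullet> b) * g x) =
        (\<lambda>x. of_real (c \<bullet> b) * g x + of_real (x \<bullet> b) * partial_deriv c g x)"
      by (rule ext) (simp add: partial_deriv_eqI[OF D], simp add: partial_deriv_def)
    then show ?thesis
      using radial_class.lincomb[OF mult(1) radial_class.mult[of "partial_deriv c g" b]] mult c by simp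
  qed
  ultimately show ?case using D differentiable_def by blast
next
  case (lincomb g g' a)
  have D: "((\<lambda>x. a * g x + g' x) has_derivative (\<lambda>h. a * frechet_derivative g (at x) h
        + frechet_derivative g' (at x) h)) (at x)" for x
    using lincomb.IH by (auto intro!: derivative_intros simp flip: frechet_derivative_works)
  have "rapidly_decreasing (\<lambda>x. a * g x + g' x)"
    using rapidly_decreasing_lincomb[of g g' a 1] lincomb.IH by simp
  moreover have "partial_deriv c (\<lambda>x. a * g x + g' x) \<in> radial_class" if c: "c \<in> Basis" for c
  proof -
    have "partial_deriv c (\<lambda>x. a * g x + g' x) = (\<lambda>x. a * partial_deriv c g x + partial_deriv c g' x)"
      by (rule ext) (simp add: partial_deriv_eqI[OF D], simp add: partial_deriv_def)
    then show ?thesis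
      using radial_class.lincomb[of "partial_deriv c g" "partial_deriv c g'" a] lincomb c by simp
  qed
  ultimately show ?case using D differentiable_def by blast
qed

theorem rotation_schwartz:
  assumes "h \<in> schwartz" "\<And>r. h (- r) = h r"
  shows "rotation h \<in> schwartz"
proof -
  have "radial_class \<subseteq> (schwartz :: ('a \<Rightarrow> complex) set)"
    using radial_class_props by (intro schwartz_coinduct) blast+
  then show ?thesis
    using radial_class.radial[OF assms] unfolding rotation_def[abs_def] by blast
qed

lemma even_part_schwartz:
  assumes "\<psi> \<in> schwartz" shows "even_part \<psi> \<in> schwartz"
proof -
  have "even_part \<psi> = (\<lambda>r. (1/2) * \<psi> r + (1/2) * \<psi> (- r))"
    by (rule ext) (simp add: even_part_def)
  then show ?thesis
    using schwartz_lincomb[OF assms schwartz_reflect[OF assms], of "1/2" "1/2"] by (simp only:)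
qed

text \<open>This makes \<open>rotation_dual\<close> meaningful: a distribution is evaluated at a
  genuine test function.\<close>

lemma rotation_even_part_schwartz:
  "\<psi> \<in> schwartz \<Longrightarrow> rotation (even_part \<psi>) \<in> schwartz"
  by (rule rotation_schwartz[OF even_part_schwartz]) (simp_all add: even_part_def add.commute)

section \<open>Positive definite functions\<close>

text \<open>Coefficients that sit at the same point are added up in \<open>\<beta>\<close>, which
  brings the sum back to pairwise distinct points. Coincidences occur later when points are
  variables of integration or are projected to a line.\<close>

lemma positive_definite_sum_nonneg:
  fixes x :: "'i \<Rightarrow> 'a::euclidean_space"
  assumes pd: "positive_definite \<Phi>" and I: "finite I"
  shows "(\<Sum>j\<in>I. \<Sum>k\<in>I. \<alpha> j * cnj (\<alpha> k) * \<Phi> (x j - x k)) \<in> \<real>\<^sub>\<ge>\<^sub>0"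
proof -
  define \<beta> where "\<beta> y = (\<Sum>j\<in>{j\<in>I. x j = y}. \<alpha> j)" for y
  define S where "S y = (\<Sum>z\<in>x ` I. cnj (\<beta> z) * \<Phi> (y - z))" for y
  have fin: "finite (x ` I)" using I by simp
  have S: "S y = (\<Sum>k\<in>I. cnj (\<alpha> k) * \<Phi> (y - x k))" for y
  proof -
    have "S y = (\<Sum>z\<in>x ` I. \<Sum>k\<in>{k\<in>I. x k = z}. cnj (\<alpha> k) * \<Phi> (y - x k))"
      unfolding S_def by (intro sum.cong refl) (simp add: \<beta>_def sum_distrib_right)
    also have "\<dots> = (\<Sum>k\<in>I. cnj (\<alpha> k) * \<Phi> (y - x k))"
      by (rule sum.group[OF I fin]) simp
    finally show ?thesis .
  qed
  obtain e where e: "bij_betw e {1..card (x ` I)} (x ` I)"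
    using ex_bij_betw_nat_finite_1[OF fin] by blast
  have "(\<Sum>j=1..card (x ` I). \<Sum>k=1..card (x ` I). \<beta> (e j) * cnj (\<beta> (e k)) * \<Phi> (e j - e k)) \<in> \<real>\<^sub>\<ge>\<^sub>0"
    using pd e unfolding positive_definite_def bij_betw_def
    by (elim conjE allE[of _ "card (x ` I)"] allE[of _ e] allE[of _ "\<lambda>i. \<beta> (e i)"]) blast
  also have "(\<Sum>j=1..card (x ` I). \<Sum>k=1..card (x ` I). \<beta> (e j) * cnj (\<beta> (e k)) * \<Phi> (e j - e k))
     = (\<Sum>y\<in>x ` I. \<Sum>z\<in>x ` I. \<beta> y * cnj (\<beta> z) * \<Phi> (y - z))"
    by (subst sum.reindex_bij_betw[OF e, symmetric], subst sum.reindex_bij_betw[OF e, symmetric]) simp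
  also have "\<dots> = (\<Sum>y\<in>x ` I. \<beta> y * S y)"
    by (simp add: S_def sum_distrib_left mult.assoc)
  also have "\<dots> = (\<Sum>y\<in>x ` I. \<Sum>j\<in>{j\<in>I. x j = y}. \<alpha> j * S (x j))"
    by (intro sum.cong refl) (simp add: \<beta>_def sum_distrib_right)
  also have "\<dots> = (\<Sum>j\<in>I. \<alpha> j * S (x j))"
    by (rule sum.group[OF I fin]) simp
  also have "\<dots> = (\<Sum>j\<in>I. \<Sum>k\<in>I. \<alpha> j * cnj (\<alpha> k) * \<Phi> (x j - x k))"
    by (simp add: S sum_distrib_left mult.assoc)
  finally show ?thesis .
qed

text \<open>Use the two points \<open>x\<close> and \<open>0\<close> with coefficients
  \<open>1\<close> and \<open>c\<close>: \<open>c = 1\<close> and \<open>c = \<i>\<close> give the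
  symmetry, and \<open>c = - sgn (\<Phi> x)\<close> gives the bound.\<close>

lemma
  fixes \<Phi> :: "'a::euclidean_space \<Rightarrow> complex"
  assumes pd: "positive_definite \<Phi>"
  shows positive_definite_hermitian: "\<Phi> (- x) = cnj (\<Phi> x)"
    and positive_definite_0: "\<Phi> 0 \<in> \<real>\<^sub>\<ge>\<^sub>0"
    and positive_definite_bounded: "norm (\<Phi> x) \<le> Re (\<Phi> 0)"
proof -
  have *: "\<Phi> 0 + cnj c * \<Phi> x + c * \<Phi> (- x) + c * cnj c * \<Phi> 0 \<in> \<real>\<^sub>\<ge>\<^sub>0" for c
    using positive_definite_sum_nonneg[OF pd, of "{False, True}" "\<lambda>b. if b then c else 1" "\<lambda>b. if b then 0 else x"]
    by (simp add: algebra_simps)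
  show 0: "\<Phi> 0 \<in> \<real>\<^sub>\<ge>\<^sub>0" using *[of 0] by simp
  then have i0: "Im (\<Phi> 0) = 0" by (simp add: complex_nonneg_Reals_iff)
  show h: "\<Phi> (- x) = cnj (\<Phi> x)"
    using *[of 1] *[of \<i>] i0 by (auto simp: complex_eq_iff complex_nonneg_Reals_iff)
  show "norm (\<Phi> x) \<le> Re (\<Phi> 0)"
  proof (cases "\<Phi> x = 0")
    case True
    then show ?thesis using 0 by (simp add: complex_nonneg_Reals_iff)
  next
    case False
    define s where "s = sgn (\<Phi> x)"
    have s: "s * cnj s = 1"
      using False complex_norm_square[of s] by (simp add: s_def norm_sgn)
    have \<Phi>: "\<Phi> x = of_real (norm (\<Phi> x)) * s"
      using False by (simp add: s_def sgn_eq)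
    have "cnj s * \<Phi> x = of_real (norm (\<Phi> x))" "s * cnj (\<Phi> x) = of_real (norm (\<Phi> x))"
      by (subst \<Phi>, use s in \<open>simp add: mult_ac\<close>)+
    then have "\<Phi> 0 - of_real (norm (\<Phi> x)) - of_real (norm (\<Phi> x)) + \<Phi> 0 \<in> \<real>\<^sub>\<ge>\<^sub>0"
      using *[of "- s"] s unfolding h by simp
    then show ?thesis by (simp add: complex_nonneg_Reals_iff)
  qed
qed

text \<open>Integrating the finite sums over \<open>N\<close> independent points gives
  \<open>N \<integral> k x x + N (N - 1) \<integral>\<integral> k x y \<ge> 0\<close>; divide by \<open>N\<^sup>2\<close>. The induction adds one random
  point at a time to some fixed points, so that no product measure is needed.\<close>

lemma (in prob_space) kernel_integral_nonneg:
  fixes k :: "'a \<Rightarrow> 'a \<Rightarrow> real"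
  assumes sym: "\<And>x y. k x y = k y x" and B: "\<And>x y. \<bar>k x y\<bar> \<le> B"
    and sp: "space M = UNIV"
    and k [measurable]: "case_prod k \<in> borel_measurable (M \<Otimes>\<^sub>M M)"
    and pos: "\<And>m y. 0 \<le> (\<Sum>i<(m::nat). \<Sum>j<m. k (y i) (y j))"
  shows "0 \<le> (\<integral>x. (\<integral>y. k x y \<partial>M) \<partial>M)"
proof -
  define g where "g x = (\<integral>y. k x y \<partial>M)" for x
  define D where "D = (\<integral>x. k x x \<partial>M)"
  define J where "J = (\<integral>x. g x \<partial>M)"
  have k1 [measurable]: "k x \<in> borel_measurable M" for x
    using measurable_compose[OF measurable_Pair1' k, of x] sp by simp
  have k2 [measurable]: "(\<lambda>x. k x y) \<in> borel_measurable M" for y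
  proof -
    have "(\<lambda>x. k x y) = k y" by (rule ext) (rule sym)
    then show ?thesis using k1[of y] by simp
  qed
  have kd [measurable]: "(\<lambda>x. k x x) \<in> borel_measurable M"
    using measurable_compose[OF measurable_Pair[OF measurable_ident measurable_ident] k]
    by simp
  have g [measurable]: "g \<in> borel_measurable M"
    unfolding g_def by (rule borel_measurable_lebesgue_integral) (rule k)
  have i1: "integrable M (k x)" for x
    by (rule integrable_const_bound[where B = B]) (auto simp: B)
  have id: "integrable M (\<lambda>x. k x x)"
    by (rule integrable_const_bound[where B = B]) (auto simp: B)
  have "\<bar>g x\<bar> \<le> B" for x
  proof -
    have "\<bar>g x\<bar> \<le> (\<integral>y. \<bar>k x y\<bar> \<partial>M)"
      unfolding g_def by (rule integral_abs_bound)
    also have "\<dots> \<le> (\<integral>y. B \<partial>M)"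
      using i1 B by (intro integral_mono) auto
    finally show ?thesis by (simp add: prob_space)
  qed
  then have ig: "integrable M g"
    by (intro integrable_const_bound[where B = B]) auto
  have ind: "0 \<le> (\<Sum>i<m. \<Sum>j<m. k (y i) (y j)) + 2 * real N * (\<Sum>i<m. g (y i)) + real N * D
      + real N * (real N - 1) * J" for m N :: nat and y
  proof (induction N arbitrary: m y)
    case 0
    then show ?case using pos by simp
  next
    case (Suc N)
    let ?y = "\<lambda>x. y(m := x)"
    have a: "(\<Sum>i<Suc m. \<Sum>j<Suc m. k (?y x i) (?y x j))
        = (\<Sum>i<m. \<Sum>j<m. k (y i) (y j)) + 2 * (\<Sum>i<m. k (y i) x) + k x x" for x
    proof -
      have "k x (y j) = k (y j) x" for j by (rule sym)
      then show ?thesis by (simp add: sum.distrib cong: sum.cong_simp)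
    qed
    have b: "(\<Sum>i<Suc m. g (?y x i)) = (\<Sum>i<m. g (y i)) + g x" for x
      by (simp cong: sum.cong_simp)
    have "(\<Sum>i<Suc m. \<Sum>j<Suc m. k (?y x i) (?y x j)) + 2 * real N * (\<Sum>i<Suc m. g (?y x i)) + real N * D
        + real N * (real N - 1) * J
      = (\<Sum>i<m. \<Sum>j<m. k (y i) (y j)) + 2 * real N * (\<Sum>i<m. g (y i)) + real N * D
        + real N * (real N - 1) * J + 2 * (\<Sum>i<m. k (y i) x) + k x x + 2 * real N * g x" (is "?L x = ?R x") for x
      unfolding a b by (simp only: distrib_left distrib_right add_ac)
    moreover have "0 \<le> ?L x" for x by (rule Suc)
    ultimately have "0 \<le> ?R x" for x by (simp only:)
    then have "0 \<le> (\<integral>x. ?R x \<partial>M)" by (intro integral_nonneg_AE AE_I2)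
    also have "(\<integral>x. ?R x \<partial>M) = (\<Sum>i<m. \<Sum>j<m. k (y i) (y j)) + 2 * real N * (\<Sum>i<m. g (y i)) + real N * D
        + real N * (real N - 1) * J + 2 * (\<Sum>i<m. g (y i)) + D + 2 * real N * J"
      using i1 id ig by (simp add: prob_space g_def[symmetric] D_def[symmetric] J_def[symmetric])
    finally show ?case by (simp add: algebra_simps)
  qed
  have "0 \<le> D / real (Suc N) + J" for N
  proof -
    have "0 \<le> real (Suc (Suc N)) * D + real (Suc (Suc N)) * real (Suc N) * J"
      using ind[of undefined 0 "Suc (Suc N)"] by simp
    then have "0 \<le> real (Suc (Suc N)) * (D + real (Suc N) * J)"
      by (simp only: distrib_left mult.assoc)
    then have "0 \<le> D + real (Suc N) * J"
      by (simp only: zero_le_mult_iff) auto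
    then show ?thesis by (simp add: field_simps)
  qed
  moreover have "(\<lambda>N. D / real (Suc N) + J) \<longlonglongrightarrow> 0 + J"
    by (intro tendsto_intros LIMSEQ_Suc lim_const_over_n)
  ultimately have "0 \<le> J" by (intro LIMSEQ_le_const) auto
  then show ?thesis by (simp add: J_def g_def[abs_def])
qed

section \<open>Gaussian windows of positive definite functions\<close>

text \<open>The parallelogram law separates the midpoint of \<open>y + z\<close> and
  \<open>y\<close> from their difference \<open>z\<close>.\<close>

lemma gauss_mult_gauss:
  fixes y z :: "'a::euclidean_space"
  shows "gauss (y + z) * gauss y = gauss (sqrt 2 *\<^sub>R ((1/2) *\<^sub>R z + y)) * gauss (inverse (sqrt 2) *\<^sub>R z)"
proof -
  have "(norm (y + z))\<^sup>2 + (norm y)\<^sup>2 = 2 * (norm ((1/2) *\<^sub>R z + y))\<^sup>2 + (norm z)\<^sup>2 / 2"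
    unfolding power2_norm_eq_inner by (simp add: inner_simps inner_commute field_simps)
  moreover have "(norm (sqrt 2 *\<^sub>R u))\<^sup>2 = 2 * (norm u)\<^sup>2" "(norm (inverse (sqrt 2) *\<^sub>R u))\<^sup>2 = (norm u)\<^sup>2 / 2" for u :: 'a
    by (simp_all add: power_mult_distrib power_divide inverse_eq_divide)
  ultimately show ?thesis
    by (simp only: gauss_def mult_exp_exp distrib_left[symmetric])
qed

text \<open>A cruder separation, in \<open>y\<close> and \<open>z\<close> themselves, which supplies
  the product majorant for the interchange of integrals below.\<close>

lemma gauss_mult_gauss_le:
  fixes y z :: "'a::euclidean_space"
  shows "gauss (y + z) * gauss y \<le> gauss ((1/2) *\<^sub>R z) * gauss ((1/2) *\<^sub>R y)"
proof -
  have "norm z \<le> norm (y + z) + norm y"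
    by (metis add_diff_cancel_left' norm_triangle_ineq4)
  then have "(norm z)\<^sup>2 \<le> (norm (y + z) + norm y)\<^sup>2" by (intro power_mono) auto
  also have "\<dots> \<le> 2 * ((norm (y + z))\<^sup>2 + (norm y)\<^sup>2)"
    by (simp add: power2_sum) (use sum_squares_bound[of "norm (y + z)" "norm y"] in linarith)
  finally have "(norm z)\<^sup>2 / 4 + (norm y)\<^sup>2 / 4 \<le> (norm (y + z))\<^sup>2 + (norm y)\<^sup>2"
    using zero_le_power2[of "norm (y + z)"] zero_le_power2[of "norm y"] by argo
  then have "pi * ((norm z)\<^sup>2 / 4 + (norm y)\<^sup>2 / 4) \<le> pi * ((norm (y + z))\<^sup>2 + (norm y)\<^sup>2)"
    by (intro mult_left_mono) auto
  then show ?thesis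
    by (simp add: gauss_def mult_exp_exp power_mult_distrib power_divide algebra_simps)
qed

text \<open>The difference of two independent Gaussian points is Gaussian, wider by the factor
  \<open>sqrt 2\<close>. The first factor on the right is the integral over the midpoint, a positive
  constant.\<close>

lemma gauss_double_integral:
  fixes K :: "'a::euclidean_space \<Rightarrow> real"
  assumes [measurable]: "K \<in> borel_measurable borel" and B: "\<And>z. \<bar>K z\<bar> \<le> B"
  shows "(\<integral>y. (\<integral>x. K (x - y) * gauss x * gauss y \<partial>lborel) \<partial>lborel)
    = (\<integral>y. gauss (sqrt 2 *\<^sub>R (y :: 'a)) \<partial>lborel) * (\<integral>z. K z * gauss (inverse (sqrt 2) *\<^sub>R z) \<partial>lborel)"
proof -
  have "B \<ge> 0" using B[of undefined] by linarith
  define h where "h z = gauss ((1/2) *\<^sub>R z)" for z :: 'a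
  have hpos: "h z > 0" for z by (simp add: h_def)
  have [measurable]: "h \<in> borel_measurable borel" unfolding h_def by measurable
  have h: "integrable lborel h"
    unfolding h_def by (rule integrable_gauss_scaled) simp
  \<comment> \<open>Dividing the integrand by the majorant \<open>h y * h z\<close> leaves a kernel
    bounded by \<open>B\<close>, as \<open>Fubini_kernel\<close> demands.\<close>
  define \<kappa> where "\<kappa> y z = K z * (gauss (y + z) * gauss y) / (h y * h z)" for y z
  have \<kappa>: "\<kappa> y z * h y * h z = K z * gauss (y + z) * gauss y" for y z
    using hpos[of y] hpos[of z] by (simp add: \<kappa>_def)
  have bd: "norm (\<kappa> y z) \<le> B" for y z
  proof -
    have "norm (\<kappa> y z) = \<bar>K z\<bar> * ((gauss (y + z) * gauss y) / (h y * h z))"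
      using hpos[of y] hpos[of z] by (simp add: \<kappa>_def abs_mult)
    moreover have "(gauss (y + z) * gauss y) / (h y * h z) \<le> 1"
      using gauss_mult_gauss_le[of y z] hpos[of y] hpos[of z] by (simp add: h_def mult.commute)
    then have "\<bar>K z\<bar> * ((gauss (y + z) * gauss y) / (h y * h z)) \<le> \<bar>K z\<bar> * 1"
      by (intro mult_left_mono) auto
    ultimately show ?thesis using B[of z] by simp
  qed
  have "(\<integral>y. (\<integral>x. K (x - y) * gauss x * gauss y \<partial>lborel) \<partial>lborel)
      = (\<integral>y. (\<integral>z. K (y + z - y) * gauss (y + z) * gauss y \<partial>lborel) \<partial>lborel)"
    by (intro Bochner_Integration.integral_cong refl lborel_integral_translate[symmetric]) measurable
  also have "\<dots> = (\<integral>y. (\<integral>z. \<kappa> y z * h y * h z \<partial>lborel) \<partial>lborel)"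
    unfolding \<kappa> by simp
  also have "\<dots> = (\<integral>z. (\<integral>y. \<kappa> y z * h y * h z \<partial>lborel) \<partial>lborel)"
    by (rule lborel_pair.Fubini_kernel[OF h h _ bd]) (unfold \<kappa>_def, measurable)
  also have "\<dots> = (\<integral>z. (\<integral>y. gauss (sqrt 2 *\<^sub>R ((1/2) *\<^sub>R z + y)) * (K z * gauss (inverse (sqrt 2) *\<^sub>R z)) \<partial>lborel) \<partial>lborel)"
  proof (intro Bochner_Integration.integral_cong refl)
    fix y z
    show "\<kappa> y z * h y * h z = gauss (sqrt 2 *\<^sub>R ((1/2) *\<^sub>R z + y)) * (K z * gauss (inverse (sqrt 2) *\<^sub>R z))"
      unfolding \<kappa> unfolding mult.assoc gauss_mult_gauss by (simp only: mult_ac)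
  qed
  also have "\<dots> = (\<integral>z. (\<integral>y. gauss (sqrt 2 *\<^sub>R y) \<partial>(lborel :: 'a measure)) * (K z * gauss (inverse (sqrt 2) *\<^sub>R z)) \<partial>lborel)"
  proof (intro Bochner_Integration.integral_cong refl)
    fix z :: 'a
    show "(\<integral>y. gauss (sqrt 2 *\<^sub>R ((1/2) *\<^sub>R z + y)) * (K z * gauss (inverse (sqrt 2) *\<^sub>R z)) \<partial>lborel)
       = (\<integral>y. gauss (sqrt 2 *\<^sub>R y) \<partial>(lborel :: 'a measure)) * (K z * gauss (inverse (sqrt 2) *\<^sub>R z))"
      unfolding integral_mult_left_zero
      by (subst lborel_integral_translate[where f = "\<lambda>y. gauss (sqrt 2 *\<^sub>R y)"]) auto
  qed
  also have "\<dots> = (\<integral>y. gauss (sqrt 2 *\<^sub>R (y :: 'a)) \<partial>lborel) * (\<integral>z. K z * gauss (inverse (sqrt 2) *\<^sub>R z) \<partial>lborel)"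
    by (rule integral_mult_right_zero)
  finally show ?thesis .
qed

lemma integral_gauss_scaled_pos:
  assumes "t > 0" shows "(\<integral>y. gauss (t *\<^sub>R (y :: 'a::euclidean_space)) \<partial>lborel) > 0"
proof -
  have "1 = t ^ DIM('a) *\<^sub>R (\<integral>y. gauss (t *\<^sub>R (y :: 'a)) \<partial>lborel)"
    using lborel_integral_affine[of t "gauss :: 'a \<Rightarrow> real" 0] assms by simp
  then show ?thesis using assms by (metis real_scaleR_def zero_less_mult_pos zero_less_one zero_less_power)
qed

text \<open>Multiplying \<open>\<phi> (x - y)\<close> by a character of \<open>x - y\<close> keeps
  it positive definite, since the character splits into factors that the coefficients absorb.
  Gaussian averaging of the real part then gives a single integral with a Gaussian window.\<close>

lemma positive_definite_gauss_cos_nonneg: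
  fixes \<phi> :: "'a::euclidean_space \<Rightarrow> real"
  assumes pd: "positive_definite (\<lambda>x. complex_of_real (\<phi> x))" and t: "t > 0"
  shows "0 \<le> (\<integral>w. \<phi> w * cos (2 * pi * (w \<bullet> v)) * gauss (inverse t *\<^sub>R w) \<partial>lborel)"
proof -
  have cont: "continuous_on UNIV \<phi>"
    using pd continuous_on_Re[of UNIV "\<lambda>x. complex_of_real (\<phi> x)"] by (simp add: positive_definite_def)
  then have [measurable]: "\<phi> \<in> borel_measurable borel"
    by (rule borel_measurable_continuous_onI)
  have sym: "\<phi> (- x) = \<phi> x" for x
    using positive_definite_hermitian[OF pd, of x] by simp
  have \<phi>B: "\<bar>\<phi> x\<bar> \<le> \<phi> 0" for x
    using positive_definite_bounded[OF pd, of x] by simp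
  \<comment> \<open>The points are dilated by \<open>inverse s\<close>, so that the Gaussian of
    width \<open>sqrt 2\<close> of their difference becomes the prescribed window of width
    \<open>t\<close>.\<close>
  define s where "s = sqrt 2 / t"
  have s: "s > 0" using t by (simp add: s_def)
  define K where "K z = \<phi> (inverse s *\<^sub>R z) * cos (2 * pi * ((inverse s *\<^sub>R z) \<bullet> v))" for z
  have [measurable]: "K \<in> borel_measurable borel" unfolding K_def by measurable
  have KB: "\<bar>K z\<bar> \<le> \<phi> 0" for z
    using \<phi>B[of "inverse s *\<^sub>R z"] abs_cos_le_one mult_mono[of "\<bar>\<phi> (inverse s *\<^sub>R z)\<bar>" "\<phi> 0" _ 1]
    by (simp add: K_def abs_mult order_trans[OF abs_ge_zero])
  have sK: "K (x - y) = K (y - x)" for x y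
  proof -
    have e: "inverse s *\<^sub>R (y - x) = - (inverse s *\<^sub>R (x - y))" by (simp add: scaleR_diff_right)
    show ?thesis unfolding K_def e sym by simp
  qed
  let ?\<gamma> = "density lborel (\<lambda>x. ennreal (gauss x)) :: 'a measure"
  interpret \<gamma>: prob_space ?\<gamma>
  proof
    have "emeasure ?\<gamma> (space ?\<gamma>) = (\<integral>\<^sup>+x. ennreal (gauss x) \<partial>(lborel :: 'a measure))"
      by (subst emeasure_density) auto
    also have "\<dots> = ennreal (\<integral>x. gauss x \<partial>(lborel :: 'a measure))"
      by (rule nn_integral_eq_integral) (auto intro: integrable_gauss)
    finally show "emeasure ?\<gamma> (space ?\<gamma>) = 1" by simp
  qed
  have "0 \<le> (\<integral>y. (\<integral>x. K (y - x) \<partial>?\<gamma>) \<partial>?\<gamma>)"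
  proof (rule \<gamma>.kernel_integral_nonneg)
    show "K (x - y) = K (y - x)" for x y by (rule sK)
    show "\<bar>K (x - y)\<bar> \<le> \<phi> 0" for x y by (rule KB)
    fix m :: nat and y :: "nat \<Rightarrow> 'a"
    \<comment> \<open>The coefficients carry the character; the real part of the resulting sum is
      the sum of \<open>K\<close>.\<close>
    let ?\<alpha> = "\<lambda>i. cis (2 * pi * ((inverse s *\<^sub>R y i) \<bullet> v))"
    let ?x = "\<lambda>i. inverse s *\<^sub>R y i"
    have "Re (?\<alpha> i * cnj (?\<alpha> j) * of_real (\<phi> (?x i - ?x j))) = K (y i - y j)" for i j
      by (simp add: K_def cis_cnj cis_mult scaleR_diff_right inner_diff_left algebra_simps)
    then have "Re (\<Sum>i<m. \<Sum>j<m. ?\<alpha> i * cnj (?\<alpha> j) * of_real (\<phi> (?x i - ?x j))) = (\<Sum>i<m. \<Sum>j<m. K (y i - y j))"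
      by (simp only: Re_sum)
    moreover have "(\<Sum>i<m. \<Sum>j<m. ?\<alpha> i * cnj (?\<alpha> j) * of_real (\<phi> (?x i - ?x j))) \<in> \<real>\<^sub>\<ge>\<^sub>0"
      by (rule positive_definite_sum_nonneg[OF pd]) simp
    ultimately show "0 \<le> (\<Sum>i<m. \<Sum>j<m. K (y i - y j))"
      by (simp add: complex_nonneg_Reals_iff)
  qed auto
  also have "(\<integral>y. (\<integral>x. K (y - x) \<partial>?\<gamma>) \<partial>?\<gamma>) = (\<integral>y. (\<integral>x. K (x - y) * gauss x * gauss y \<partial>lborel) \<partial>lborel)"
    by (subst integral_density; (subst integral_density)?)
       (auto simp: sK mult_ac simp flip: integral_mult_right_zero)
  also have "\<dots> = (\<integral>y. gauss (sqrt 2 *\<^sub>R (y :: 'a)) \<partial>lborel) * (\<integral>z. K z * gauss (inverse (sqrt 2) *\<^sub>R z) \<partial>lborel)"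
    by (rule gauss_double_integral[OF _ KB]) measurable
  finally have "0 \<le> (\<integral>z. K z * gauss (inverse (sqrt 2) *\<^sub>R z) \<partial>lborel)"
    using integral_gauss_scaled_pos[of "sqrt 2", where 'a = 'a] by (simp add: zero_le_mult_iff)
  also have "(\<integral>z. K z * gauss (inverse (sqrt 2) *\<^sub>R z) \<partial>lborel)
     = s ^ DIM('a) *\<^sub>R (\<integral>w. K (s *\<^sub>R w) * gauss (inverse (sqrt 2) *\<^sub>R (s *\<^sub>R w)) \<partial>lborel)"
    using s by (subst lborel_integral_affine[where c = s and t = 0]) auto
  also have "(\<integral>w. K (s *\<^sub>R w) * gauss (inverse (sqrt 2) *\<^sub>R (s *\<^sub>R w)) \<partial>lborel)
     = (\<integral>w. \<phi> w * cos (2 * pi * (w \<bullet> v)) * gauss (inverse t *\<^sub>R w) \<partial>lborel)"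
    using s t by (simp add: K_def) (simp add: s_def field_simps)
  finally show ?thesis
    using zero_less_power[OF s, of "DIM('a)"] by (auto simp: zero_le_mult_iff)
qed

text \<open>By \<open>integral_fourier_gauss\<close> the cosine transform of \<open>q n\<close> is a
  Gaussian average of the windowed function \<open>\<psi> n\<close>. As \<open>n\<close> grows the
  window opens while the average concentrates, so the limit is \<open>\<phi>\<close>.\<close>

lemma positive_definite_approximation:
  fixes \<phi> :: "'a::euclidean_space \<Rightarrow> real"
  assumes pd: "positive_definite (\<lambda>x. complex_of_real (\<phi> x))"
  obtains q :: "nat \<Rightarrow> 'a \<Rightarrow> real"
    where "\<And>n v. q n v \<ge> 0" "\<And>n. integrable lborel (q n)"
      "\<And>x. (\<lambda>n. \<integral>v. cos (2 * pi * (x \<bullet> v)) * q n v \<partial>lborel) \<longlonglongrightarrow> \<phi> x"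
proof
  have cont: "continuous_on UNIV \<phi>"
    using pd continuous_on_Re[of UNIV "\<lambda>x. complex_of_real (\<phi> x)"] by (simp add: positive_definite_def)
  then have [measurable]: "\<phi> \<in> borel_measurable borel"
    by (rule borel_measurable_continuous_onI)
  have sym: "\<phi> (- x) = \<phi> x" for x
    using positive_definite_hermitian[OF pd, of x] by simp
  have \<phi>B: "\<bar>\<phi> x\<bar> \<le> \<phi> 0" for x
    using positive_definite_bounded[OF pd, of x] by simp
  have \<phi>0: "0 \<le> \<phi> 0" using \<phi>B[of 0] by linarith
  define t where "t n = real (Suc n)" for n
  have t: "t n > 0" for n by (simp add: t_def)
  define \<psi> where "\<psi> n w = \<phi> w * gauss (inverse (t n) *\<^sub>R w)" for n w
  have [measurable]: "\<psi> n \<in> borel_measurable borel" for n unfolding \<psi>_def by measurable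
  have \<psi>B: "\<bar>\<psi> n w\<bar> \<le> \<phi> 0 * gauss (inverse (t n) *\<^sub>R w)" for n w
    using \<phi>B by (simp add: \<psi>_def abs_mult mult_right_mono)
  have \<psi>B': "\<bar>\<psi> n w\<bar> \<le> \<phi> 0" for n w
    using \<psi>B[of n w] mult_left_mono[OF gauss_le_1 \<phi>0, of "inverse (t n) *\<^sub>R w"] by simp
  have gi: "integrable lborel (\<lambda>w::'a. gauss (inverse (t n) *\<^sub>R w))" for n
    using t[of n] by (intro integrable_gauss_scaled) simp
  have \<psi>i: "integrable lborel (\<psi> n)" for n
    by (rule Bochner_Integration.integrable_bound[OF integrable_mult_right[OF gi[of n], of "\<phi> 0"]])
       (use \<psi>B \<phi>0 in \<open>auto simp: abs_mult\<close>)
  then have \<psi>ic: "integrable lborel (\<lambda>x. complex_of_real (\<psi> n x))" for n by simp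
  define p where "p n v = (\<integral>w. \<phi> w * cos (2 * pi * (w \<bullet> v)) * gauss (inverse (t n) *\<^sub>R w) \<partial>lborel)" for n v
  \<comment> \<open>The transform \<open>p n\<close> is known to be bounded; the second Gaussian
    turns this into integrability.\<close>
  define q where "q n v = gauss (inverse (t n) *\<^sub>R v) * p n v" for n v
  show "q n v \<ge> 0" for n v
    unfolding q_def p_def by (intro mult_nonneg_nonneg positive_definite_gauss_cos_nonneg pd t) simp
  have fp: "fourier (\<lambda>x. complex_of_real (\<psi> n x)) v = of_real (p n v)" for n v
  proof (rule complex_eqI)
    have i: "integrable lborel (\<lambda>w. cis (- 2 * pi * (w \<bullet> v)) * complex_of_real (\<psi> n w))"
      by (intro integrable_cis_mult \<psi>ic) measurable
    show "Re (fourier (\<lambda>x. complex_of_real (\<psi> n x)) v) = Re (of_real (p n v))"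
      unfolding fourier_eq_cis integral_Re[OF i, symmetric]
      by (simp add: p_def \<psi>_def mult_ac)
    \<comment> \<open>The sine part vanishes because the windowed function is even.\<close>
    have "Im (fourier (\<lambda>x. complex_of_real (\<psi> n x)) v) = - (\<integral>w. sin (2 * pi * (w \<bullet> v)) * \<psi> n w \<partial>lborel)"
      unfolding fourier_eq_cis integral_Im[OF i, symmetric] by simp
    moreover have "(\<integral>w. sin (2 * pi * (w \<bullet> v)) * \<psi> n w \<partial>lborel)
        = (\<integral>w. sin (2 * pi * (- w \<bullet> v)) * \<psi> n (- w) \<partial>lborel)"
      by (rule lborel_integral_reflect[symmetric]) measurable
    then have "(\<integral>w. sin (2 * pi * (w \<bullet> v)) * \<psi> n w \<partial>lborel) = 0"
      by (simp add: \<psi>_def sym)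
    ultimately show "Im (fourier (\<lambda>x. complex_of_real (\<psi> n x)) v) = Im (of_real (p n v))"
      by simp
  qed
  have [measurable]: "p n \<in> borel_measurable borel" for n
    unfolding p_def by measurable
  have pB: "\<bar>p n v\<bar> \<le> (\<integral>x. \<bar>\<psi> n x\<bar> \<partial>lborel)" for n v
    using fourier_bounded[OF \<psi>ic, of n v] by (simp add: fp)
  show qi: "integrable lborel (q n)" for n
  proof (rule Bochner_Integration.integrable_bound[OF integrable_mult_right[OF gi[of n], of "\<integral>x. \<bar>\<psi> n x\<bar> \<partial>lborel"]])
    show "AE v in lborel. norm (q n v) \<le> norm ((\<integral>x. \<bar>\<psi> n x\<bar> \<partial>lborel) * gauss (inverse (t n) *\<^sub>R v))"
      using pB by (auto simp: q_def abs_mult intro!: AE_I2 mult_mono)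
  qed (unfold q_def, measurable)
  have key: "complex_of_real (\<integral>v. cos (2 * pi * (x \<bullet> v)) * q n v \<partial>lborel)
      = of_real (Re (\<integral>y. of_real (\<psi> n (x + inverse (t n) *\<^sub>R y)) * of_real (gauss y) \<partial>lborel))" for n x
  proof -
    have i: "integrable lborel (\<lambda>v. cis (2 * pi * (x \<bullet> v)) * complex_of_real (q n v))"
      by (intro integrable_cis_mult) (auto intro: qi)
    have "(\<integral>v. cos (2 * pi * (x \<bullet> v)) * q n v \<partial>lborel) = Re (\<integral>v. cis (2 * pi * (x \<bullet> v)) * complex_of_real (q n v) \<partial>lborel)"
      by (subst integral_Re[OF i, symmetric]) simp
    also have "(\<integral>v. cis (2 * pi * (x \<bullet> v)) * complex_of_real (q n v) \<partial>lborel)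
       = (\<integral>y. of_real (\<psi> n (x + inverse (t n) *\<^sub>R y)) * of_real (gauss y) \<partial>lborel)"
      using integral_fourier_gauss[OF \<psi>ic t, of x n n] by (simp add: fp q_def mult.assoc)
    finally show ?thesis by simp
  qed
  then have key': "(\<integral>v. cos (2 * pi * (x \<bullet> v)) * q n v \<partial>lborel)
      = (\<integral>y. \<psi> n (x + inverse (t n) *\<^sub>R y) * gauss y \<partial>lborel)" for n x
    unfolding of_real_eq_iff by (simp flip: of_real_mult)
  show "(\<lambda>n. \<integral>v. cos (2 * pi * (x \<bullet> v)) * q n v \<partial>lborel) \<longlonglongrightarrow> \<phi> x" for x
  proof -
    have "(\<lambda>n. \<integral>y. \<psi> n (x + inverse (t n) *\<^sub>R y) * gauss y \<partial>lborel) \<longlonglongrightarrow> (\<integral>y. \<phi> x * gauss y \<partial>(lborel :: 'a measure))"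
    proof (rule integral_dominated_convergence)
      show "integrable lborel (\<lambda>y::'a. \<phi> 0 * gauss y)"
        using integrable_gauss by (rule integrable_mult_right)
      show "AE y in lborel. norm (\<psi> n (x + inverse (t n) *\<^sub>R y) * gauss y) \<le> \<phi> 0 * gauss y" for n
        using \<psi>B' by (auto simp: abs_mult intro!: mult_right_mono)
      show "AE y in lborel. (\<lambda>n. \<psi> n (x + inverse (t n) *\<^sub>R y) * gauss y) \<longlonglongrightarrow> \<phi> x * gauss y"
      proof (rule AE_I2)
        fix y
        have l: "(\<lambda>n. x + inverse (t n) *\<^sub>R y) \<longlonglongrightarrow> x + 0 *\<^sub>R y"
          unfolding t_def by (intro tendsto_intros LIMSEQ_inverse_real_of_nat)
        have "(\<lambda>n. \<phi> (x + inverse (t n) *\<^sub>R y)) \<longlonglongrightarrow> \<phi> (x + 0 *\<^sub>R y)"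
          by (rule continuous_on_tendsto_compose[OF cont l]) auto
        moreover have "(\<lambda>n. gauss (inverse (t n) *\<^sub>R (x + inverse (t n) *\<^sub>R y))) \<longlonglongrightarrow> gauss (0 *\<^sub>R (x + 0 *\<^sub>R y))"
          unfolding gauss_def t_def by (intro tendsto_intros LIMSEQ_inverse_real_of_nat)
        ultimately have "(\<lambda>n. \<psi> n (x + inverse (t n) *\<^sub>R y) * gauss y)
            \<longlonglongrightarrow> \<phi> (x + 0 *\<^sub>R y) * gauss (0 *\<^sub>R (x + 0 *\<^sub>R y)) * gauss y"
          unfolding \<psi>_def by (intro tendsto_intros)
        then show "(\<lambda>n. \<psi> n (x + inverse (t n) *\<^sub>R y) * gauss y) \<longlonglongrightarrow> \<phi> x * gauss y" by simp
      qed
    qed measurable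
    then show ?thesis by (simp add: key')
  qed
qed

section \<open>The uniform distribution on the sphere and radial positive definite functions\<close>

lemma nn_integral_lborel_affine:
  fixes f :: "'a::euclidean_space \<Rightarrow> ennreal"
  assumes c: "c \<noteq> 0" and [measurable]: "f \<in> borel_measurable borel"
  shows "(\<integral>\<^sup>+x. f x \<partial>lborel) = ennreal (\<bar>c\<bar> ^ DIM('a)) * (\<integral>\<^sup>+x. f (t + c *\<^sub>R x) \<partial>lborel)"
  by (subst lborel_affine[OF c, of t])
     (simp add: nn_integral_density nn_integral_distr nn_integral_cmult)

lemma orthogonal_transformation_measurable:
  fixes U :: "'a::euclidean_space \<Rightarrow> 'a"
  assumes "orthogonal_transformation U"
  shows "U \<in> borel_measurable borel"
  using assms by (intro borel_measurable_continuous_onI linear_continuous_on)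
    (simp add: orthogonal_transformation_linear flip: linear_conv_bounded_linear)

text \<open>The measure of \<open>A\<close> and of \<open>U -` A\<close> are compared by means of a ball \<open>B\<close>, which is
  invariant under \<open>U\<close>: computing \<open>\<integral>\<integral> 1 A (x + U y) * 1 B (U y)\<close> in either order
  gives \<open>|A| * |B| = |U -` A| * |B|\<close>.\<close>

lemma distr_lborel_orthogonal:
  fixes U :: "'a::euclidean_space \<Rightarrow> 'a"
  assumes U: "orthogonal_transformation U"
  shows "distr lborel borel U = lborel"
proof (rule measure_eqI)
  note [measurable] = orthogonal_transformation_measurable[OF U]
  fix A assume "A \<in> sets (distr lborel borel U)"
  then have [measurable]: "A \<in> sets borel" by simp
  define a b :: "'a \<Rightarrow> ennreal" where "a = indicator A" and "b = indicator (ball 0 1)"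
  have [measurable]: "a \<in> borel_measurable borel" "b \<in> borel_measurable borel"
    unfolding a_def b_def by (auto intro!: borel_measurable_indicator)
  have bU: "b (U y) = b y" for y
    using orthogonal_transformation_norm[OF U, of y] by (auto simp: b_def indicator_def)
  define \<beta> where "\<beta> = (\<integral>\<^sup>+y. b y \<partial>lborel)"
  have \<beta>: "\<beta> = emeasure lborel (ball (0::'a) 1)" by (simp add: \<beta>_def b_def)
  have "(\<integral>\<^sup>+x. a x \<partial>lborel) * \<beta> = (\<integral>\<^sup>+y. (\<integral>\<^sup>+x. a x \<partial>lborel) * b (U y) \<partial>lborel)"
    by (simp add: nn_integral_cmult \<beta>_def bU)
  also have "\<dots> = (\<integral>\<^sup>+y. (\<integral>\<^sup>+x. a (U y + x) * b (U y) \<partial>lborel) \<partial>lborel)"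
  proof (rule nn_integral_cong)
    fix y
    show "(\<integral>\<^sup>+x. a x \<partial>lborel) * b (U y) = (\<integral>\<^sup>+x. a (U y + x) * b (U y) \<partial>lborel)"
      using nn_integral_lborel_affine[of 1 a "U y"] by (simp add: nn_integral_multc)
  qed
  also have "\<dots> = (\<integral>\<^sup>+x. (\<integral>\<^sup>+y. a (U y + x) * b (U y) \<partial>lborel) \<partial>lborel)"
    by (rule lborel_pair.Fubini') measurable
  also have "\<dots> = (\<integral>\<^sup>+x. (\<integral>\<^sup>+y. a (U y) * b (U y - x) \<partial>lborel) \<partial>lborel)"
  proof (rule nn_integral_cong)
    fix x
    obtain z where z: "U z = x"
      using orthogonal_transformation_surj[OF U] by (metis surjD)
    have add: "U (y - z) = U y - x" for y
      using linear_diff[OF orthogonal_transformation_linear[OF U], of y z] z by simp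
    show "(\<integral>\<^sup>+y. a (U y + x) * b (U y) \<partial>lborel) = (\<integral>\<^sup>+y. a (U y) * b (U y - x) \<partial>lborel)"
      using nn_integral_lborel_affine[of 1 "\<lambda>y. a (U y + x) * b (U y)" "- z"] by (simp add: add)
  qed
  also have "\<dots> = (\<integral>\<^sup>+y. (\<integral>\<^sup>+x. a (U y) * b (U y - x) \<partial>lborel) \<partial>lborel)"
    by (rule lborel_pair.Fubini') measurable
  also have "\<dots> = (\<integral>\<^sup>+y. a (U y) * \<beta> \<partial>lborel)"
  proof (rule nn_integral_cong)
    fix y
    have "(\<integral>\<^sup>+x. b (U y - x) \<partial>lborel) = \<beta>"
      using nn_integral_lborel_affine[of "-1" b "U y"] by (simp add: \<beta>_def)
    then show "(\<integral>\<^sup>+x. a (U y) * b (U y - x) \<partial>lborel) = a (U y) * \<beta>"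
      by (simp add: nn_integral_cmult)
  qed
  also have "\<dots> = (\<integral>\<^sup>+y. a (U y) \<partial>lborel) * \<beta>" by (simp add: nn_integral_multc)
  finally have "(\<integral>\<^sup>+x. a x \<partial>lborel) * \<beta> = (\<integral>\<^sup>+y. a (U y) \<partial>lborel) * \<beta>" .
  moreover have "(\<integral>\<^sup>+x. a x \<partial>lborel) = emeasure lborel A" by (simp add: a_def)
  moreover have "(\<integral>\<^sup>+y. a (U y) \<partial>lborel) = emeasure (distr lborel borel U) A"
    by (simp add: nn_integral_distr[symmetric, of U lborel borel a]) (simp add: a_def)
  moreover have "\<beta> \<noteq> 0" "\<beta> \<noteq> top"
    unfolding \<beta> by (simp_all add: emeasure_ball ennreal_eq_0_iff not_le)
  ultimately show "emeasure (distr lborel borel U) A = emeasure lborel A"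
    by (simp add: ennreal_mult_cancel_left mult.commute[of _ \<beta>])
qed simp

lemma prob_space_uniform_ball: "prob_space (uniform_measure lborel (ball (0::'a::euclidean_space) 1))"
  by (rule prob_space_uniform_measure) (simp_all add: emeasure_ball ennreal_eq_0_iff not_le)

lemma sets_uniform_sphere [simp, measurable_cong]: "sets uniform_sphere = sets borel"
  by (simp add: uniform_sphere_def)

lemma space_uniform_sphere [simp]: "space uniform_sphere = UNIV"
  by (simp add: uniform_sphere_def)

lemma prob_space_uniform_sphere: "prob_space (uniform_sphere :: 'a::euclidean_space measure)"
  unfolding uniform_sphere_def
  by (rule prob_space.prob_space_distr[OF prob_space_uniform_ball]) measurable

lemma measure_uniform_sphere_UNIV [simp]: "measure (uniform_sphere :: 'a::euclidean_space measure) UNIV = 1"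
  using prob_space.prob_space[OF prob_space_uniform_sphere] by simp

lemma AE_uniform_sphere_norm: "AE \<xi> in uniform_sphere. norm (\<xi> :: 'a::euclidean_space) = 1"
proof -
  have "AE x in uniform_measure lborel (ball (0::'a) 1). norm (x /\<^sub>R norm x) = 1"
    by (rule AE_uniform_measureI) (use AE_lborel_singleton[of "0::'a"] in \<open>auto elim!: eventually_mono\<close>)
  then show ?thesis
    unfolding uniform_sphere_def by (subst AE_distr_iff) auto
qed

text \<open>An orthogonal map preserves the uniform distribution on the ball and commutes with the
  radial projection.\<close>

lemma distr_uniform_sphere_orthogonal:
  fixes U :: "'a::euclidean_space \<Rightarrow> 'a"
  assumes U: "orthogonal_transformation U"
  shows "distr uniform_sphere borel U = uniform_sphere"
proof -
  note [measurable] = orthogonal_transformation_measurable[OF U]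
  let ?B = "uniform_measure lborel (ball (0::'a) 1)"
  have UB: "distr ?B borel U = ?B"
  proof (rule measure_eqI)
    fix A assume "A \<in> sets (distr ?B borel U)"
    then have [measurable]: "A \<in> sets borel" by simp
    have [measurable]: "U -` A \<in> sets borel"
      using measurable_sets[of U borel borel A] by simp
    have eq: "ball 0 1 \<inter> U -` A = U -` (ball 0 1 \<inter> A)"
      using orthogonal_transformation_norm[OF U] by auto
    have "emeasure (distr ?B borel U) A = emeasure lborel (ball 0 1 \<inter> U -` A) / emeasure lborel (ball (0::'a) 1)"
      by (simp add: emeasure_distr)
    also have "emeasure lborel (ball 0 1 \<inter> U -` A) = emeasure (distr lborel borel U) (ball 0 1 \<inter> A)"
      unfolding eq by (subst emeasure_distr) auto
    finally show "emeasure (distr ?B borel U) A = emeasure ?B A"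
      by (simp add: distr_lborel_orthogonal[OF U])
  qed simp
  have "distr uniform_sphere borel U = distr ?B borel (\<lambda>x. U (x /\<^sub>R norm x))"
    unfolding uniform_sphere_def by (subst distr_distr) (auto simp: o_def)
  also have "(\<lambda>x. U (x /\<^sub>R norm x)) = (\<lambda>x. U x /\<^sub>R norm (U x))"
    using orthogonal_transformation_norm[OF U] orthogonal_transformation_scaleR[OF U] by auto
  also have "distr ?B borel (\<lambda>x. U x /\<^sub>R norm (U x)) = distr (distr ?B borel U) borel (\<lambda>x. x /\<^sub>R norm x)"
    by (subst distr_distr) (auto simp: o_def)
  finally show ?thesis
    by (simp add: UB uniform_sphere_def)
qed

text \<open>Some orthogonal map carries \<open>norm x *\<^sub>R e\<close> to \<open>x\<close>, and
  the sphere measure does not change under it; slice averages therefore depend on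
  \<open>norm x\<close> only.\<close>

lemma uniform_sphere_inner:
  fixes x e :: "real^'n" and h :: "real \<Rightarrow> 'b::{banach, second_countable_topology}"
  assumes [measurable]: "h \<in> borel_measurable borel" and e: "norm e = 1"
  shows "(\<integral>\<xi>. h (x \<bullet> \<xi>) \<partial>uniform_sphere) = (\<integral>\<xi>. h (norm x * (e \<bullet> \<xi>)) \<partial>uniform_sphere)"
proof -
  have "norm (norm x *\<^sub>R e) = norm x" using e by simp
  then obtain U where U: "orthogonal_transformation U" and Ux: "U (norm x *\<^sub>R e) = x"
    using orthogonal_transformation_exists[of "norm x *\<^sub>R e" x] by blast
  note [measurable] = orthogonal_transformation_measurable[OF U]
  have "(\<integral>\<xi>. h (x \<bullet> \<xi>) \<partial>uniform_sphere) = (\<integral>\<xi>. h (x \<bullet> \<xi>) \<partial>distr uniform_sphere borel U)"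
    by (simp add: distr_uniform_sphere_orthogonal[OF U])
  also have "\<dots> = (\<integral>\<xi>. h (x \<bullet> U \<xi>) \<partial>uniform_sphere)"
    by (subst integral_distr) auto
  finally have eq: "(\<integral>\<xi>. h (x \<bullet> \<xi>) \<partial>uniform_sphere) = (\<integral>\<xi>. h (x \<bullet> U \<xi>) \<partial>uniform_sphere)" .
  have "x \<bullet> U \<xi> = norm x * (e \<bullet> \<xi>)" for \<xi>
  proof -
    have "U (norm x *\<^sub>R e) \<bullet> U \<xi> = (norm x *\<^sub>R e) \<bullet> \<xi>"
      using U unfolding orthogonal_transformation_def by blast
    then show ?thesis unfolding Ux by simp
  qed
  with eq show ?thesis by simp
qed

section \<open>Tightness and the radial representation\<close>

lemma (in prob_space) continuous_on_integral_param:
  fixes f :: "'c::metric_space \<Rightarrow> 'a \<Rightarrow> 'b::{banach, second_countable_topology}"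
  assumes [measurable]: "\<And>s. f s \<in> borel_measurable M" and cont: "\<And>\<xi>. continuous_on UNIV (\<lambda>s. f s \<xi>)"
    and B: "\<And>s \<xi>. norm (f s \<xi>) \<le> B"
  shows "continuous_on UNIV (\<lambda>s. \<integral>\<xi>. f s \<xi> \<partial>M)"
  unfolding continuous_on_sequentially
proof (intro allI ballI impI, elim conjE)
  fix x :: "nat \<Rightarrow> 'c" and a assume "x \<longlonglongrightarrow> a"
  have "(\<lambda>n. \<integral>\<xi>. f (x n) \<xi> \<partial>M) \<longlonglongrightarrow> (\<integral>\<xi>. f a \<xi> \<partial>M)"
  proof (rule integral_dominated_convergence[where w = "\<lambda>_. B"])
    show "AE \<xi> in M. (\<lambda>n. f (x n) \<xi>) \<longlonglongrightarrow> f a \<xi>"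
      using \<open>x \<longlonglongrightarrow> a\<close> by (intro AE_I2 continuous_on_tendsto_compose[OF cont]) auto
  qed (auto simp: B)
  then show "((\<lambda>s. \<integral>\<xi>. f s \<xi> \<partial>M) \<circ> x) \<longlonglongrightarrow> (\<integral>\<xi>. f a \<xi> \<partial>M)"
    by (simp add: o_def)
qed

text \<open>Each of the finitely many laws before the index \<open>N\<close> is tight on its own, so
  a larger interval serves them all.\<close>

lemma tight_eventuallyI:
  assumes rd: "\<And>n. real_distribution (M n)"
    and ev: "\<And>\<epsilon>. \<epsilon> > 0 \<Longrightarrow> \<exists>K::nat. \<exists>N. \<forall>n\<ge>N. measure (M n) {- real K<..real K} > 1 - \<epsilon>"
  shows "tight M"
  unfolding tight_def
proof (intro conjI allI impI rd)
  fix \<epsilon> :: real assume e: "\<epsilon> > 0"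
  obtain K :: nat and N where K: "\<And>n. n \<ge> N \<Longrightarrow> measure (M n) {- real K<..real K} > 1 - \<epsilon>"
    using ev[OF e] by blast
  have single: "eventually (\<lambda>k. measure (M n) {- real k<..real k} > 1 - \<epsilon>) sequentially" for n
  proof -
    interpret real_distribution "M n" by (rule rd)
    have *: "(\<Union>k::nat. {- real k<..real k}) = UNIV"
      by (auto, metis leI le_less_trans less_imp_le minus_less_iff reals_Archimedean2)
    have "(\<lambda>k. measure (M n) {- real k<..real k}) \<longlonglongrightarrow> measure (M n) (\<Union>k::nat. {- real k<..real k})"
      by (rule finite_Lim_measure_incseq) (auto simp: incseq_def)
    then have "(\<lambda>k. measure (M n) {- real k<..real k}) \<longlonglongrightarrow> 1"
      using prob_space unfolding * borel_UNIV by simp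
    then show ?thesis using e by (auto intro: order_tendstoD)
  qed
  have "eventually (\<lambda>k. \<forall>m\<in>{..<N}. measure (M m) {- real k<..real k} > 1 - \<epsilon>) sequentially"
    by (rule eventually_ball_finite) (use single in auto)
  then obtain L where L: "\<And>m. m < N \<Longrightarrow> measure (M m) {- real L<..real L} > 1 - \<epsilon>"
    by (auto simp: eventually_sequentially)
  \<comment> \<open>\<open>Suc\<close> keeps the interval nondegenerate, since \<open>tight\<close>
    asks for \<open>a < b\<close>.\<close>
  let ?k = "max (Suc K) L"
  have "measure (M n) {- real ?k<..real ?k} > 1 - \<epsilon>" for n
  proof -
    interpret real_distribution "M n" by (rule rd)
    show ?thesis
    proof (cases "n < N")
      case True
      have "measure (M n) {- real L<..real L} \<le> measure (M n) {- real ?k<..real ?k}"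
        by (rule finite_measure_mono) auto
      then show ?thesis using L[OF True] by linarith
    next
      case False
      have "measure (M n) {- real K<..real K} \<le> measure (M n) {- real ?k<..real ?k}"
        by (rule finite_measure_mono) auto
      then show ?thesis using K[of n] False by linarith
    qed
  qed
  then show "\<exists>a b. a < b \<and> (\<forall>n. 1 - \<epsilon> < measure (M n) {a<..b})"
    by (intro exI[of _ "- real ?k"] exI[of _ "real ?k"]) auto
qed

theorem schoenberg:
  fixes F :: "real \<Rightarrow> real"
  assumes pd: "positive_definite (rotation (\<lambda>r. complex_of_real (F r)) :: real^'n \<Rightarrow> complex)"
  obtains \<nu> where "real_distribution \<nu>"
    "\<And>x :: real^'n. F (norm x) = F 0 * (\<integral>r. (\<integral>\<xi>. cos (2 * pi * (r * (x \<bullet> \<xi>))) \<partial>uniform_sphere) \<partial>\<nu>)"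
proof -
  define \<phi> where "\<phi> x = F (norm x)" for x :: "real^'n"
  have pd': "positive_definite (\<lambda>x. complex_of_real (\<phi> x))"
    using pd by (simp add: \<phi>_def rotation_def[abs_def])
  have \<phi>B: "\<bar>\<phi> x\<bar> \<le> F 0" for x
    using positive_definite_bounded[OF pd', of x] by (simp add: \<phi>_def)
  show thesis
  proof (cases "F 0 = 0")
    case True
    \<comment> \<open>Here \<open>F\<close> vanishes on all norms by the bound
      \<open>\<phi>B\<close>, so any probability law will do.\<close>
    have "F (norm x) = F 0 * (\<integral>r. (\<integral>\<xi>. cos (2 * pi * (r * (x \<bullet> \<xi>))) \<partial>uniform_sphere) \<partial>std_normal_distribution)"
      for x :: "real^'n"
      using \<phi>B[of x] True by (simp add: \<phi>_def)
    then show thesis using that real_dist_normal_dist by blast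
  next
    case False
    then have F0: "F 0 > 0" using \<phi>B[of 0] by linarith
    have cont: "continuous_on UNIV \<phi>"
      using pd' continuous_on_Re[of UNIV "\<lambda>x. complex_of_real (\<phi> x)"] by (simp add: positive_definite_def)
    then have [measurable]: "\<phi> \<in> borel_measurable borel"
      by (rule borel_measurable_continuous_onI)
    interpret \<sigma>: prob_space "uniform_sphere :: (real^'n) measure"
      by (rule prob_space_uniform_sphere)
    obtain q where q: "\<And>n v. q n v \<ge> 0" "\<And>n. integrable lborel (q n)"
      and qlim: "\<And>x. (\<lambda>n. \<integral>v. cos (2 * pi * (x \<bullet> v)) * q n v \<partial>lborel) \<longlonglongrightarrow> \<phi> x"
      by (rule positive_definite_approximation[OF pd'], rule that)
    define m where "m n = (\<integral>v. q n v \<partial>lborel)" for n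
    have mlim: "m \<longlonglongrightarrow> F 0"
      using qlim[of 0] by (simp add: m_def[abs_def] \<phi>_def)
    then obtain N where N: "\<And>n. n \<ge> N \<Longrightarrow> m n > 0"
      using order_tendstoD(1)[OF mlim F0] by (auto simp: eventually_sequentially)
    \<comment> \<open>The shift by \<open>N\<close> guarantees positive total masses; after division
      the densities are probability densities.\<close>
    define Q where "Q n v = q (n + N) v / m (n + N)" for n v
    have mN: "m (n + N) > 0" for n using N by simp
    have Q0: "Q n v \<ge> 0" for n v using q(1) mN[of n] by (simp add: Q_def less_imp_le)
    have Qi: "integrable lborel (Q n)" for n unfolding Q_def using q(2) by simp
    note [measurable] = borel_measurable_integrable[OF Qi, simplified]
    have Q1: "(\<integral>v. Q n v \<partial>lborel) = 1" for n
      using mN[of n] by (simp add: Q_def m_def)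
    define C where "C n x = (\<integral>v. cos (2 * pi * (x \<bullet> v)) * Q n v \<partial>lborel)" for n x
    have [measurable]: "C n \<in> borel_measurable borel" for n
      unfolding C_def by measurable
    have Clim: "(\<lambda>n. C n x) \<longlonglongrightarrow> \<phi> x / F 0" for x
    proof -
      have "C n x = (\<integral>v. cos (2 * pi * (x \<bullet> v)) * q (n + N) v \<partial>lborel) / m (n + N)" for n
        by (simp add: C_def Q_def)
      moreover have "(\<lambda>n. (\<integral>v. cos (2 * pi * (x \<bullet> v)) * q (n + N) v \<partial>lborel) / m (n + N)) \<longlonglongrightarrow> \<phi> x / F 0"
        using F0 by (intro tendsto_divide LIMSEQ_ignore_initial_segment qlim mlim) auto
      ultimately show ?thesis by simp
    qed
    have CB: "\<bar>C n x\<bar> \<le> 1" for n x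
    proof -
      have "norm (C n x) \<le> (\<integral>v. Q n v \<partial>lborel)"
        unfolding C_def
      proof (rule Bochner_Integration.integral_norm_bound_integral)
        show le: "norm (cos (2 * pi * (x \<bullet> v)) * Q n v) \<le> Q n v" for v
          using Q0[of n v] by (simp add: abs_mult mult_left_le_one_le)
        show "integrable lborel (\<lambda>v. cos (2 * pi * (x \<bullet> v)) * Q n v)"
          by (rule Bochner_Integration.integrable_bound[OF Qi[of n]])
             (use order_trans[OF le abs_ge_self] in auto)
      qed (rule Qi)
      then show ?thesis by (simp add: Q1)
    qed
    define \<mu> where "\<mu> n = density lborel (\<lambda>v. ennreal (Q n v))" for n
    have \<mu>p: "prob_space (\<mu> n)" for n
    proof
      have "emeasure (\<mu> n) (space (\<mu> n)) = (\<integral>\<^sup>+v. ennreal (Q n v) \<partial>lborel)"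
        unfolding \<mu>_def by (subst emeasure_density) auto
      also have "\<dots> = ennreal (\<integral>v. Q n v \<partial>lborel)"
        by (rule nn_integral_eq_integral) (auto simp: Qi Q0)
      finally show "emeasure (\<mu> n) (space (\<mu> n)) = 1" by (simp add: Q1)
    qed
    define \<nu> where "\<nu> n = distr (\<mu> n) borel norm" for n
    have \<nu>: "real_distribution (\<nu> n)" for n
      unfolding \<nu>_def by (rule prob_space.real_distribution_distr[OF \<mu>p]) (simp add: \<mu>_def)
    have int\<nu>: "(\<integral>r. h r \<partial>\<nu> n) = (\<integral>v. h (norm v) * Q n v \<partial>lborel)"
      if [measurable]: "h \<in> borel_measurable borel" for h :: "real \<Rightarrow> real" and n
      unfolding \<nu>_def \<mu>_def
      by (subst integral_distr; (subst integral_density)?) (auto simp: Q0 mult.commute)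
    text \<open>The Gaussian averages of the characteristic functions control the tails.\<close>
    have gauss\<nu>: "(\<integral>r. gauss (d * r) \<partial>\<nu> n) = (\<integral>x. C n (d *\<^sub>R x) * gauss x \<partial>lborel)" for d n
    proof -
      have "(\<integral>r. gauss (d * r) \<partial>\<nu> n) = (\<integral>v. gauss (d *\<^sub>R v) * Q n v \<partial>lborel)"
        by (subst int\<nu>) (auto simp: gauss_def power_mult_distrib)
      also have "\<dots> = (\<integral>v. (\<integral>x. cos (2 * pi * (x \<bullet> (d *\<^sub>R v))) * Q n v * gauss x \<partial>lborel) \<partial>lborel)"
      proof (intro Bochner_Integration.integral_cong refl)
        fix v :: "real^'n"
        have i: "integrable lborel (\<lambda>x. cis (2 * pi * (x \<bullet> (d *\<^sub>R v))) * complex_of_real (gauss x))"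
          by (intro integrable_cis_mult) (auto intro!: integrable_gauss)
        have "gauss (d *\<^sub>R v) = Re (\<integral>x. cis (2 * pi * (x \<bullet> (d *\<^sub>R v))) * of_real (gauss x) \<partial>lborel)"
          unfolding fourier_gauss by simp
        also have "\<dots> = (\<integral>x. cos (2 * pi * (x \<bullet> (d *\<^sub>R v))) * gauss x \<partial>lborel)"
          by (subst integral_Re[OF i, symmetric]) simp
        finally have "gauss (d *\<^sub>R v) * Q n v = Q n v * (\<integral>x. cos (2 * pi * (x \<bullet> (d *\<^sub>R v))) * gauss x \<partial>lborel)"
          by simp
        also have "\<dots> = (\<integral>x. Q n v * (cos (2 * pi * (x \<bullet> (d *\<^sub>R v))) * gauss x) \<partial>lborel)"
          by (rule integral_mult_right_zero[symmetric])
        finally show "gauss (d *\<^sub>R v) * Q n v = (\<integral>x. cos (2 * pi * (x \<bullet> (d *\<^sub>R v))) * Q n v * gauss x \<partial>lborel)"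
          by (simp only: mult_ac)
      qed
      also have "\<dots> = (\<integral>x. (\<integral>v. cos (2 * pi * (x \<bullet> (d *\<^sub>R v))) * Q n v * gauss x \<partial>lborel) \<partial>lborel)"
        by (rule lborel_pair.Fubini_kernel[OF Qi integrable_gauss, where B = 1]) auto
      also have "\<dots> = (\<integral>x. C n (d *\<^sub>R x) * gauss x \<partial>lborel)"
        by (simp add: C_def)
      finally show ?thesis .
    qed
    have "tight \<nu>"
    proof (rule tight_eventuallyI[OF \<nu>])
      fix \<epsilon> :: real assume \<epsilon>: "\<epsilon> > 0"
      have "(\<lambda>k. \<integral>x. complex_of_real (\<phi> (0 + inverse (real (Suc k)) *\<^sub>R x)) * of_real (gauss x) \<partial>lborel) \<longlonglongrightarrow> complex_of_real (\<phi> 0)"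
        by (rule gauss_average_tendsto[where B = "F 0"]) (use cont \<phi>B in \<open>auto intro: continuous_intros\<close>)
      then have "(\<lambda>k. complex_of_real (\<integral>x. \<phi> (inverse (real (Suc k)) *\<^sub>R x) * gauss x \<partial>lborel)) \<longlonglongrightarrow> complex_of_real (\<phi> 0)"
        by (simp flip: of_real_mult)
      then have "(\<lambda>k. \<integral>x. \<phi> (inverse (real (Suc k)) *\<^sub>R x) * gauss x \<partial>lborel) \<longlonglongrightarrow> \<phi> 0"
        by (simp only: tendsto_of_real_iff)
      then have "(\<lambda>k. (\<integral>x. \<phi> (inverse (real (Suc k)) *\<^sub>R x) * gauss x \<partial>lborel) / F 0) \<longlonglongrightarrow> \<phi> 0 / F 0"
        by (intro tendsto_intros) (use F0 in auto)
      moreover have "1 - \<epsilon> / 2 < \<phi> 0 / F 0" using \<epsilon> F0 by (simp add: \<phi>_def)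
      ultimately have "eventually (\<lambda>k. 1 - \<epsilon> / 2 < (\<integral>x. \<phi> (inverse (real (Suc k)) *\<^sub>R x) * gauss x \<partial>lborel) / F 0) sequentially"
        by (rule order_tendstoD(1))
      then obtain k where k: "1 - \<epsilon> / 2 < (\<integral>x. \<phi> (inverse (real (Suc k)) *\<^sub>R x) * gauss x \<partial>lborel) / F 0"
        by (auto simp: eventually_sequentially)
      define d where "d = inverse (real (Suc k))"
      have d: "d > 0" by (simp add: d_def)
      have "(\<lambda>n. \<integral>x. C n (d *\<^sub>R x) * gauss x \<partial>lborel) \<longlonglongrightarrow> (\<integral>x. \<phi> (d *\<^sub>R x) / F 0 * gauss x \<partial>lborel)"
      proof (rule integral_dominated_convergence[where w = gauss])
        show "AE x in lborel. (\<lambda>n. C n (d *\<^sub>R x) * gauss x) \<longlonglongrightarrow> \<phi> (d *\<^sub>R x) / F 0 * gauss x"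
          by (intro AE_I2 tendsto_intros Clim)
        show "AE x in lborel. norm (C n (d *\<^sub>R x) * gauss x) \<le> gauss x" for n
          using CB by (auto simp: abs_mult intro!: mult_left_le_one_le)
      qed (auto intro: integrable_gauss)
      moreover have "1 - \<epsilon> / 2 < (\<integral>x. \<phi> (d *\<^sub>R x) / F 0 * gauss x \<partial>lborel)"
        using k unfolding d_def[symmetric] by simp
      ultimately have "eventually (\<lambda>n. 1 - \<epsilon> / 2 < (\<integral>x. C n (d *\<^sub>R x) * gauss x \<partial>lborel)) sequentially"
        by (rule order_tendstoD(1))
      then obtain n0 where n0: "\<And>n. n \<ge> n0 \<Longrightarrow> 1 - \<epsilon> / 2 < (\<integral>r. gauss (d * r) \<partial>\<nu> n)"
        unfolding gauss\<nu> by (auto simp: eventually_sequentially)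
      have "measure (\<nu> n) {- real (Suc k)<..real (Suc k)} > 1 - \<epsilon>" if n: "n \<ge> n0" for n
      proof -
        interpret real_distribution "\<nu> n" by (rule \<nu>)
        have gi: "integrable (\<nu> n) (\<lambda>r. gauss (d * r))"
          by (rule integrable_const_bound[where B = 1]) (auto simp: gauss_le_1)
        \<comment> \<open>This minorant of the indicator is nonpositive where
          \<open>\<bar>d * r\<bar> \<ge> 1\<close>, as \<open>exp (- pi) \<le> 1 / 2\<close>. A
          Gaussian mean above \<open>1 - \<epsilon> / 2\<close> thus forces a probability above
          \<open>1 - \<epsilon>\<close>.\<close>
        have "2 * gauss (d * r) - 1 \<le> indicator {- real (Suc k)<..real (Suc k)} r" for r
        proof (cases "\<bar>r\<bar> < real (Suc k)")
          case True
          then have "r \<in> {- real (Suc k)<..real (Suc k)}" by auto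
          then show ?thesis using gauss_le_1[of "d * r"] by (simp add: indicator_def)
        next
          case False
          then have "1 \<le> \<bar>d * r\<bar>" by (simp add: d_def abs_mult field_simps)
          then have "1 \<le> (d * r)\<^sup>2" by (metis one_le_power power2_abs)
          then have "pi * 1 \<le> pi * (d * r)\<^sup>2" by (intro mult_left_mono) auto
          then have "gauss (d * r) \<le> exp (- pi)" by (simp add: gauss_def)
          also have "\<dots> = 1 / exp pi" by (simp add: exp_minus inverse_eq_divide)
          also have "\<dots> \<le> 1 / 2"
          proof -
            have "2 \<le> exp pi" using exp_ge_add_one_self[of pi] pi_gt3 by linarith
            then show ?thesis by (intro divide_left_mono) auto
          qed
          finally have "2 * gauss (d * r) - 1 \<le> 0" by simp
          also have "0 \<le> indicat_real {- real (Suc k)<..real (Suc k)} r" by simp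
          finally show ?thesis .
        qed
        then have "(\<integral>r. 2 * gauss (d * r) - 1 \<partial>\<nu> n) \<le> (\<integral>r. indicator {- real (Suc k)<..real (Suc k)} r \<partial>\<nu> n)"
          using gi by (intro integral_mono) (auto intro!: integrable_const_bound[where B = 1])
        then have "2 * (\<integral>r. gauss (d * r) \<partial>\<nu> n) - 1 \<le> measure (\<nu> n) {- real (Suc k)<..real (Suc k)}"
          using gi prob_space by (simp add: Bochner_Integration.integral_diff)
        then show ?thesis using n0[OF n] by linarith
      qed
      then show "\<exists>K::nat. \<exists>N. \<forall>n\<ge>N. 1 - \<epsilon> < measure (\<nu> n) {- real K<..real K}" by blast
    qed
    then obtain s \<nu>' where s: "strict_mono s" and \<nu>': "real_distribution \<nu>'"
      and conv: "weak_conv_m (\<nu> \<circ> s) \<nu>'"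
      using tight_imp_convergent_subsubsequence[of \<nu> id] by (auto simp: strict_mono_def)
    have "F (norm x) = F 0 * (\<integral>r. (\<integral>\<xi>. cos (2 * pi * (r * (x \<bullet> \<xi>))) \<partial>uniform_sphere) \<partial>\<nu>')" for x :: "real^'n"
    proof -
      define W where "W r = (\<integral>\<xi>. cos (2 * pi * (r * (x \<bullet> \<xi>))) \<partial>uniform_sphere)" for r
      have Wc: "continuous_on UNIV W"
        unfolding W_def by (rule \<sigma>.continuous_on_integral_param[where B = 1]) (auto intro!: continuous_intros)
      have [measurable]: "W \<in> borel_measurable borel"
        using Wc by (rule borel_measurable_continuous_onI)
      have WB: "norm (W r) \<le> 1" for r
      proof -
        have "norm (W r) \<le> (\<integral>\<xi>. 1 \<partial>(uniform_sphere :: (real^'n) measure))"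
          unfolding W_def
          by (rule Bochner_Integration.integral_norm_bound_integral)
             (auto intro!: \<sigma>.integrable_const_bound[where B = 1])
        then show ?thesis by simp
      qed
      have "(\<lambda>n. \<integral>r. W r \<partial>(\<nu> \<circ> s) n) \<longlonglongrightarrow> (\<integral>r. W r \<partial>\<nu>')"
        by (rule weak_conv_imp_integral_bdd_continuous_conv[OF _ \<nu>' conv _ WB])
           (use \<nu> Wc in \<open>auto simp: continuous_on_eq_continuous_at\<close>)
      moreover have W\<nu>: "(\<integral>r. W r \<partial>\<nu> n) = (\<integral>\<xi>. C n (norm x *\<^sub>R \<xi>) \<partial>uniform_sphere)" for n
      proof -
        have "(\<integral>r. W r \<partial>\<nu> n) = (\<integral>v. W (norm v) * Q n v \<partial>lborel)"
          by (rule int\<nu>) measurable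
        also have "\<dots> = (\<integral>v. (\<integral>\<xi>. cos (2 * pi * ((norm x *\<^sub>R \<xi>) \<bullet> v)) * Q n v * 1 \<partial>uniform_sphere) \<partial>lborel)"
        proof (intro Bochner_Integration.integral_cong refl)
          fix v :: "real^'n"
          define e :: "real^'n" where "e = axis undefined 1"
          have e: "norm e = 1" by (simp add: e_def)
          \<comment> \<open>Passing through the unit vector \<open>e\<close> exchanges the roles of
            \<open>norm x\<close> and \<open>norm v\<close>, so that the frequency \<open>v\<close>
            enters linearly and the inner integral becomes \<open>C n\<close>.\<close>
          have "W (norm v) = (\<integral>\<xi>. cos (2 * pi * (norm v * (norm x * (e \<bullet> \<xi>)))) \<partial>uniform_sphere)"
            unfolding W_def
            by (rule uniform_sphere_inner[OF _ e, where h = "\<lambda>t. cos (2 * pi * (norm v * t))"]) auto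
          also have "\<dots> = (\<integral>\<xi>. cos (2 * pi * (norm x * (norm v * (e \<bullet> \<xi>)))) \<partial>(uniform_sphere :: (real^'n) measure))"
            by (simp only: mult.left_commute)
          also have "\<dots> = (\<integral>\<xi>. cos (2 * pi * (norm x * (v \<bullet> \<xi>))) \<partial>uniform_sphere)"
            by (rule uniform_sphere_inner[OF _ e, where h = "\<lambda>t. cos (2 * pi * (norm x * t))", symmetric]) auto
          also have "\<dots> = (\<integral>\<xi>. cos (2 * pi * ((norm x *\<^sub>R \<xi>) \<bullet> v)) \<partial>uniform_sphere)"
            by (simp add: inner_commute)
          finally show "W (norm v) * Q n v = (\<integral>\<xi>. cos (2 * pi * ((norm x *\<^sub>R \<xi>) \<bullet> v)) * Q n v * 1 \<partial>uniform_sphere)"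
            by simp
        qed
        also have "\<dots> = (\<integral>\<xi>. (\<integral>v. cos (2 * pi * ((norm x *\<^sub>R \<xi>) \<bullet> v)) * Q n v * 1 \<partial>lborel) \<partial>uniform_sphere)"
        proof -
          interpret pair_sigma_finite "lborel :: (real^'n) measure" "uniform_sphere :: (real^'n) measure"
            by (intro pair_sigma_finite.intro lborel.sigma_finite_measure_axioms \<sigma>.sigma_finite_measure_axioms)
          show ?thesis
            by (rule Fubini_kernel[OF Qi, where B = 1]) auto
        qed
        finally show ?thesis by (simp add: C_def)
      qed
      \<comment> \<open>Radiality enters here: the pointwise limit is the same at every point of the
        sphere of radius \<open>norm x\<close>.\<close>
      moreover have "(\<lambda>n. \<integral>\<xi>. C (s n) (norm x *\<^sub>R \<xi>) \<partial>uniform_sphere) \<longlonglongrightarrow> (\<integral>\<xi>. F (norm x) / F 0 \<partial>(uniform_sphere :: (real^'n) measure))"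
      proof (rule integral_dominated_convergence[where w = "\<lambda>_. 1"])
        show "AE \<xi> in uniform_sphere. (\<lambda>n. C (s n) (norm x *\<^sub>R (\<xi> :: real^'n))) \<longlonglongrightarrow> F (norm x) / F 0"
          using AE_uniform_sphere_norm
        proof eventually_elim
          case (elim \<xi>)
          have "(\<lambda>n. C (s n) (norm x *\<^sub>R \<xi>)) \<longlonglongrightarrow> \<phi> (norm x *\<^sub>R \<xi>) / F 0"
            using LIMSEQ_subseq_LIMSEQ[OF Clim s] by (simp add: o_def)
          then show ?case using elim by (simp add: \<phi>_def)
        qed
      qed (auto simp: CB)
      ultimately have "(\<integral>r. W r \<partial>\<nu>') = F (norm x) / F 0"
        by (simp add: LIMSEQ_unique)
      then show ?thesis using F0 by (simp add: W_def)
    qed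
    then show thesis using that \<nu>' by blast
  qed
qed

section \<open>Averages along a slice\<close>

text \<open>Meant for integrands that blow up at an endpoint, such as powers with exponent between
  -1 and 0. Nonnegativity turns the gauge integral over the interval into a Lebesgue
  integral.\<close>

lemma nonneg_FTC_interior:
  fixes G g :: "real \<Rightarrow> real"
  assumes ab: "a \<le> b" and cont: "continuous_on {a..b} G"
    and der: "\<And>x. a < x \<Longrightarrow> x < b \<Longrightarrow> (G has_real_derivative g x) (at x)"
    and nn: "\<And>x. a < x \<Longrightarrow> x < b \<Longrightarrow> g x \<ge> 0" and [measurable]: "g \<in> borel_measurable borel"
  shows "has_bochner_integral lborel (\<lambda>x. indicator {a<..<b} x * g x) (G b - G a)"
proof -
  let ?g = "\<lambda>x. indicator {a<..<b} x * g x"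
  have nn': "0 \<le> ?g x" for x using nn by (auto simp: indicator_def)
  have "(g has_integral (G b - G a)) {a..b}"
    using der by (intro fundamental_theorem_of_calculus_interior[OF ab cont])
      (auto simp: has_real_derivative_iff_has_vector_derivative)
  then have "(g has_integral (G b - G a)) {a<..<b}"
    using has_integral_open_interval[of g "G b - G a" a b] by simp
  then have hi: "(?g has_integral (G b - G a)) {a<..<b}"
    by (rule has_integral_eq[rotated]) simp
  have I: "(\<integral>\<^sup>+x. ennreal (indicator {a<..<b} x * ?g x) \<partial>lborel) = ennreal (G b - G a)"
    by (rule nn_integral_has_integral_lebesgue[OF nn' hi])
  moreover have "0 \<le> G b - G a"
    by (rule has_integral_nonneg[OF hi nn'])
  moreover have "(\<lambda>x. ennreal (indicator {a<..<b} x * ?g x)) = (\<lambda>x. ennreal (?g x))"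
    by (auto simp: indicator_def)
  ultimately show ?thesis
    using nn' by (intro has_bochner_integral_nn_integral) auto
qed

text \<open>This is \<open>H_b\<close> of the overview. For \<open>b = (d - 3)/2\<close> the weight
  is, up to a constant, the density of the absolute value of one coordinate of a uniform point on
  the unit sphere in dimension \<open>d\<close>.\<close>

definition slice_average :: "(real \<Rightarrow> real) \<Rightarrow> real \<Rightarrow> real \<Rightarrow> real" where
  "slice_average f b s = (\<integral>t. indicator {0<..<1} t * (f (s * t) * (1 - t\<^sup>2) powr b) \<partial>lborel)"

lemma integrable_slice_weight:
  assumes b: "b > -1"
  shows "integrable lborel (\<lambda>t::real. indicator {0<..<1} t * (1 - t\<^sup>2) powr b)"
proof -
  have "has_bochner_integral lborel (\<lambda>t. indicator {0<..<1} t * (1 - t) powr b)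
     (- ((1 - 1) powr (b + 1) / (b + 1)) - (- ((1 - 0) powr (b + 1) / (b + 1))))"
  proof (rule nonneg_FTC_interior[where G = "\<lambda>t. - ((1 - t) powr (b + 1) / (b + 1))"])
    show "continuous_on {0..1::real} (\<lambda>t. - ((1 - t) powr (b + 1) / (b + 1)))"
      using b by (intro continuous_intros continuous_on_powr') auto
    fix t :: real assume "0 < t" "t < 1"
    then show "((\<lambda>t. - ((1 - t) powr (b + 1) / (b + 1))) has_real_derivative (1 - t) powr b) (at t)"
    proof -
      have d: "((\<lambda>t. 1 - t) has_real_derivative - 1) (at t)"
        by (auto intro!: derivative_eq_intros)
      have "((\<lambda>t. (1 - t) powr (b + 1)) has_real_derivative (b + 1) * (1 - t) powr (b + 1 - 1) * - 1) (at t)"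
        using DERIV_fun_powr[OF d, of "b + 1"] \<open>t < 1\<close> by simp
      from DERIV_minus[OF DERIV_cdivide[OF this, of "b + 1"]] show ?thesis
        using b by simp
    qed
  qed auto
  then have "integrable lborel (\<lambda>t::real. indicator {0<..<1} t * (1 - t) powr b)"
    by (rule integrable.intros)
  moreover have "integrable lborel (indicator {0<..<1} :: real \<Rightarrow> real)"
    by (simp add: integrable_indicator_iff)
  \<comment> \<open>The sum covers both signs of \<open>b\<close>: for \<open>b \<ge> 0\<close> the
    weight is at most 1, and for \<open>b < 0\<close> it is at most \<open>(1 - t) powr b\<close>
    because \<open>t^2 \<le> t\<close>.\<close>
  ultimately have i: "integrable lborel (\<lambda>t::real. indicator {0<..<1} t + indicator {0<..<1} t * (1 - t) powr b)"
    by simp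
  show ?thesis
  proof (rule Bochner_Integration.integrable_bound[OF i])
    show "AE t in lborel. norm (indicator {0<..<1} t * (1 - t\<^sup>2) powr b)
        \<le> norm (indicator {0<..<1} t + indicator {0<..<1} t * (1 - t) powr b)"
    proof (rule AE_I2)
      fix t :: real
      show "norm (indicator {0<..<1} t * (1 - t\<^sup>2) powr b)
        \<le> norm (indicator {0<..<1} t + indicator {0<..<1} t * (1 - t) powr b)"
      proof (cases "t \<in> {0<..<1}")
        case True
        have t2: "t\<^sup>2 \<le> t" using True by (simp add: power2_eq_square mult_left_le)
        have "(1 - t\<^sup>2) powr b \<le> 1 + (1 - t) powr b"
        proof (cases "b \<ge> 0")
          case True
          then have "(1 - t\<^sup>2) powr b \<le> 1 powr b"
            using \<open>t \<in> {0<..<1}\<close> by (intro powr_mono2) (auto simp: power_le_one)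
          then show ?thesis by (simp add: add_increasing2)
        next
          case False
          then have "(1 - t\<^sup>2) powr b \<le> (1 - t) powr b"
            using \<open>t \<in> {0<..<1}\<close> t2 by (intro powr_mono2') auto
          then show ?thesis by simp
        qed
        then show ?thesis using True by simp
      qed simp
    qed
  qed measurable
qed

context
  fixes f :: "real \<Rightarrow> real" and B :: real
  assumes f_cont: "continuous_on UNIV f" and f_bound: "\<And>t. \<bar>f t\<bar> \<le> B"
begin

lemma slice_average_integrable:
  assumes b: "b > -1"
  shows "integrable lborel (\<lambda>t. indicator {0<..<1} t * (f (s * t) * (1 - t\<^sup>2) powr b))"
proof (rule Bochner_Integration.integrable_bound[OF integrable_mult_right[OF integrable_slice_weight[OF b], of B]])
  have [measurable]: "f \<in> borel_measurable borel"
    using f_cont by (rule borel_measurable_continuous_onI)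
  show "(\<lambda>t. indicator {0<..<1} t * (f (s * t) * (1 - t\<^sup>2) powr b)) \<in> borel_measurable lborel"
    by measurable
  show "AE t in lborel. norm (indicator {0<..<1} t * (f (s * t) * (1 - t\<^sup>2) powr b))
      \<le> norm (B * (indicator {0<..<1} t * (1 - t\<^sup>2) powr b))"
    using order_trans[OF f_bound abs_ge_self] by (intro AE_I2) (auto simp: abs_mult indicator_def intro!: mult_right_mono)
qed

lemma slice_average_continuous:
  assumes b: "b > -1"
  shows "continuous_on UNIV (slice_average f b)"
  unfolding continuous_on_sequentially
proof (intro allI ballI impI, elim conjE)
  fix x :: "nat \<Rightarrow> real" and a assume x: "x \<longlonglongrightarrow> a"
  have [measurable]: "f \<in> borel_measurable borel"
    using f_cont by (rule borel_measurable_continuous_onI)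
  have "(\<lambda>n. slice_average f b (x n)) \<longlonglongrightarrow> slice_average f b a"
    unfolding slice_average_def
  proof (rule integral_dominated_convergence)
    show "integrable lborel (\<lambda>t::real. B * (indicator {0<..<1} t * (1 - t\<^sup>2) powr b))"
      by (rule integrable_mult_right[OF integrable_slice_weight[OF b]])
    show "AE t in lborel. (\<lambda>n. indicator {0<..<1} t * (f (x n * t) * (1 - t\<^sup>2) powr b))
        \<longlonglongrightarrow> indicator {0<..<1} t * (f (a * t) * (1 - t\<^sup>2) powr b)"
    proof (rule AE_I2)
      fix t :: real
      have "(\<lambda>n. f (x n * t)) \<longlonglongrightarrow> f (a * t)"
        by (rule continuous_on_tendsto_compose[OF f_cont]) (auto intro!: tendsto_intros x)
      then show "(\<lambda>n. indicator {0<..<1} t * (f (x n * t) * (1 - t\<^sup>2) powr b))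
        \<longlonglongrightarrow> indicator {0<..<1} t * (f (a * t) * (1 - t\<^sup>2) powr b)"
        by (intro tendsto_intros)
    qed
    show "AE t in lborel. norm (indicator {0<..<1} t * (f (x n * t) * (1 - t\<^sup>2) powr b))
        \<le> B * (indicator {0<..<1} t * (1 - t\<^sup>2) powr b)" for n
      using f_bound by (intro AE_I2) (auto simp: abs_mult indicator_def intro!: mult_right_mono)
  qed measurable
  then show "(slice_average f b \<circ> x) \<longlonglongrightarrow> slice_average f b a" by (simp add: o_def)
qed

lemma slice_average_measurable: "b > -1 \<Longrightarrow> slice_average f b \<in> borel_measurable borel"
  by (intro borel_measurable_continuous_onI slice_average_continuous)

text \<open>Insert \<open>(1 - t\<^sup>2)\<^sup>a = \<integral>\<^bsub>t\<^esub>\<^bsup>1\<^esup> 2 a r (r\<^sup>2 - t\<^sup>2)\<^bsup>a-1\<^esup> dr\<close> and exchange the integrals.\<close>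

lemma slice_average_reduction:
  assumes a: "a > 0"
  shows "slice_average f a s =
    (\<integral>r. indicator {0<..<1} r * (2 * a * r powr (2 * a) * slice_average f (a - 1) (s * r)) \<partial>lborel)"
proof -
  have [measurable]: "f \<in> borel_measurable borel"
    using f_cont by (rule borel_measurable_continuous_onI)
  define k where "k t r = indicator {0<..<1} t * (f (s * t) * (indicator {t<..<1} r * (2 * a * r * (r\<^sup>2 - t\<^sup>2) powr (a - 1))))" for t r :: real
  have [measurable]: "(\<lambda>x :: real \<times> real. indicator {fst x<..<1} (snd x) :: real) \<in> borel_measurable (borel \<Otimes>\<^sub>M borel)"
  proof -
    have "(\<lambda>x. indicator {fst x<..<1} (snd x)) = (\<lambda>x :: real \<times> real. if fst x < snd x \<and> snd x < 1 then 1 else 0 :: real)"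
      by (auto simp: indicator_def fun_eq_iff)
    moreover have "(\<lambda>x :: real \<times> real. if fst x < snd x \<and> snd x < 1 then 1 else 0 :: real) \<in> borel_measurable (borel \<Otimes>\<^sub>M borel)"
      by measurable
    ultimately show ?thesis by simp
  qed
  have km [measurable]: "case_prod k \<in> borel_measurable (borel \<Otimes>\<^sub>M borel)"
    unfolding k_def case_prod_beta by measurable
  have inner: "has_bochner_integral lborel (\<lambda>r. indicator {t<..<1} r * (2 * a * r * (r\<^sup>2 - t\<^sup>2) powr (a - 1))) ((1 - t\<^sup>2) powr a)"
    if t: "t \<in> {0<..<1}" for t :: real
  proof -
    have sq: "t\<^sup>2 < x\<^sup>2" if "t < x" for x using t that by (intro power_strict_mono) auto
    have "has_bochner_integral lborel (\<lambda>r. indicator {t<..<1} r * (2 * a * r * (r\<^sup>2 - t\<^sup>2) powr (a - 1)))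
        ((1\<^sup>2 - t\<^sup>2) powr a - (t\<^sup>2 - t\<^sup>2) powr a)"
    proof (rule nonneg_FTC_interior[where G = "\<lambda>r. (r\<^sup>2 - t\<^sup>2) powr a"])
      show "continuous_on {t..1} (\<lambda>r. (r\<^sup>2 - t\<^sup>2) powr a)"
        using a t by (intro continuous_intros continuous_on_powr') (auto intro!: power_mono)
      fix x assume x: "t < x" "x < 1"
      show "((\<lambda>r. (r\<^sup>2 - t\<^sup>2) powr a) has_real_derivative 2 * a * x * (x\<^sup>2 - t\<^sup>2) powr (a - 1)) (at x)"
        using sq[OF x(1)] by (auto intro!: derivative_eq_intros simp: powr_diff)
      show "2 * a * x * (x\<^sup>2 - t\<^sup>2) powr (a - 1) \<ge> 0" using x t a by simp
    qed (use t in auto)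
    then show ?thesis by simp
  qed
  have innerk: "(\<integral>r. k t r \<partial>lborel) = indicator {0<..<1} t * (f (s * t) * (1 - t\<^sup>2) powr a)" for t
    using has_bochner_integral_integral_eq[OF inner[of t]]
    by (cases "t \<in> {0<..<1}") (simp_all add: k_def)
  have nk: "norm (k t r) = indicator {0<..<1} t * (\<bar>f (s * t)\<bar> * (indicator {t<..<1} r * (2 * a * r * (r\<^sup>2 - t\<^sup>2) powr (a - 1))))" for t r
    using a by (auto simp: k_def abs_mult indicator_def)
  have innernk: "(\<integral>r. norm (k t r) \<partial>lborel) = indicator {0<..<1} t * (\<bar>f (s * t)\<bar> * (1 - t\<^sup>2) powr a)" for t
    unfolding nk using has_bochner_integral_integral_eq[OF inner[of t]]
    by (cases "t \<in> {0<..<1}") simp_all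
  have kint: "integrable (lborel \<Otimes>\<^sub>M lborel) (case_prod k)"
  proof (rule lborel_pair.Fubini_integrable)
    have "integrable lborel (\<lambda>t. \<bar>indicator {0<..<1} t * (f (s * t) * (1 - t\<^sup>2) powr a)\<bar>)"
      using slice_average_integrable[of a s] a by simp
    then show "integrable lborel (\<lambda>t. \<integral>r. norm (case (t, r) of (t, r) \<Rightarrow> k t r) \<partial>lborel)"
      by (simp add: innernk[unfolded real_norm_def] abs_mult)
    show "AE t in lborel. integrable lborel (\<lambda>r. case (t, r) of (t, r) \<Rightarrow> k t r)"
    proof (rule AE_I2)
      fix t :: real
      show "integrable lborel (\<lambda>r. case (t, r) of (t, r) \<Rightarrow> k t r)"
        using integrable.intros[OF inner[of t]] by (cases "t \<in> {0<..<1}") (simp_all add: k_def)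
    qed
  qed measurable
  \<comment> \<open>The substitution \<open>t = r * u\<close> maps the section of the triangle at
    \<open>r\<close> to the unit interval; the powers of \<open>r\<close> combine to
    \<open>r powr (2 * a)\<close>.\<close>
  have outer: "(\<integral>t. k t r \<partial>lborel) = indicator {0<..<1} r * (2 * a * r powr (2 * a) * slice_average f (a - 1) (s * r))" for r
  proof (cases "r \<in> {0<..<1}")
    case True
    have "(\<integral>t. k t r \<partial>lborel) = \<bar>r\<bar> *\<^sub>R (\<integral>u. k (0 + r * u) r \<partial>lborel)"
      using True by (intro lborel_integral_real_affine) auto
    also have "(\<lambda>u. k (0 + r * u) r) = (\<lambda>u. (2 * a * r * r powr (2 * (a - 1))) * (indicator {0<..<1} u * (f (s * r * u) * (1 - u\<^sup>2) powr (a - 1))))"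
    proof
      fix u
      show "k (0 + r * u) r = (2 * a * r * r powr (2 * (a - 1))) * (indicator {0<..<1} u * (f (s * r * u) * (1 - u\<^sup>2) powr (a - 1)))"
      proof (cases "u \<in> {0<..<1}")
        case u: True
        have ru: "0 < r * u" "r * u < r" using True u by auto
        have "r\<^sup>2 - (r * u)\<^sup>2 = r\<^sup>2 * (1 - u\<^sup>2)" by (simp add: power_mult_distrib algebra_simps)
        moreover have "u\<^sup>2 < 1" using u by (simp add: power_less_one_iff abs_square_less_1)
        ultimately have "(r\<^sup>2 - (r * u)\<^sup>2) powr (a - 1) = (r\<^sup>2) powr (a - 1) * (1 - u\<^sup>2) powr (a - 1)"
          by (simp add: powr_mult)
        also have "(r\<^sup>2) powr (a - 1) = (r powr 2) powr (a - 1)"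
          using True by simp
        also have "\<dots> = r powr (2 * (a - 1))"
          by (rule powr_powr)
        finally have "(r\<^sup>2 - (r * u)\<^sup>2) powr (a - 1) = r powr (2 * (a - 1)) * (1 - u\<^sup>2) powr (a - 1)" .
        then show ?thesis using True u ru by (simp add: k_def indicator_def mult.assoc)
      next
        case False
        then have "\<not> (0 < r * u \<and> r * u < r)" using True by (auto simp: zero_less_mult_iff)
        then show ?thesis using False True by (auto simp: k_def indicator_def)
      qed
    qed
    finally have "(\<integral>t. k t r \<partial>lborel) = r * (2 * a * r * r powr (2 * (a - 1)) * slice_average f (a - 1) (s * r))"
      using True by (simp add: slice_average_def)
    moreover have "r * (r * r powr (2 * (a - 1))) = r powr (2 * a)"
      using True by (simp add: powr_diff right_diff_distrib power2_eq_square field_simps)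
    ultimately show ?thesis using True by (simp add: mult_ac)
  qed (auto simp: k_def indicator_def intro!: Bochner_Integration.integral_eq_zero_AE)
  have "slice_average f a s = (\<integral>t. (\<integral>r. k t r \<partial>lborel) \<partial>lborel)"
    by (simp add: innerk slice_average_def)
  also have "\<dots> = (\<integral>r. (\<integral>t. k t r \<partial>lborel) \<partial>lborel)"
    by (rule lborel_pair.Fubini_integral[OF kint, symmetric])
  finally show ?thesis by (simp add: outer)
qed

text \<open>Rescaling the reduction formula to the interval from 0 to \<open>s\<close> shows the
  product to be an antiderivative of a function that is continuous for merely continuous
  \<open>f\<close>. One derivative is thus gained without differentiating \<open>f\<close>.\<close>

lemma slice_average_powr_has_derivative:
  assumes a: "a > 0" and s: "s > 0"
  shows "((\<lambda>s. s powr (2 * a + 1) * slice_average f a s) has_real_derivative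
    2 * a * s powr (2 * a) * slice_average f (a - 1) s) (at s)"
proof -
  define g where "g r = 2 * a * r powr (2 * a) * slice_average f (a - 1) r" for r
  have gc: "continuous_on {0..} g"
    unfolding g_def using a
    by (intro continuous_intros continuous_on_powr' continuous_on_subset[OF slice_average_continuous]) auto
  have [measurable]: "slice_average f (a - 1) \<in> borel_measurable borel"
    using a by (intro slice_average_measurable) simp
  have [measurable]: "g \<in> borel_measurable borel"
    unfolding g_def using a by measurable
  have eq: "x powr (2 * a + 1) * slice_average f a x = integral {0..x} g" if x: "x > 0" for x
  proof -
    have "integrable lborel (\<lambda>r. indicator {0..x} r *\<^sub>R g r)"
      by (rule borel_integrable_compact) (auto intro: continuous_on_subset[OF gc])
    then have "integral {0..x} g = (\<integral>r. indicator {0..x} r *\<^sub>R g r \<partial>lborel)"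
      using set_borel_integral_eq_integral(2)[of "{0..x}" g]
      by (simp add: set_integrable_def set_lebesgue_integral_def)
    also have "\<dots> = (\<integral>r. indicator {0<..<x} r *\<^sub>R g r \<partial>lborel)"
      using AE_lborel_singleton[of "0::real"] AE_lborel_singleton[of x]
      by (intro integral_cong_AE) (auto elim!: eventually_rev_mp simp: indicator_def)
    also have "\<dots> = \<bar>x\<bar> *\<^sub>R (\<integral>r. indicator {0<..<x} (0 + x * r) *\<^sub>R g (0 + x * r) \<partial>lborel)"
      using x by (intro lborel_integral_real_affine) auto
    also have "(\<lambda>r. indicator {0<..<x} (0 + x * r) *\<^sub>R g (0 + x * r))
        = (\<lambda>r. x powr (2 * a) * (indicator {0<..<1} r * (2 * a * r powr (2 * a) * slice_average f (a - 1) (x * r))))"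
      using x by (auto simp: g_def indicator_def powr_mult zero_less_mult_iff fun_eq_iff)
    finally have "integral {0..x} g = x * (x powr (2 * a) * slice_average f a x)"
      using x by (simp only: integral_mult_right_zero slice_average_reduction[OF a, symmetric]) simp
    then show ?thesis using x by (simp add: powr_add)
  qed
  have "((\<lambda>x. integral {0..x} g) has_real_derivative g s) (at s within {0..s + 1})"
    using s by (intro integral_has_real_derivative continuous_on_subset[OF gc]) auto
  moreover have "at s within {0..s + 1} = at s"
    using s by (intro at_within_interior) auto
  ultimately have "((\<lambda>x. integral {0..x} g) has_real_derivative g s) (at s)" by simp
  then show ?thesis
    unfolding g_def[symmetric]
    by (rule has_field_derivative_transform_within_open[of _ _ _ "{0<..}"]) (use s eq in auto)
qed

lemma slice_average_has_derivative:
  assumes a: "a > 0" and s: "s > 0"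
  shows "(slice_average f a has_real_derivative
    inverse s * (2 * a * slice_average f (a - 1) s - (2 * a + 1) * slice_average f a s)) (at s)"
proof -
  let ?P = "\<lambda>s. s powr (2 * a + 1) * slice_average f a s"
  have "((\<lambda>s. s powr (- (2 * a + 1)) * ?P s) has_real_derivative
      s powr (- (2 * a + 1)) * (2 * a * s powr (2 * a) * slice_average f (a - 1) s) +
      (- (2 * a + 1)) * s powr (- (2 * a + 1) - 1) * ?P s) (at s)"
    by (rule DERIV_cong[OF DERIV_mult[OF has_real_derivative_powr[OF s] slice_average_powr_has_derivative[OF a s]]])
       (simp only: mult.commute add.commute)
  also have "s powr (- (2 * a + 1)) * (2 * a * s powr (2 * a) * slice_average f (a - 1) s) +
      (- (2 * a + 1)) * s powr (- (2 * a + 1) - 1) * ?P s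
     = inverse s * (2 * a * slice_average f (a - 1) s - (2 * a + 1) * slice_average f a s)"
  proof -
    have e: "s powr (- (2 * a + 1)) * s powr (2 * a) = inverse s"
      "s powr (- (2 * a + 1) - 1) * s powr (2 * a + 1) = inverse s"
      using s by (simp_all add: powr_add[symmetric] powr_minus)
    have r: "A * (c * B * H') + d * C * (P * H) = (A * B) * (c * H') + (C * P) * (d * H)"
      for A B C P H H' c d :: real
      by (simp only: mult_ac)
    show ?thesis unfolding r e by (simp add: algebra_simps)
  qed
  finally have D: "((\<lambda>s. s powr (- (2 * a + 1)) * ?P s) has_real_derivative
      inverse s * (2 * a * slice_average f (a - 1) s - (2 * a + 1) * slice_average f a s)) (at s)" .
  have cancel: "x powr (- c) * (x powr c * y) = y" if "x > 0" for x c y :: real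
    using that by (simp add: powr_minus)
  show ?thesis
    by (rule has_field_derivative_transform_within_open[OF D, of "{0<..}"])
       (use s in \<open>simp_all only: cancel greaterThan_iff open_greaterThan\<close>)
qed

end

section \<open>Repeated differentiability on the positive half-line\<close>

text \<open>Derivatives are existential witnesses, so the sum and product rules apply with explicit
  formulas; iterated \<open>deriv\<close> enters only in \<open>smooth_on_pos_imp\<close>.\<close>

primrec smooth_on_pos :: "nat \<Rightarrow> (real \<Rightarrow> real) \<Rightarrow> bool" where
  "smooth_on_pos 0 f \<longleftrightarrow> continuous_on {0<..} f"
| "smooth_on_pos (Suc k) f \<longleftrightarrow> (\<exists>f'. (\<forall>s>0. (f has_real_derivative f' s) (at s)) \<and> smooth_on_pos k f')"

lemma smooth_on_pos_cong:
  assumes "\<And>s. s > 0 \<Longrightarrow> f s = g s" and "smooth_on_pos k f"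
  shows "smooth_on_pos k g"
proof (cases k)
  case 0
  then show ?thesis using assms continuous_on_cong[of "{0<..}" "{0<..}" f g] by auto
next
  case (Suc l)
  then obtain f' where f': "\<And>s. s > 0 \<Longrightarrow> (f has_real_derivative f' s) (at s)" "smooth_on_pos l f'"
    using assms(2) by auto
  have "(g has_real_derivative f' s) (at s)" if "s > 0" for s
    by (rule has_field_derivative_transform_within_open[OF f'(1)[OF that], of "{0<..}"])
       (use that assms(1) in auto)
  then show ?thesis using f'(2) Suc by auto
qed

lemma smooth_on_pos_Suc: "smooth_on_pos (Suc k) f \<Longrightarrow> smooth_on_pos k f"
proof (induction k arbitrary: f)
  case 0
  then show ?case
    by (auto intro!: continuous_at_imp_continuous_on dest: DERIV_isCont)
next
  case (Suc k)
  then show ?case by (metis smooth_on_pos.simps(2))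
qed

lemma smooth_on_pos_const: "smooth_on_pos k (\<lambda>_. c)"
proof (induction k arbitrary: c)
  case (Suc k)
  then show ?case by (auto intro!: exI[of _ "\<lambda>_. 0"])
qed simp

lemma smooth_on_pos_add:
  "smooth_on_pos k f \<Longrightarrow> smooth_on_pos k g \<Longrightarrow> smooth_on_pos k (\<lambda>s. f s + g s)"
proof (induction k arbitrary: f g)
  case 0
  then show ?case by (auto intro: continuous_intros)
next
  case (Suc k)
  obtain f' g' where "\<And>s. s > 0 \<Longrightarrow> (f has_real_derivative f' s) (at s)" "smooth_on_pos k f'"
    "\<And>s. s > 0 \<Longrightarrow> (g has_real_derivative g' s) (at s)" "smooth_on_pos k g'"
    using Suc.prems by auto
  then show ?case using Suc.IH
    by (auto intro!: exI[of _ "\<lambda>s. f' s + g' s"] derivative_intros)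
qed

lemma smooth_on_pos_mult:
  "smooth_on_pos k f \<Longrightarrow> smooth_on_pos k g \<Longrightarrow> smooth_on_pos k (\<lambda>s. f s * g s)"
proof (induction k arbitrary: f g)
  case 0
  then show ?case by (auto intro: continuous_intros)
next
  case (Suc k)
  obtain f' g' where d: "\<And>s. s > 0 \<Longrightarrow> (f has_real_derivative f' s) (at s)" "smooth_on_pos k f'"
    "\<And>s. s > 0 \<Longrightarrow> (g has_real_derivative g' s) (at s)" "smooth_on_pos k g'"
    using Suc.prems by auto
  have "smooth_on_pos k (\<lambda>s. f' s * g s + g' s * f s)"
    using d Suc.prems[THEN smooth_on_pos_Suc] by (intro smooth_on_pos_add Suc.IH)
  moreover have "((\<lambda>s. f s * g s) has_real_derivative f' s * g s + g' s * f s) (at s)" if "s > 0" for s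
    by (rule DERIV_mult[OF d(1)[OF that] d(3)[OF that]])
  ultimately show ?case
    unfolding smooth_on_pos.simps by (intro exI[of _ "\<lambda>s. f' s * g s + g' s * f s"]) blast
qed

lemma smooth_on_pos_inverse: "smooth_on_pos k inverse"
proof (induction k)
  case 0
  then show ?case by (auto intro!: continuous_intros)
next
  case (Suc k)
  have "smooth_on_pos k (\<lambda>s. - 1 * (inverse s * inverse s))"
    by (intro smooth_on_pos_mult smooth_on_pos_const Suc)
  moreover have "(inverse has_real_derivative - 1 * (inverse s * inverse s)) (at s)" if "s > 0" for s :: real
    using that DERIV_inverse[of s UNIV] by (simp add: power2_eq_square)
  ultimately show ?case
    unfolding smooth_on_pos.simps by (intro exI[of _ "\<lambda>s. - 1 * (inverse s * inverse s)"]) blast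
qed

lemma smooth_on_pos_imp:
  "smooth_on_pos k f \<Longrightarrow> times_continuously_differentiable_on k f {0<..}"
proof (induction k arbitrary: f)
  case 0
  then show ?case by (simp add: times_continuously_differentiable_on_def)
next
  case (Suc k)
  then obtain f' where f': "\<And>s. s > 0 \<Longrightarrow> (f has_real_derivative f' s) (at s)" "smooth_on_pos k f'"
    by auto
  have "smooth_on_pos k (deriv f)"
    by (rule smooth_on_pos_cong[OF _ f'(2)]) (use f'(1) DERIV_imp_deriv in force)
  then have IH: "times_continuously_differentiable_on k (deriv f) {0<..}" by (rule Suc.IH)
  have "f differentiable_on {0<..}"
    using f'(1) by (auto simp: differentiable_on_def real_differentiable_def intro: has_field_derivative_at_within)
  then have "((deriv ^^ j) f) differentiable_on {0<..}" if "j < Suc k" for j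
    using IH that by (cases j) (auto simp: times_continuously_differentiable_on_def funpow_swap1)
  then show ?case
    using IH by (auto simp: times_continuously_differentiable_on_def funpow_swap1)
qed

text \<open>Every differentiation lowers \<open>b\<close> by one, and continuity at the last stage
  requires an exponent above -1; hence the bound \<open>b > real k - 1\<close>.\<close>

lemma slice_average_smooth:
  assumes f: "continuous_on UNIV f" "\<And>t. \<bar>f t\<bar> \<le> B"
  shows "b > real k - 1 \<Longrightarrow> smooth_on_pos k (slice_average f b)"
proof (induction k arbitrary: b)
  case 0
  then show ?case
    using slice_average_continuous[OF f] by (auto intro: continuous_on_subset)
next
  case (Suc k)
  let ?g = "\<lambda>s. inverse s * (2 * b * slice_average f (b - 1) s + (- (2 * b + 1)) * slice_average f b s)"
  have "(slice_average f b has_real_derivative ?g s) (at s)" if "s > 0" for s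
    using slice_average_has_derivative[OF f, of b s] Suc.prems that by (simp add: algebra_simps)
  moreover have "smooth_on_pos k ?g"
    using Suc.prems
    by (intro smooth_on_pos_mult smooth_on_pos_add smooth_on_pos_inverse smooth_on_pos_const Suc.IH) auto
  ultimately show ?case
    unfolding smooth_on_pos.simps by (intro exI[of _ ?g]) blast
qed

section \<open>Balls in polar coordinates and along hyperplanes\<close>

lemma emeasure_density_indicator:
  assumes "B \<in> sets M" "A \<in> sets M"
  shows "emeasure (density M (\<lambda>x. ennreal (indicator B x))) A = emeasure M (A \<inter> B)"
proof -
  have "emeasure (density M (\<lambda>x. ennreal (indicator B x))) A = (\<integral>\<^sup>+x. ennreal (indicator B x) * indicator A x \<partial>M)"
    using assms by (intro emeasure_density) auto
  also have "(\<lambda>x. ennreal (indicator B x) * indicator A x) = indicator (A \<inter> B)"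
    by (auto simp: indicator_def fun_eq_iff)
  finally show ?thesis using assms by simp
qed

text \<open>The law of the norm on the ball is compared with its density on half-lines only, where
  both sides are volumes of spherical shells.\<close>

lemma radial_ball_integral:
  fixes F :: "real \<Rightarrow> real"
  assumes s: "s > 0" and [measurable]: "F \<in> borel_measurable borel"
  shows "(\<integral>x. indicator (cball 0 s) x * F (norm (x :: 'a::euclidean_space)) \<partial>lborel)
    = (\<integral>r. indicator {0..s} r * (DIM('a) * unit_ball_vol (DIM('a)) * r ^ (DIM('a) - 1) * F r) \<partial>lborel)"
proof -
  let ?d = "DIM('a)" and ?w = "unit_ball_vol (real DIM('a))"
  define p where "p r = indicator {0..s} r * (real ?d * ?w * r ^ (?d - 1))" for r :: real
  have p0: "p r \<ge> 0" for r by (auto simp: p_def indicator_def)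
  have [measurable]: "p \<in> borel_measurable borel" unfolding p_def by measurable
  have [measurable]: "cball (0::'a) s \<in> sets borel" by simp
  let ?M = "distr (density lborel (\<lambda>x::'a. ennreal (indicator (cball 0 s) x))) borel norm"
  let ?N = "density lborel (\<lambda>r. ennreal (p r))"
  have M: "emeasure ?M {a<..} = emeasure lborel (norm -` {a<..} \<inter> cball (0::'a) s)" for a
  proof -
    have "norm -` {a<..} \<in> sets (borel :: 'a measure)"
      using measurable_sets[of "norm :: 'a \<Rightarrow> real" borel borel "{a<..}"] by simp
    then show ?thesis by (simp add: emeasure_distr emeasure_density_indicator)
  qed
  have Mval: "emeasure ?M {a<..} = ennreal (?w * (s ^ ?d - max 0 a ^ ?d))" if "a \<le> s" for a
  proof (cases "a < 0")
    case True
    then have "norm -` {a<..} \<inter> cball (0::'a) s = cball 0 s"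
      by (auto intro: less_le_trans[OF _ norm_ge_zero])
    then show ?thesis unfolding M using True s by (simp add: emeasure_cball zero_power)
  next
    case False
    then have "norm -` {a<..} \<inter> cball (0::'a) s = cball 0 s - cball 0 a" by auto
    moreover have "emeasure lborel (cball 0 s - cball (0::'a) a) = emeasure lborel (cball (0::'a) s) - emeasure lborel (cball (0::'a) a)"
      by (rule emeasure_Diff) (use subset_cball[OF that, of "0::'a"] emeasure_lborel_cball_finite[of "0::'a" a] in auto)
    ultimately have "emeasure ?M {a<..} = emeasure lborel (cball (0::'a) s) - emeasure lborel (cball (0::'a) a)"
      unfolding M by simp
    then show ?thesis using False s that
      by (simp add: emeasure_cball ennreal_minus right_diff_distrib power_mono)
  qed
  have Nval: "emeasure ?N {a<..} = ennreal (?w * (s ^ ?d - max 0 a ^ ?d))" if "a \<le> s" for a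
  proof -
    let ?m = "max 0 a"
    have "emeasure ?N {a<..} = (\<integral>\<^sup>+r. ennreal (p r) * indicator {a<..} r \<partial>lborel)"
      by (rule emeasure_density) auto
    also have "\<dots> = (\<integral>\<^sup>+r. ennreal (real ?d * ?w * r ^ (?d - 1)) * indicator {?m..s} r \<partial>lborel)"
      using AE_lborel_singleton[of a]
      by (intro nn_integral_cong_AE) (auto elim!: eventually_mono simp: p_def indicator_def)
    also have "\<dots> = ennreal (?w * s ^ ?d - ?w * ?m ^ ?d)"
    proof (rule nn_integral_FTC_Icc)
      fix x assume "x \<in> {?m..s}"
      have "((\<lambda>r. ?w * r ^ ?d) has_real_derivative ?w * (real ?d * x ^ (?d - Suc 0))) (at x)"
        by (rule DERIV_cmult[OF DERIV_pow])
      then show "((\<lambda>r. ?w * r ^ ?d) has_real_derivative real ?d * ?w * x ^ (?d - 1)) (at x)"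
        by (simp add: mult_ac)
    qed (use that s in auto)
    finally show ?thesis by (simp add: right_diff_distrib)
  qed
  have "?M = ?N"
  proof (rule measure_eqI_lessThan)
    fix a
    show "emeasure ?M {a<..} < \<infinity>"
      unfolding M by (rule le_less_trans[OF emeasure_mono emeasure_lborel_cball_finite[of 0 s]]) auto
    show "emeasure ?M {a<..} = emeasure ?N {a<..}"
    proof (cases "a \<le> s")
      case False
      then have "norm -` {a<..} \<inter> cball (0::'a) s = {}" by auto
      moreover have "emeasure ?N {a<..} = 0"
      proof -
        have "emeasure ?N {a<..} = (\<integral>\<^sup>+r. ennreal (p r) * indicator {a<..} r \<partial>lborel)"
          by (rule emeasure_density) auto
        also have "\<dots> = (\<integral>\<^sup>+r. 0 \<partial>(lborel :: real measure))"
          using False by (intro nn_integral_cong) (auto simp: p_def indicator_def)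
        finally show ?thesis by simp
      qed
      ultimately show ?thesis unfolding M by simp
    qed (simp add: Mval Nval)
  qed auto
  have "(\<integral>x. indicator (cball 0 s) x * F (norm (x :: 'a)) \<partial>lborel) = (\<integral>r. F r \<partial>?M)"
    by (simp add: integral_distr integral_density)
  also have "\<dots> = (\<integral>r. p r * F r \<partial>lborel)"
    unfolding \<open>?M = ?N\<close> by (simp add: integral_density p0)
  finally show ?thesis by (simp add: p_def mult.assoc)
qed

text \<open>Splitting off the coordinate along \<open>b\<close> in the product measure, the section
  of the ball at height \<open>y\<close> is a ball of one dimension less and radius
  \<open>sqrt (s^2 - y^2)\<close>.\<close>

lemma marginal_ball_integral:
  fixes h :: "real \<Rightarrow> real"
  assumes s: "s > 0" and [measurable]: "h \<in> borel_measurable borel" and b: "b \<in> (Basis :: 'a::euclidean_space set)"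
  shows "(\<integral>x. indicator (cball 0 s) x * h (x \<bullet> b) \<partial>lborel)
    = (\<integral>y. indicator {- s..s} y * (unit_ball_vol (DIM('a) - 1) * sqrt (s\<^sup>2 - y\<^sup>2) ^ (DIM('a) - 1) * h y) \<partial>lborel)"
proof -
  let ?d = "DIM('a) - 1" and ?w = "unit_ball_vol (real (DIM('a) - 1))"
  interpret P: product_sigma_finite "\<lambda>_::'a. lborel :: real measure" by standard
  define p where "p y = indicator {- s..s} y * (?w * sqrt (s\<^sup>2 - y\<^sup>2) ^ ?d)" for y
  have p0: "p y \<ge> 0" for y
  proof (cases "y \<in> {- s..s}")
    case True
    then have "y\<^sup>2 \<le> s\<^sup>2" by (intro power2_le_iff_abs_le[THEN iffD2]) (use s in auto)
    then show ?thesis by (simp add: p_def)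
  qed (simp add: p_def)
  have [measurable]: "p \<in> borel_measurable borel" unfolding p_def by measurable
  have [measurable]: "cball (0::'a) s \<in> sets borel" by simp
  let ?M = "distr (density lborel (\<lambda>x::'a. ennreal (indicator (cball 0 s) x))) borel (\<lambda>x. x \<bullet> b)"
  let ?N = "density lborel (\<lambda>r. ennreal (p r))"
  have "?M = ?N"
  proof (rule measure_eqI)
    fix A assume "A \<in> sets ?M"
    then have [measurable]: "A \<in> sets borel" by simp
    define I where "I = Basis - {b}"
    have I: "finite I" "b \<notin> I" "insert b I = Basis" "card I = ?d"
      using b by (auto simp: I_def)
    define G where "G g = indicator {g. sqrt (\<Sum>c\<in>Basis. (g c)\<^sup>2) \<le> s} g * (indicator A (g b) :: ennreal)" for g :: "'a \<Rightarrow> real"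
    have "emeasure ?M A = (\<integral>\<^sup>+x. indicator A x \<partial>?M)" by simp
    also have "\<dots> = (\<integral>\<^sup>+x. ennreal (indicator (cball 0 s) x) * indicator A (x \<bullet> b) \<partial>(lborel :: 'a measure))"
    proof -
      have "(\<integral>\<^sup>+x. indicator A x \<partial>?M) = (\<integral>\<^sup>+x. indicator A (x \<bullet> b) \<partial>density lborel (\<lambda>x::'a. ennreal (indicator (cball 0 s) x)))"
        by (subst nn_integral_distr) auto
      then show ?thesis by (subst (asm) nn_integral_density) auto
    qed
    also have "\<dots> = (\<integral>\<^sup>+g. ennreal (indicator (cball 0 s) (\<Sum>c\<in>Basis. g c *\<^sub>R (c::'a))) * indicator A ((\<Sum>c\<in>Basis. g c *\<^sub>R (c::'a)) \<bullet> b)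
         \<partial>(\<Pi>\<^sub>M c\<in>Basis. lborel))"
      by (subst lborel_eq, subst nn_integral_distr) auto
    also have "\<dots> = (\<integral>\<^sup>+g. G g \<partial>(\<Pi>\<^sub>M c\<in>Basis. lborel))"
    proof (rule nn_integral_cong)
      fix g :: "'a \<Rightarrow> real"
      have "norm (\<Sum>c\<in>Basis. g c *\<^sub>R (c::'a)) = sqrt (\<Sum>c\<in>Basis. (g c)\<^sup>2)"
        unfolding norm_eq_sqrt_inner by (subst euclidean_inner) (simp add: power2_eq_square)
      moreover have "(\<Sum>c\<in>Basis. g c *\<^sub>R (c::'a)) \<bullet> b = g b" using b by simp
      ultimately show "ennreal (indicator (cball 0 s) (\<Sum>c\<in>Basis. g c *\<^sub>R (c::'a))) * indicator A ((\<Sum>c\<in>Basis. g c *\<^sub>R (c::'a)) \<bullet> b) = G g"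
        by (simp add: G_def indicator_def)
    qed
    also have "\<dots> = (\<integral>\<^sup>+y. (\<integral>\<^sup>+x. G (x(b := y)) \<partial>Pi\<^sub>M I (\<lambda>_. lborel)) \<partial>lborel)"
    proof -
      have "G \<in> borel_measurable (Pi\<^sub>M (insert b I) (\<lambda>_. lborel))"
        unfolding G_def I(3) using b by measurable
      from P.product_nn_integral_insert_rev[OF I(1,2) this] show ?thesis by (simp add: I(3))
    qed
    also have "\<dots> = (\<integral>\<^sup>+y. ennreal (p y) * indicator A y \<partial>lborel)"
    proof (rule nn_integral_cong_AE)
      \<comment> \<open>At the two poles the section degenerates, while
        \<open>emeasure_cball_aux\<close> needs a positive radius.\<close>
      have "AE y in lborel. y \<notin> {- s, s}"
        by (intro AE_not_in countable_imp_null_set_lborel) auto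
      then show "AE y in lborel. (\<integral>\<^sup>+x. G (x(b := y)) \<partial>Pi\<^sub>M I (\<lambda>_. lborel)) = ennreal (p y) * indicator A y"
      proof eventually_elim
        case (elim y)
        have sum: "(\<Sum>c\<in>Basis. ((x(b := y)) c)\<^sup>2) = y\<^sup>2 + (\<Sum>c\<in>I. (x c)\<^sup>2)" for x
        proof -
          have "(\<Sum>c\<in>I. ((x(b := y)) c)\<^sup>2) = (\<Sum>c\<in>I. (x c)\<^sup>2)"
            using I(2) by (intro sum.cong refl) auto
          then show ?thesis unfolding I(3)[symmetric] using I(1,2) by simp
        qed
        have Gy: "G (x(b := y)) = of_bool (sqrt (y\<^sup>2 + (\<Sum>c\<in>I. (x c)\<^sup>2)) \<le> s) * indicator A y" for x
          by (simp only: G_def indicator_def mem_Collect_eq sum fun_upd_same)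
        show ?case
        proof (cases "y \<in> {- s<..<s}")
          case True
          then have "\<bar>y\<bar> < \<bar>s\<bar>" by auto
          then have y2: "y\<^sup>2 < s\<^sup>2" using abs_le_square_iff[of s y] by linarith
          then have r: "sqrt (s\<^sup>2 - y\<^sup>2) > 0" by simp
          have iff: "sqrt (y\<^sup>2 + S) \<le> s \<longleftrightarrow> sqrt S \<le> sqrt (s\<^sup>2 - y\<^sup>2)" for S
            using s y2 by (auto simp: real_sqrt_le_iff' sqrt_le_D intro: real_le_lsqrt dest: sqrt_le_D)
          have "(\<integral>\<^sup>+x. G (x(b := y)) \<partial>Pi\<^sub>M I (\<lambda>_. lborel))
             = (\<integral>\<^sup>+x. indicator A y * indicator ({g. sqrt (\<Sum>c\<in>I. (g c)\<^sup>2) \<le> sqrt (s\<^sup>2 - y\<^sup>2)} \<inter> space (Pi\<^sub>M I (\<lambda>_. lborel))) x \<partial>Pi\<^sub>M I (\<lambda>_. lborel))"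
            by (intro nn_integral_cong) (simp only: Gy iff, simp add: indicator_def)
          also have "\<dots> = indicator A y * emeasure (Pi\<^sub>M I (\<lambda>_. lborel))
              ({g. sqrt (\<Sum>c\<in>I. (g c)\<^sup>2) \<le> sqrt (s\<^sup>2 - y\<^sup>2)} \<inter> space (Pi\<^sub>M I (\<lambda>_. lborel)))"
            by (subst nn_integral_cmult) auto
          also have "\<dots> = indicator A y * ennreal (?w * sqrt (s\<^sup>2 - y\<^sup>2) ^ ?d)"
            by (subst emeasure_cball_aux[OF I(1) r]) (simp add: I(4))
          finally show ?thesis using True by (simp add: p_def mult.commute)
        next
          case False
          then have "y \<notin> {- s..s}" using elim by auto
          then have "\<not> \<bar>y\<bar> \<le> \<bar>s\<bar>" using s by auto
          then have y2: "s\<^sup>2 < y\<^sup>2" by (simp add: abs_le_square_iff not_le)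
          have "\<not> sqrt (y\<^sup>2 + (\<Sum>c\<in>I. (x c)\<^sup>2)) \<le> s" for x
          proof
            assume "sqrt (y\<^sup>2 + (\<Sum>c\<in>I. (x c)\<^sup>2)) \<le> s"
            then have "y\<^sup>2 + (\<Sum>c\<in>I. (x c)\<^sup>2) \<le> s\<^sup>2" by (rule sqrt_le_D)
            then show False using y2 sum_nonneg[of I "\<lambda>c. (x c)\<^sup>2"] by simp
          qed
          then have "G (x(b := y)) = 0" for x by (simp add: Gy)
          then show ?thesis using \<open>y \<notin> {- s..s}\<close> by (simp add: p_def)
        qed
      qed
    qed
    also have "\<dots> = emeasure ?N A" by (rule emeasure_density[symmetric]) auto
    finally show "emeasure ?M A = emeasure ?N A" .
  qed simp
  have "(\<integral>x. indicator (cball 0 s) x * h (x \<bullet> b) \<partial>lborel) = (\<integral>r. h r \<partial>?M)"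
    by (simp add: integral_distr integral_density)
  also have "\<dots> = (\<integral>r. p r * h r \<partial>lborel)"
    unfolding \<open>?M = ?N\<close> by (simp add: integral_density p0)
  finally show ?thesis by (simp add: p_def mult.assoc)
qed

section \<open>From the slicing formula to a one-dimensional average\<close>

lemma integral_even_interval:
  fixes e :: "real \<Rightarrow> real"
  assumes even: "\<And>t. e (- t) = e t" and int: "integrable lborel (\<lambda>t. indicator {0<..<1} t * e t)"
    and [measurable]: "e \<in> borel_measurable borel"
  shows "(\<integral>t. indicator {-1..1} t * e t \<partial>lborel) = 2 * (\<integral>t. indicator {0<..<1} t * e t \<partial>lborel)"
proof -
  have int': "integrable lborel (\<lambda>t. indicator {0<..<1} (- t) * e (- t))"
    using lborel_integrable_real_affine[OF int, of "-1" 0] by simp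
  have "(\<integral>t. indicator {-1..1} t * e t \<partial>lborel)
      = (\<integral>t. indicator {0<..<1} t * e t + indicator {0<..<1} (- t) * e (- t) \<partial>lborel)"
  proof (rule integral_cong_AE)
    have "AE t in lborel. t \<notin> {-1, 0, 1 :: real}"
      by (intro AE_not_in countable_imp_null_set_lborel) auto
    then show "AE t in lborel. indicator {-1..1} t * e t
        = indicator {0<..<1} t * e t + indicator {0<..<1} (- t) * e (- t)"
      by eventually_elim (auto simp: even indicator_def)
  qed measurable
  also have "\<dots> = (\<integral>t. indicator {0<..<1} t * e t \<partial>lborel) + (\<integral>t. indicator {0<..<1} (- t) * e (- t) \<partial>lborel)"
    by (rule Bochner_Integration.integral_add[OF int int'])
  also have "(\<integral>t. indicator {0<..<1} (- t) * e (- t) \<partial>lborel) = (\<integral>t. indicator {0<..<1} t * e t \<partial>lborel)"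
    by (rule lborel_integral_reflect) measurable
  finally show ?thesis by simp
qed

text \<open>Integrate the slicing formula over the ball of radius \<open>s\<close>, once in polar coordinates and
  once along hyperplanes, and differentiate in \<open>s\<close>.\<close>

theorem slicing_formula_eq_slice_average:
  fixes F f :: "real \<Rightarrow> real"
  assumes d: "CARD('n) \<ge> 2"
    and f: "continuous_on UNIV f" "\<And>t. \<bar>f t\<bar> \<le> B" and even: "\<And>t. f (- t) = f t"
    and F: "continuous_on {0..} F"
    and slicing: "\<And>x :: real^'n. F (norm x) = (\<integral>\<xi>. f (x \<bullet> \<xi>) \<partial>uniform_sphere)"
  obtains c where "\<And>s. s > 0 \<Longrightarrow> F s = c * slice_average f ((real CARD('n) - 3) / 2) s"
proof -
  let ?n = "CARD('n)"
  define w w' where "w = unit_ball_vol (real ?n)" and "w' = unit_ball_vol (real (?n - 1))"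
  have w: "w > 0" by (simp add: w_def)
  \<comment> \<open>The volume of a section, \<open>sqrt (s^2 - y^2) ^ (?n - 1)\<close>, gives this
    exponent. It is one more than the exponent of the claim, and differentiating in \<open>s\<close>
    removes the difference.\<close>
  define a where "a = (real ?n - 1) / 2"
  have a: "a > 0" using d by (simp add: a_def)
  have [measurable]: "f \<in> borel_measurable borel"
    using f(1) by (rule borel_measurable_continuous_onI)
  \<comment> \<open>Nothing is assumed about \<open>F\<close> at negative arguments; the even
    extension is continuous and hence Borel on the whole line.\<close>
  define F' where "F' r = F \<bar>r\<bar>" for r
  have F'c: "continuous_on UNIV F'"
    unfolding F'_def by (rule continuous_on_compose2[OF F]) (auto intro!: continuous_intros)
  then have [measurable]: "F' \<in> borel_measurable borel"
    by (rule borel_measurable_continuous_onI)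
  obtain b :: "real^'n" where b: "b \<in> Basis" using nonempty_Basis by blast
  interpret \<sigma>: prob_space "uniform_sphere :: (real^'n) measure"
    by (rule prob_space_uniform_sphere)
  interpret pair_sigma_finite "lborel :: (real^'n) measure" "uniform_sphere :: (real^'n) measure"
    by (intro pair_sigma_finite.intro lborel.sigma_finite_measure_axioms \<sigma>.sigma_finite_measure_axioms)
  define g where "g r = real ?n * w * r ^ (?n - 1) * F' r" for r
  have gc: "continuous_on {0..} g"
    unfolding g_def by (intro continuous_intros continuous_on_subset[OF F'c]) auto
  have ball: "integral {0..s} g = 2 * w' * (s powr (2 * a + 1) * slice_average f a s)" if s: "s > 0" for s
  proof -
    have [measurable]: "cball (0 :: real^'n) s \<in> sets borel" by simp
    have i: "integrable lborel (indicator (cball (0 :: real^'n) s) :: _ \<Rightarrow> real)"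
      using emeasure_lborel_cball_finite[of "0 :: real^'n" s] by (simp add: integrable_indicator_iff)
    have "integrable lborel (\<lambda>r. indicator {0..s} r *\<^sub>R g r)"
      by (rule borel_integrable_compact) (auto intro: continuous_on_subset[OF gc])
    then have "integral {0..s} g = (\<integral>r. indicator {0..s} r * g r \<partial>lborel)"
      using set_borel_integral_eq_integral(2)[of "{0..s}" g]
      by (simp add: set_integrable_def set_lebesgue_integral_def)
    also have "\<dots> = (\<integral>x. indicator (cball 0 s) x * F' (norm (x :: real^'n)) \<partial>lborel)"
      by (subst radial_ball_integral[OF s]) (auto simp: g_def w_def)
    also have "\<dots> = (\<integral>x. (\<integral>\<xi>. f (x \<bullet> \<xi>) * indicator (cball 0 s) x * 1 \<partial>uniform_sphere) \<partial>(lborel :: (real^'n) measure))"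
      by (simp add: F'_def slicing mult.commute)
    also have "\<dots> = (\<integral>\<xi>. (\<integral>x. f (x \<bullet> \<xi>) * indicator (cball 0 s) x * 1 \<partial>(lborel :: (real^'n) measure)) \<partial>uniform_sphere)"
      by (rule Fubini_kernel[OF i, where B = B]) (auto simp: f)
    \<comment> \<open>For a fixed unit vector \<open>\<xi>\<close>, rotating the ball replaces it by
      the basis vector \<open>b\<close>, so the average over the sphere becomes that of a
      constant.\<close>
    also have "\<dots> = (\<integral>\<xi>. (\<integral>x. indicator (cball 0 s) x * f (x \<bullet> b) \<partial>lborel) \<partial>(uniform_sphere :: (real^'n) measure))"
    proof (rule integral_cong_AE)
      show "AE \<xi> in uniform_sphere. (\<integral>x. f (x \<bullet> \<xi>) * indicator (cball 0 s) x * 1 \<partial>(lborel :: (real^'n) measure))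
          = (\<integral>x. indicator (cball 0 s) x * f (x \<bullet> b) \<partial>lborel)"
        using AE_uniform_sphere_norm
      proof eventually_elim
        case (elim \<xi>)
        then obtain U where U: "orthogonal_transformation U" and Ub: "U b = \<xi>"
          using orthogonal_transformation_exists[of b \<xi>] b by auto
        note [measurable] = orthogonal_transformation_measurable[OF U]
        have "(\<integral>x. f (x \<bullet> \<xi>) * indicator (cball 0 s) x * 1 \<partial>(lborel :: (real^'n) measure))
          = (\<integral>x. f (x \<bullet> \<xi>) * indicator (cball 0 s) x * 1 \<partial>(distr lborel borel U))"
          by (simp add: distr_lborel_orthogonal[OF U])
        also have "\<dots> = (\<integral>x. f (U x \<bullet> \<xi>) * indicator (cball 0 s) (U x) * 1 \<partial>lborel)"
          by (subst integral_distr) auto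
        also have "(\<lambda>x. f (U x \<bullet> \<xi>) * indicator (cball 0 s) (U x) * 1) = (\<lambda>x. indicator (cball 0 s) x * f (x \<bullet> b))"
        proof
          fix x
          have "U x \<bullet> \<xi> = x \<bullet> b" using U Ub by (auto simp: orthogonal_transformation_def)
          then show "f (U x \<bullet> \<xi>) * indicator (cball 0 s) (U x) * 1 = indicator (cball 0 s) x * f (x \<bullet> b)"
            using orthogonal_transformation_norm[OF U, of x] by (simp add: indicator_def)
        qed
        finally show ?case .
      qed
    qed measurable
    also have "\<dots> = (\<integral>x. indicator (cball 0 s) x * f (x \<bullet> b) \<partial>lborel)"
      by simp
    also have "\<dots> = (\<integral>y. indicator {- s..s} y * (w' * sqrt (s\<^sup>2 - y\<^sup>2) ^ (?n - 1) * f y) \<partial>lborel)"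
      by (subst marginal_ball_integral[OF s _ b]) (auto simp: w'_def)
    also have "\<dots> = \<bar>s\<bar> *\<^sub>R (\<integral>t. indicator {- s..s} (0 + s * t) * (w' * sqrt (s\<^sup>2 - (0 + s * t)\<^sup>2) ^ (?n - 1) * f (0 + s * t)) \<partial>lborel)"
      using s by (intro lborel_integral_real_affine) auto
    also have "(\<lambda>t. indicator {- s..s} (0 + s * t) * (w' * sqrt (s\<^sup>2 - (0 + s * t)\<^sup>2) ^ (?n - 1) * f (0 + s * t)))
       = (\<lambda>t. w' * s ^ (?n - 1) * (indicator {-1..1} t * (f (s * t) * (1 - t\<^sup>2) powr a)))"
    proof
      fix t
      show "indicator {- s..s} (0 + s * t) * (w' * sqrt (s\<^sup>2 - (0 + s * t)\<^sup>2) ^ (?n - 1) * f (0 + s * t))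
        = w' * s ^ (?n - 1) * (indicator {-1..1} t * (f (s * t) * (1 - t\<^sup>2) powr a))"
      proof (cases "t \<in> {-1..1}")
        case True
        have t2: "t\<^sup>2 \<le> 1" using True by (simp add: abs_square_le_1 abs_le_iff)
        have "s\<^sup>2 - (s * t)\<^sup>2 = s\<^sup>2 * (1 - t\<^sup>2)" by (simp add: power_mult_distrib algebra_simps)
        then have "sqrt (s\<^sup>2 - (s * t)\<^sup>2) = s * sqrt (1 - t\<^sup>2)"
          using s by (simp add: real_sqrt_mult)
        then have "sqrt (s\<^sup>2 - (s * t)\<^sup>2) ^ (?n - 1) = s ^ (?n - 1) * sqrt (1 - t\<^sup>2) ^ (?n - 1)"
          by (simp add: power_mult_distrib)
        also have "sqrt (1 - t\<^sup>2) ^ (?n - 1) = (1 - t\<^sup>2) powr a"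
        \<comment> \<open>At \<open>t = 1\<close> and \<open>t = -1\<close> both sides are 0: the
          power because its exponent is positive, and \<open>0 powr a\<close> by convention.\<close>
        proof (cases "1 - t\<^sup>2 = 0")
          case True
          then show ?thesis using d by simp
        next
          case False
          then have p: "1 - t\<^sup>2 > 0" using t2 by simp
          have q: "sqrt (1 - t\<^sup>2) = (1 - t\<^sup>2) powr (1/2)" using p by (simp add: powr_half_sqrt)
          have "(1 - t\<^sup>2) powr (1/2) > 0" using p by simp
          then have "sqrt (1 - t\<^sup>2) ^ (?n - 1) = ((1 - t\<^sup>2) powr (1/2)) powr real (?n - 1)"
            unfolding q by (rule powr_realpow[symmetric])
          also have "\<dots> = (1 - t\<^sup>2) powr (1/2 * real (?n - 1))" by (rule powr_powr)
          also have "1/2 * real (?n - 1) = a" using d by (simp add: a_def of_nat_diff)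
          finally show ?thesis .
        qed
        finally have e: "sqrt (s\<^sup>2 - (s * t)\<^sup>2) ^ (?n - 1) = s ^ (?n - 1) * (1 - t\<^sup>2) powr a" .
        have "s * t \<in> {- s..s}"
          using True s mult_left_mono[of "-1" t s] mult_left_mono[of t 1 s] by auto
        then show ?thesis using True e by (simp add: mult_ac)
      next
        case False
        have "s * t \<notin> {- s..s}"
        proof
          assume "s * t \<in> {- s..s}"
          then have "s * (-1) \<le> s * t" "s * t \<le> s * 1" by auto
          then show False using False s by (simp only: mult_le_cancel_left_pos) auto
        qed
        then show ?thesis using False by simp
      qed
    qed
    also have "\<bar>s\<bar> *\<^sub>R (\<integral>t. w' * s ^ (?n - 1) * (indicator {-1..1} t * (f (s * t) * (1 - t\<^sup>2) powr a)) \<partial>lborel)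
        = s * (w' * s ^ (?n - 1) * (2 * slice_average f a s))"
      unfolding slice_average_def integral_mult_right_zero
      using slice_average_integrable[OF f, of a s] a s
      by (subst integral_even_interval) (auto simp: even)
    also have "\<dots> = 2 * w' * (s powr (2 * a + 1) * slice_average f a s)"
    proof -
      have "2 * a + 1 = real ?n" by (simp add: a_def field_simps)
      then have "s powr (2 * a + 1) = s powr real ?n" by simp
      also have "\<dots> = s ^ ?n" using s by (simp add: powr_realpow)
      also have "\<dots> = s * s ^ (?n - 1)" using d by (simp flip: power_Suc)
      finally show ?thesis by simp
    qed
    finally show ?thesis .
  qed
  \<comment> \<open>Both derivatives contain the factor \<open>s ^ (?n - 1)\<close>, which cancels;
    the constant is what remains of the two ball volumes and the factor
    \<open>2 * a\<close>.\<close>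
  have "F s = (2 * w' * (2 * a) / (real ?n * w)) * slice_average f ((real ?n - 3) / 2) s" if s: "s > 0" for s
  proof -
    have "((\<lambda>x. integral {0..x} g) has_real_derivative g s) (at s within {0..s + 1})"
      using s by (intro integral_has_real_derivative continuous_on_subset[OF gc]) auto
    moreover have "at s within {0..s + 1} = at s"
      using s by (intro at_within_interior) auto
    ultimately have D: "((\<lambda>x. integral {0..x} g) has_real_derivative g s) (at s)" by simp
    have D1: "((\<lambda>s. 2 * w' * (s powr (2 * a + 1) * slice_average f a s)) has_real_derivative g s) (at s)"
      by (rule has_field_derivative_transform_within_open[OF D, of "{0<..}"]) (use s ball in auto)
    have D2: "((\<lambda>s. 2 * w' * (s powr (2 * a + 1) * slice_average f a s)) has_real_derivative
        2 * w' * (2 * a * s powr (2 * a) * slice_average f (a - 1) s)) (at s)"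
      by (rule DERIV_cmult[OF slice_average_powr_has_derivative[OF f a s]])
    have "g s = 2 * w' * (2 * a * s powr (2 * a) * slice_average f (a - 1) s)"
      by (rule DERIV_unique[OF D1 D2])
    moreover have "s powr (2 * a) = s ^ (?n - 1)"
    proof -
      have "2 * a = real (?n - 1)" using d by (simp add: a_def of_nat_diff field_simps)
      then have "s powr (2 * a) = s powr real (?n - 1)" by simp
      then show ?thesis using powr_realpow[OF s, of "?n - 1"] by (simp only:)
    qed
    moreover have "a - 1 = (real ?n - 3) / 2" by (simp add: a_def field_simps)
    ultimately have "real ?n * w * s ^ (?n - 1) * F s =
        2 * w' * (2 * a * s ^ (?n - 1) * slice_average f ((real ?n - 3) / 2) s)"
      using s by (simp add: g_def F'_def)
    then show ?thesis using s w by (simp add: field_simps)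
  qed
  then show thesis by (rule that)
qed

section \<open>The slicing formula\<close>

text \<open>\<open>x\<close> and \<open>- x\<close> have equal norms, so this average equals its own
  negative. It removes the imaginary part of the transform of \<open>\<mu>\<close>.\<close>

lemma uniform_sphere_integral_sin:
  fixes x :: "real^'n"
  shows "(\<integral>\<xi>. sin (c * (x \<bullet> \<xi>)) \<partial>uniform_sphere) = 0"
proof -
  obtain e :: "real^'n" where e: "norm e = 1" using vector_choose_size[of 1] by auto
  have "(\<integral>\<xi>. sin (c * (x \<bullet> \<xi>)) \<partial>uniform_sphere) = (\<integral>\<xi>. sin (c * ((- x) \<bullet> \<xi>)) \<partial>uniform_sphere)"
    using uniform_sphere_inner[of "\<lambda>t. sin (c * t)" e x] uniform_sphere_inner[of "\<lambda>t. sin (c * t)" e "- x"] e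
    by simp
  then show ?thesis by simp
qed

text \<open>\<open>\<mu>\<close> is the law of \<open>r *\<^sub>R \<xi>\<close> for independent
  \<open>r\<close> and \<open>\<xi>\<close>, whose norm is \<open>\<bar>r\<bar>\<close>. Since
  \<open>\<nu>\<close> is not asserted to live on the nonnegative reals, the last clause is stated
  for even functions, which is the form \<open>even_part\<close> produces.\<close>

theorem bochner_radial:
  fixes F :: "real \<Rightarrow> real"
  assumes pd: "positive_definite (rotation (\<lambda>r. complex_of_real (F r)) :: real^'n \<Rightarrow> complex)"
  obtains \<mu> :: "(real^'n) measure" and \<nu> :: "real measure"
  where "prob_space \<mu>" "sets \<mu> = sets borel" "real_distribution \<nu>"
    "\<And>x :: real^'n. F (norm x) = F 0 * (\<integral>r. (\<integral>\<xi>. cos (2 * pi * (r * (x \<bullet> \<xi>))) \<partial>uniform_sphere) \<partial>\<nu>)"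
    "\<And>x :: real^'n. complex_of_real (F (norm x)) = of_real (F 0) * (\<integral>v. cis (- 2 * pi * (x \<bullet> v)) \<partial>\<mu>)"
    "\<And>h :: real \<Rightarrow> complex. continuous_on UNIV h \<Longrightarrow> (\<And>r. h (- r) = h r) \<Longrightarrow> (\<integral>v. h (norm v) \<partial>\<mu>) = (\<integral>r. h r \<partial>\<nu>)"
proof -
  obtain \<nu> where \<nu>: "real_distribution \<nu>"
    and F: "\<And>x :: real^'n. F (norm x) = F 0 * (\<integral>r. (\<integral>\<xi>. cos (2 * pi * (r * (x \<bullet> \<xi>))) \<partial>uniform_sphere) \<partial>\<nu>)"
    using schoenberg[OF pd] by blast
  interpret \<nu>: real_distribution \<nu> by (rule \<nu>)
  interpret \<sigma>: prob_space "uniform_sphere :: (real^'n) measure"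
    by (rule prob_space_uniform_sphere)
  interpret P: pair_prob_space \<nu> "uniform_sphere :: (real^'n) measure" ..
  let ?P = "\<nu> \<Otimes>\<^sub>M (uniform_sphere :: (real^'n) measure)"
  define \<mu> where "\<mu> = distr ?P borel (\<lambda>z. fst z *\<^sub>R snd z)"
  have [measurable]: "(\<lambda>z. fst z *\<^sub>R snd z) \<in> borel_measurable ?P" by measurable
  have \<mu>p: "prob_space \<mu>" unfolding \<mu>_def by (rule P.prob_space_distr) measurable
  have \<mu>i: "(\<integral>v. g v \<partial>\<mu>) = (\<integral>z. g (fst z *\<^sub>R snd z) \<partial>?P)"
    if [measurable]: "g \<in> borel_measurable borel" for g :: "real^'n \<Rightarrow> complex"
    unfolding \<mu>_def by (subst integral_distr) auto
  have "complex_of_real (F (norm x)) = of_real (F 0) * (\<integral>v. cis (- 2 * pi * (x \<bullet> v)) \<partial>\<mu>)" for x :: "real^'n"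
  proof -
    have "integrable ?P (\<lambda>z. cis (- 2 * pi * (x \<bullet> (fst z *\<^sub>R snd z))))"
      by (rule P.integrable_const_bound[where B = 1]) auto
    then have "(\<integral>z. cis (- 2 * pi * (x \<bullet> (fst z *\<^sub>R snd z))) \<partial>?P)
        = (\<integral>r. (\<integral>\<xi>. cis (- 2 * pi * (x \<bullet> (r *\<^sub>R \<xi>))) \<partial>uniform_sphere) \<partial>\<nu>)"
      by (subst P.integral_fst'[symmetric]) auto
    also have "\<dots> = (\<integral>r. complex_of_real (\<integral>\<xi>. cos (2 * pi * (r * (x \<bullet> \<xi>))) \<partial>uniform_sphere) \<partial>\<nu>)"
    proof (intro Bochner_Integration.integral_cong refl complex_eqI)
      fix r
      have i: "integrable (uniform_sphere :: (real^'n) measure) (\<lambda>\<xi>. cis (- 2 * pi * (x \<bullet> (r *\<^sub>R \<xi>))))"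
        by (rule \<sigma>.integrable_const_bound[where B = 1]) auto
      show "Re (\<integral>\<xi>. cis (- 2 * pi * (x \<bullet> (r *\<^sub>R \<xi>))) \<partial>uniform_sphere)
         = Re (complex_of_real (\<integral>\<xi>. cos (2 * pi * (r * (x \<bullet> \<xi>))) \<partial>uniform_sphere))"
        unfolding integral_Re[OF i, symmetric] by simp
      show "Im (\<integral>\<xi>. cis (- 2 * pi * (x \<bullet> (r *\<^sub>R \<xi>))) \<partial>uniform_sphere)
         = Im (complex_of_real (\<integral>\<xi>. cos (2 * pi * (r * (x \<bullet> \<xi>))) \<partial>uniform_sphere))"
        unfolding integral_Im[OF i, symmetric]
        using uniform_sphere_integral_sin[of "2 * pi * r" x] by (simp add: mult.assoc)
    qed
    finally show ?thesis
      using F[of x] by (subst \<mu>i) auto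
  qed
  moreover have "(\<integral>v. h (norm v) \<partial>\<mu>) = (\<integral>r. h r \<partial>\<nu>)"
    if c: "continuous_on UNIV h" and even: "\<And>r. h (- r) = h r" for h :: "real \<Rightarrow> complex"
  proof -
    have [measurable]: "h \<in> borel_measurable borel"
      using c by (rule borel_measurable_continuous_onI)
    have "AE z in ?P. norm (snd z) = 1"
    proof (rule P.AE_pair_measure)
      show "{z \<in> space ?P. norm (snd z) = 1} \<in> sets ?P" by measurable
    qed (simp add: AE_uniform_sphere_norm)
    then have "(\<integral>v. h (norm v) \<partial>\<mu>) = (\<integral>z. h (fst z) \<partial>?P)"
    proof (subst \<mu>i, measurable, intro integral_cong_AE)
      assume "AE z in ?P. norm (snd z) = 1"
      then show "AE z in ?P. h (norm (fst z *\<^sub>R snd z)) = h (fst z)"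
        by eventually_elim (auto simp: abs_if even)
    qed measurable
    also have "\<dots> = (\<integral>r. h r \<partial>distr ?P \<nu> fst)"
      by (subst integral_distr) auto
    also have "distr ?P \<nu> fst = \<nu>"
      by (rule \<sigma>.distr_pair_fst)
    finally show ?thesis .
  qed
  moreover have "sets \<mu> = sets borel" by (simp add: \<mu>_def)
  ultimately show thesis using that \<mu>p \<nu> F by blast
qed

section \<open>Finite measures as tempered distributions\<close>

lemma schwartz_norm_0_ge:
  assumes "\<phi> \<in> schwartz"
  shows "norm (\<phi> x) \<le> schwartz_norm 0 \<phi>"
proof -
  obtain B where B: "\<And>x. norm (\<phi> x) \<le> B" using schwartz_bounded[OF assms] by blast
  have "norm (\<phi> x) = (case ([] :: 'a list, x) of (bs, x) \<Rightarrow> (1 + norm x) ^ 0 * norm (partial_derivs bs \<phi> x))"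
    by (simp add: partial_derivs_def)
  also have "\<dots> \<le> schwartz_norm 0 \<phi>"
    unfolding schwartz_norm_def
  proof (rule cSUP_upper)
    show "bdd_above ((\<lambda>(bs, x). (1 + norm x) ^ 0 * norm (partial_derivs bs \<phi> x)) ` ({bs \<in> lists Basis. length bs \<le> 0} \<times> UNIV))"
      by (rule bdd_aboveI[of _ B]) (auto simp: partial_derivs_def B)
  qed auto
  finally show ?thesis .
qed

lemma finite_measure_tempered:
  fixes \<mu> :: "'a::euclidean_space measure"
  assumes "finite_measure \<mu>" and s: "sets \<mu> = sets borel"
  shows "(\<lambda>\<phi>\<in>schwartz. c * (\<integral>v. \<phi> v \<partial>\<mu>)) \<in> tempered_distributions"
proof -
  interpret finite_measure \<mu> by fact
  have m: "\<phi> \<in> borel_measurable \<mu>" if "\<phi> \<in> schwartz" for \<phi> :: "'a \<Rightarrow> complex"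
    using schwartz_measurable[OF that] measurable_cong_sets[OF s refl] by blast
  have i: "integrable \<mu> \<phi>" if S: "\<phi> \<in> schwartz" for \<phi> :: "'a \<Rightarrow> complex"
    using schwartz_norm_0_ge[OF S] by (intro integrable_const_bound[OF _ m[OF S]]) auto
  have bound: "norm (c * (\<integral>v. \<phi> v \<partial>\<mu>)) \<le> norm c * measure \<mu> (space \<mu>) * schwartz_norm 0 \<phi>"
    if S: "\<phi> \<in> schwartz" for \<phi> :: "'a \<Rightarrow> complex"
  proof -
    have "norm (\<integral>v. \<phi> v \<partial>\<mu>) \<le> (\<integral>v. schwartz_norm 0 \<phi> \<partial>\<mu>)"
      using i[OF S] schwartz_norm_0_ge[OF S] by (intro Bochner_Integration.integral_norm_bound_integral) auto
    then have "norm c * norm (\<integral>v. \<phi> v \<partial>\<mu>) \<le> norm c * (measure \<mu> (space \<mu>) * schwartz_norm 0 \<phi>)"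
      by (intro mult_left_mono) auto
    then show ?thesis by (simp add: norm_mult mult.assoc)
  qed
  have add: "(\<lambda>x. \<phi> x + \<psi> x) \<in> schwartz" if "\<phi> \<in> schwartz" "\<psi> \<in> schwartz" for \<phi> \<psi> :: "'a \<Rightarrow> complex"
    using schwartz_lincomb[OF that, of 1 1] by simp
  show ?thesis
    unfolding tempered_distributions_def
  proof (intro CollectI conjI IntI ballI allI exI)
    show "(\<lambda>\<phi>\<in>schwartz. c * (\<integral>v. \<phi> v \<partial>\<mu>)) \<in> extensional schwartz" by simp
    fix \<phi> \<psi> :: "'a \<Rightarrow> complex" and a assume S: "\<phi> \<in> schwartz"
    show "(\<lambda>\<phi>\<in>schwartz. c * (\<integral>v. \<phi> v \<partial>\<mu>)) (\<lambda>x. a * \<phi> x) = a * (\<lambda>\<phi>\<in>schwartz. c * (\<integral>v. \<phi> v \<partial>\<mu>)) \<phi>"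
      using S schwartz_scale[OF S] by simp
    show "norm ((\<lambda>\<phi>\<in>schwartz. c * (\<integral>v. \<phi> v \<partial>\<mu>)) \<phi>) \<le> norm c * measure \<mu> (space \<mu>) * schwartz_norm 0 \<phi>"
      using S bound[OF S] by simp
    assume S': "\<psi> \<in> schwartz"
    show "(\<lambda>\<phi>\<in>schwartz. c * (\<integral>v. \<phi> v \<partial>\<mu>)) (\<lambda>x. \<phi> x + \<psi> x)
       = (\<lambda>\<phi>\<in>schwartz. c * (\<integral>v. \<phi> v \<partial>\<mu>)) \<phi> + (\<lambda>\<phi>\<in>schwartz. c * (\<integral>v. \<phi> v \<partial>\<mu>)) \<psi>"
      using S S' add[OF S S'] by (simp add: i distrib_left)
  qed
qed

lemma inj_on_fourier_distribution:
  "inj_on fourier_distribution (tempered_distributions :: (('a::euclidean_space \<Rightarrow> complex) \<Rightarrow> complex) set)"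
proof (rule inj_onI)
  fix S T :: "('a \<Rightarrow> complex) \<Rightarrow> complex"
  assume ST: "S \<in> tempered_distributions" "T \<in> tempered_distributions"
    and eq: "fourier_distribution S = fourier_distribution T"
  show "S = T"
  proof (rule extensionalityI)
    show "S \<in> extensional schwartz" "T \<in> extensional schwartz"
      using ST by (auto simp: tempered_distributions_def)
    fix \<phi> :: "'a \<Rightarrow> complex" assume "\<phi> \<in> schwartz"
    then obtain \<psi> where \<psi>: "\<psi> \<in> schwartz" "fourier \<psi> = \<phi>"
      using fourier_schwartz_surj by blast
    have "fourier_distribution S \<psi> = fourier_distribution T \<psi>" using eq by simp
    then show "S \<phi> = T \<phi>" using \<psi> by (simp add: fourier_distribution_def)
  qed
qed

text \<open>Exhibits the preimage of \<open>regular_distribution g\<close>; together with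
  injectivity this evaluates \<open>inv_fourier_distribution\<close> there.\<close>

lemma fourier_distribution_measure:
  fixes \<mu> :: "'a::euclidean_space measure"
  assumes \<mu>: "finite_measure \<mu>" and s: "sets \<mu> = sets borel"
    and g: "\<And>x. g x = c * (\<integral>v. cis (- 2 * pi * (x \<bullet> v)) \<partial>\<mu>)"
  shows "fourier_distribution (\<lambda>\<phi>\<in>schwartz. c * (\<integral>v. \<phi> v \<partial>\<mu>)) = regular_distribution g"
proof
  fix \<phi> :: "'a \<Rightarrow> complex"
  interpret \<mu>: finite_measure \<mu> by fact
  interpret pair_sigma_finite \<mu> "lborel :: 'a measure"
    by (intro pair_sigma_finite.intro lborel.sigma_finite_measure_axioms \<mu>.sigma_finite_measure_axioms)
  note s [measurable_cong]
  show "fourier_distribution (\<lambda>\<phi>\<in>schwartz. c * (\<integral>v. \<phi> v \<partial>\<mu>)) \<phi> = regular_distribution g \<phi>"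
  proof (cases "\<phi> \<in> schwartz")
    case True
    have "(\<integral>v. fourier \<phi> v \<partial>\<mu>) = (\<integral>v. (\<integral>x. cis (- 2 * pi * (x \<bullet> v)) * 1 * \<phi> x \<partial>lborel) \<partial>\<mu>)"
      by (simp add: fourier_eq_cis)
    also have "\<dots> = (\<integral>x. (\<integral>v. cis (- 2 * pi * (x \<bullet> v)) * 1 * \<phi> x \<partial>\<mu>) \<partial>lborel)"
      by (rule Fubini_kernel[OF _ schwartz_integrable[OF True], where B = 1]) auto
    also have "c * \<dots> = (\<integral>x. g x * \<phi> x \<partial>lborel)"
      by (simp add: g mult.assoc)
    finally show ?thesis
      using True fourier_schwartz[OF True] by (simp add: fourier_distribution_def regular_distribution_def)
  qed (simp add: fourier_distribution_def regular_distribution_def)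
qed

section \<open>The positive definite function on the line\<close>

text \<open>The addition formula for the cosine of a difference turns the quadratic form under the
  integral into a sum of two squared moduli.\<close>

lemma positive_definite_cosine_transform:
  assumes \<nu>: "real_distribution \<nu>" and c: "c \<ge> 0"
  shows "positive_definite (\<lambda>t. complex_of_real (c * (\<integral>r. cos (2 * pi * (t * r)) \<partial>\<nu>)))"
  unfolding positive_definite_def
proof (intro conjI allI impI)
  interpret real_distribution \<nu> by (rule \<nu>)
  show "continuous_on UNIV (\<lambda>t. complex_of_real (c * (\<integral>r. cos (2 * pi * (t * r)) \<partial>\<nu>)))"
    by (intro continuous_intros continuous_on_integral_param[where B = 1]) (auto intro!: continuous_intros)
  fix N :: nat and x :: "nat \<Rightarrow> real" and \<alpha> :: "nat \<Rightarrow> complex"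
  define q where "q r = (cmod (\<Sum>j=1..N. \<alpha> j * of_real (cos (2 * pi * (x j * r)))))\<^sup>2
      + (cmod (\<Sum>j=1..N. \<alpha> j * of_real (sin (2 * pi * (x j * r)))))\<^sup>2" for r
  have q: "(\<Sum>j=1..N. \<Sum>k=1..N. \<alpha> j * cnj (\<alpha> k) * of_real (cos (2 * pi * ((x j - x k) * r)))) = of_real (q r)" for r
  proof -
    have "\<alpha> j * cnj (\<alpha> k) * of_real (cos (2 * pi * ((x j - x k) * r)))
      = (\<alpha> j * of_real (cos (2 * pi * (x j * r)))) * cnj (\<alpha> k * of_real (cos (2 * pi * (x k * r))))
      + (\<alpha> j * of_real (sin (2 * pi * (x j * r)))) * cnj (\<alpha> k * of_real (sin (2 * pi * (x k * r))))" for j k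
    proof -
      have "2 * pi * ((x j - x k) * r) = 2 * pi * (x j * r) - 2 * pi * (x k * r)"
        by (simp add: algebra_simps)
      then show ?thesis by (simp only: cos_diff) (simp add: algebra_simps)
    qed
    then show ?thesis
      by (simp only: sum.distrib q_def of_real_add complex_norm_square cnj_sum sum_product)
  qed
  have i: "integrable \<nu> (\<lambda>r. \<alpha> j * cnj (\<alpha> k) * complex_of_real (cos (2 * pi * ((x j - x k) * r))))" for j k
    by (rule integrable_const_bound[where B = "cmod (\<alpha> j * cnj (\<alpha> k))"])
       (auto simp: norm_mult intro!: mult_left_le)
  have "(\<Sum>j=1..N. \<Sum>k=1..N. \<alpha> j * cnj (\<alpha> k) * complex_of_real (c * (\<integral>r. cos (2 * pi * ((x j - x k) * r)) \<partial>\<nu>)))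
    = of_real c * (\<Sum>j=1..N. \<Sum>k=1..N. (\<integral>r. \<alpha> j * cnj (\<alpha> k) * complex_of_real (cos (2 * pi * ((x j - x k) * r))) \<partial>\<nu>))"
    by (simp add: sum_distrib_left mult_ac)
  also have "\<dots> = of_real c * (\<integral>r. of_real (q r) \<partial>\<nu>)"
    unfolding q[symmetric] using i by (simp add: Bochner_Integration.integral_sum)
  also have "\<dots> = of_real (c * (\<integral>r. q r \<partial>\<nu>))" by simp
  also have "\<dots> \<in> \<real>\<^sub>\<ge>\<^sub>0"
    using c by (auto simp: q_def intro!: mult_nonneg_nonneg integral_nonneg_AE)
  finally show "(\<Sum>j=1..N. \<Sum>k=1..N. \<alpha> j * cnj (\<alpha> k) * complex_of_real (c * (\<integral>r. cos (2 * pi * ((x j - x k) * r)) \<partial>\<nu>))) \<in> \<real>\<^sub>\<ge>\<^sub>0" .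
qed

lemma even_part_fourier:
  assumes S: "\<psi> \<in> schwartz"
  shows "even_part (fourier \<psi>) r = (\<integral>x. of_real (cos (2 * pi * (x * r))) * \<psi> x \<partial>lborel)"
proof -
  have i: "integrable lborel (\<lambda>x. cis (- 2 * pi * (x * r)) * \<psi> x)" for r
    by (intro integrable_cis_mult schwartz_integrable S) auto
  have "even_part (fourier \<psi>) r = (\<integral>x. cis (- 2 * pi * (x * r)) * \<psi> x + cis (- 2 * pi * (x * - r)) * \<psi> x \<partial>lborel) / 2"
    unfolding Bochner_Integration.integral_add[OF i i] by (simp add: even_part_def fourier_eq_cis)
  also have "\<dots> = (\<integral>x. (cis (- 2 * pi * (x * r)) * \<psi> x + cis (- 2 * pi * (x * - r)) * \<psi> x) / 2 \<partial>lborel)"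
    by simp
  also have "\<dots> = (\<integral>x. of_real (cos (2 * pi * (x * r))) * \<psi> x \<partial>lborel)"
  proof (intro Bochner_Integration.integral_cong refl)
    fix x
    have "cis (- 2 * pi * (x * r)) + cis (- 2 * pi * (x * - r)) = 2 * of_real (cos (2 * pi * (x * r)))"
      by (simp add: complex_eq_iff)
    then have "(cis (- 2 * pi * (x * r)) + cis (- 2 * pi * (x * - r))) * \<psi> x / 2 = of_real (cos (2 * pi * (x * r))) * \<psi> x"
      by simp
    then show "(cis (- 2 * pi * (x * r)) * \<psi> x + cis (- 2 * pi * (x * - r)) * \<psi> x) / 2 = of_real (cos (2 * pi * (x * r))) * \<psi> x"
      by (simp only: distrib_right)
  qed
  finally show ?thesis .
qed

text \<open>On test functions, \<open>rotation_dual\<close> of the measure integrates the even part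
  against \<open>\<nu>\<close>, so its Fourier transform is a cosine transform of
  \<open>\<nu>\<close>. Exchanging the two integrals in the representation of \<open>F\<close>
  yields the slicing formula for that same function.\<close>

theorem slicing_of_positive_definite:
  fixes F :: "real \<Rightarrow> real"
  assumes d: "CARD('n) \<ge> 2"
    and pd: "positive_definite (rotation (\<lambda>r. complex_of_real (F r)) :: real^'n \<Rightarrow> complex)"
  shows "times_continuously_differentiable_on ((CARD('n) - 2) div 2) F {0<..} \<and>
    (\<exists>f :: real \<Rightarrow> complex.
       fourier_distribution (rotation_dual (inv_fourier_distribution
         (regular_distribution (rotation (\<lambda>r. complex_of_real (F r)) :: real^'n \<Rightarrow> complex))))
         = regular_distribution f \<and>
       positive_definite f \<and>
       (\<forall>x :: real^'n. complex_of_real (F (norm x)) = (\<integral>\<xi>. f \<bar>x \<bullet> \<xi>\<bar> \<partial>uniform_sphere)))"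
proof -
  obtain \<mu> :: "(real^'n) measure" and \<nu> where \<mu>: "prob_space \<mu>" "sets \<mu> = sets borel" and \<nu>: "real_distribution \<nu>"
    and F: "\<And>x :: real^'n. F (norm x) = F 0 * (\<integral>r. (\<integral>\<xi>. cos (2 * pi * (r * (x \<bullet> \<xi>))) \<partial>uniform_sphere) \<partial>\<nu>)"
    and F\<mu>: "\<And>x :: real^'n. complex_of_real (F (norm x)) = of_real (F 0) * (\<integral>v. cis (- 2 * pi * (x \<bullet> v)) \<partial>\<mu>)"
    and \<mu>\<nu>: "\<And>h :: real \<Rightarrow> complex. continuous_on UNIV h \<Longrightarrow> (\<And>r. h (- r) = h r) \<Longrightarrow> (\<integral>v. h (norm v) \<partial>\<mu>) = (\<integral>r. h r \<partial>\<nu>)"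
    by (rule bochner_radial[OF pd]) (rule that, assumption, assumption, assumption, blast, blast, blast)
  interpret \<mu>: prob_space \<mu> by (rule \<mu>(1))
  interpret \<nu>: real_distribution \<nu> by (rule \<nu>)
  interpret \<sigma>: prob_space "uniform_sphere :: (real^'n) measure"
    by (rule prob_space_uniform_sphere)
  have F0: "F 0 \<ge> 0"
    using positive_definite_0[OF pd] by (simp add: rotation_def complex_nonneg_Reals_iff)
  \<comment> \<open>\<open>\<nu>\<close> is a probability law; the factor \<open>F 0\<close>
    restores the total mass.\<close>
  define f where "f t = F 0 * (\<integral>r. cos (2 * pi * (t * r)) \<partial>\<nu>)" for t
  have fpd: "positive_definite (\<lambda>t. complex_of_real (f t))"
    unfolding f_def by (rule positive_definite_cosine_transform[OF \<nu> F0])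
  have even: "f (- t) = f t" for t by (simp add: f_def)
  have fabs: "f \<bar>t\<bar> = f t" for t by (simp add: abs_if even)
  have fc: "continuous_on UNIV f"
    using fpd continuous_on_Re[of UNIV "\<lambda>t. complex_of_real (f t)"] by (simp add: positive_definite_def)
  then have [measurable]: "f \<in> borel_measurable borel"
    by (rule borel_measurable_continuous_onI)
  have fB: "\<bar>f t\<bar> \<le> f 0" for t
    using positive_definite_bounded[OF fpd, of t] by simp
  have slicing: "F (norm x) = (\<integral>\<xi>. f (x \<bullet> \<xi>) \<partial>uniform_sphere)" for x :: "real^'n"
  proof -
    interpret pair_sigma_finite \<nu> "uniform_sphere :: (real^'n) measure"
      by (intro pair_sigma_finite.intro \<nu>.sigma_finite_measure_axioms \<sigma>.sigma_finite_measure_axioms)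
    have "(\<integral>r. (\<integral>\<xi>. cos (2 * pi * (r * (x \<bullet> \<xi>))) * 1 * 1 \<partial>uniform_sphere) \<partial>\<nu>)
      = (\<integral>\<xi>. (\<integral>r. cos (2 * pi * (r * (x \<bullet> \<xi>))) * 1 * 1 \<partial>\<nu>) \<partial>uniform_sphere)"
      by (rule Fubini_kernel[where B = 1]) auto
    then show ?thesis
      using F[of x] by (simp add: f_def mult.commute[of "_ \<bullet> _"])
  qed
  have slicing': "complex_of_real (F (norm x)) = (\<integral>\<xi>. complex_of_real (f \<bar>x \<bullet> \<xi>\<bar>) \<partial>uniform_sphere)" for x :: "real^'n"
    by (simp add: slicing fabs)
  have smooth: "times_continuously_differentiable_on ((CARD('n) - 2) div 2) F {0<..}"
  proof -
    have Fc: "continuous_on {0..} F"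
    proof -
      obtain e :: "real^'n" where e: "norm e = 1" using vector_choose_size[of 1] by auto
      have "continuous_on UNIV (\<lambda>x :: real^'n. F (norm x))"
        using pd continuous_on_Re[of UNIV "\<lambda>x :: real^'n. complex_of_real (F (norm x))"]
        by (simp add: positive_definite_def rotation_def[abs_def])
      then have "continuous_on {0..} (\<lambda>r. F (norm (r *\<^sub>R e)))"
        by (rule continuous_on_compose2) (auto intro!: continuous_intros)
      then show ?thesis
        by (rule continuous_on_eq) (simp add: e)
    qed
    obtain c where c: "\<And>s. s > 0 \<Longrightarrow> F s = c * slice_average f ((real CARD('n) - 3) / 2) s"
      using slicing_formula_eq_slice_average[OF d fc fB even Fc slicing] by blast
    let ?k = "(CARD('n) - 2) div 2"
    \<comment> \<open>This is the arithmetic behind the order of smoothness: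
      \<open>2 k + 2 \<le> d\<close> implies \<open>(d - 3)/2 > k - 1\<close>, the condition of
      \<open>slice_average_smooth\<close>.\<close>
    have "2 * ?k + 2 \<le> CARD('n)" using d by linarith
    then have "real (2 * ?k + 2) \<le> real CARD('n)" by (rule of_nat_mono)
    then have "real ?k \<le> (real CARD('n) - 2) / 2" by simp
    then have "smooth_on_pos ?k (slice_average f ((real CARD('n) - 3) / 2))"
      by (intro slice_average_smooth[OF fc fB]) (simp add: field_simps)
    then have "smooth_on_pos ?k (\<lambda>s. c * slice_average f ((real CARD('n) - 3) / 2) s)"
      by (intro smooth_on_pos_mult smooth_on_pos_const)
    then have "smooth_on_pos ?k F"
      by (rule smooth_on_pos_cong[rotated]) (simp add: c)
    then show ?thesis by (rule smooth_on_pos_imp)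
  qed
  let ?R = "rotation (\<lambda>r. complex_of_real (F r)) :: real^'n \<Rightarrow> complex"
  define T :: "(real^'n \<Rightarrow> complex) \<Rightarrow> complex" where "T = (\<lambda>\<phi>\<in>schwartz. of_real (F 0) * (\<integral>v. \<phi> v \<partial>\<mu>))"
  have T: "T \<in> tempered_distributions"
    unfolding T_def by (rule finite_measure_tempered[OF \<mu>.finite_measure_axioms \<mu>(2)])
  have "fourier_distribution T = regular_distribution ?R"
    unfolding T_def
    by (rule fourier_distribution_measure[OF \<mu>.finite_measure_axioms \<mu>(2)]) (simp add: rotation_def F\<mu>)
  then have inv: "inv_fourier_distribution (regular_distribution ?R) = T"
    unfolding inv_fourier_distribution_def using T
    by (metis the_inv_into_f_f[OF inj_on_fourier_distribution])
  have dual: "rotation_dual T \<psi> = of_real (F 0) * (\<integral>r. even_part \<psi> r \<partial>\<nu>)" if S: "\<psi> \<in> schwartz" for \<psi>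
  proof -
    have "rotation_dual T \<psi> = of_real (F 0) * (\<integral>v. even_part \<psi> (norm v) \<partial>\<mu>)"
      using S rotation_even_part_schwartz[OF S, where 'a = "real^'n"]
      by (simp add: rotation_dual_def T_def rotation_def[abs_def])
    also have "(\<integral>v. even_part \<psi> (norm v) \<partial>\<mu>) = (\<integral>r. even_part \<psi> r \<partial>\<nu>)"
      by (rule \<mu>\<nu>[OF schwartz_continuous[OF even_part_schwartz[OF S]]]) (simp add: even_part_def add.commute)
    finally show ?thesis .
  qed
  have "fourier_distribution (rotation_dual T) = regular_distribution (\<lambda>t. complex_of_real (f t))"
  proof
    fix \<psi> :: "real \<Rightarrow> complex"
    interpret pair_sigma_finite \<nu> "lborel :: real measure"
      by (intro pair_sigma_finite.intro lborel.sigma_finite_measure_axioms \<nu>.sigma_finite_measure_axioms)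
    show "fourier_distribution (rotation_dual T) \<psi> = regular_distribution (\<lambda>t. complex_of_real (f t)) \<psi>"
    proof (cases "\<psi> \<in> schwartz")
      case True
      have "(\<integral>r. even_part (fourier \<psi>) r \<partial>\<nu>) = (\<integral>r. (\<integral>x. of_real (cos (2 * pi * (x * r))) * 1 * \<psi> x \<partial>lborel) \<partial>\<nu>)"
        by (simp add: even_part_fourier[OF True])
      also have "\<dots> = (\<integral>x. (\<integral>r. of_real (cos (2 * pi * (x * r))) * 1 * \<psi> x \<partial>\<nu>) \<partial>lborel)"
        by (rule Fubini_kernel[OF _ schwartz_integrable[OF True], where B = 1]) auto
      also have "of_real (F 0) * \<dots> = (\<integral>x. of_real (f x) * \<psi> x \<partial>lborel)"
        by (simp add: f_def mult.assoc)
      finally show ?thesis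
        using True dual[OF fourier_schwartz[OF True]]
        by (simp add: fourier_distribution_def regular_distribution_def)
    qed (simp add: fourier_distribution_def regular_distribution_def)
  qed
  then show ?thesis
    using smooth fpd slicing' unfolding inv by blast
qed

section \<open>The converse\<close>

text \<open>For each fixed \<open>\<xi>\<close> the ridge function of
  \<open>x \<bullet> \<xi>\<close> has nonnegative quadratic forms, and averaging over
  \<open>\<xi>\<close> preserves this. Evaluating the average along a fixed unit vector
  \<open>e\<close> produces the radial profile \<open>F\<close>.\<close>

theorem positive_definite_of_slicing:
  fixes f :: "real \<Rightarrow> complex"
  assumes even: "\<And>r. f (- r) = f r" and pd: "positive_definite f"
  shows "\<exists>F :: real \<Rightarrow> real.
    (\<forall>x :: real^'n. rotation (\<lambda>r. complex_of_real (F r)) x = (\<integral>\<xi>. f \<bar>x \<bullet> \<xi>\<bar> \<partial>uniform_sphere)) \<and>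
    positive_definite (rotation (\<lambda>r. complex_of_real (F r)) :: real^'n \<Rightarrow> complex)"
proof -
  interpret \<sigma>: prob_space "uniform_sphere :: (real^'n) measure"
    by (rule prob_space_uniform_sphere)
  have fc: "continuous_on UNIV f" using pd by (simp add: positive_definite_def)
  then have [measurable]: "f \<in> borel_measurable borel"
    by (rule borel_measurable_continuous_onI)
  have fabs: "f \<bar>t\<bar> = f t" for t by (simp add: abs_if even)
  \<comment> \<open>Hermitian symmetry together with evenness makes \<open>f\<close> real, so that
    \<open>F\<close> can be real-valued.\<close>
  have freal: "f t = of_real (Re (f t))" for t
    using positive_definite_hermitian[OF pd, of t] by (simp add: even complex_eq_iff)
  have fB: "norm (f t) \<le> Re (f 0)" for t by (rule positive_definite_bounded[OF pd])
  obtain e :: "real^'n" where e: "norm e = 1" using vector_choose_size[of 1] by auto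
  define \<Phi> where "\<Phi> x = (\<integral>\<xi>. f (x \<bullet> \<xi>) \<partial>uniform_sphere)" for x :: "real^'n"
  define F where "F r = (\<integral>\<xi>. Re (f (r * (e \<bullet> \<xi>))) \<partial>uniform_sphere)" for r
  have F: "rotation (\<lambda>r. complex_of_real (F r)) x = \<Phi> x" for x
  proof -
    have "\<Phi> x = (\<integral>\<xi>. f (norm x * (e \<bullet> \<xi>)) \<partial>uniform_sphere)"
      unfolding \<Phi>_def by (rule uniform_sphere_inner[OF _ e]) measurable
    also have "\<dots> = (\<integral>\<xi>. complex_of_real (Re (f (norm x * (e \<bullet> \<xi>)))) \<partial>uniform_sphere)"
      using freal by simp
    finally show ?thesis by (simp add: rotation_def F_def)
  qed
  have int: "integrable (uniform_sphere :: (real^'n) measure) (\<lambda>\<xi>. f (x \<bullet> \<xi>))" for x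
    using fB by (intro \<sigma>.integrable_const_bound[where B = "Re (f 0)"]) auto
  have "positive_definite \<Phi>"
    unfolding positive_definite_def
  proof (intro conjI allI impI)
    show "continuous_on UNIV \<Phi>"
      unfolding \<Phi>_def using fB
      by (intro \<sigma>.continuous_on_integral_param[where B = "Re (f 0)"] continuous_on_compose2[OF fc])
         (auto intro!: continuous_intros)
    fix N :: nat and x :: "nat \<Rightarrow> real^'n" and \<alpha> :: "nat \<Rightarrow> complex"
    define S where "S \<xi> = (\<Sum>j=1..N. \<Sum>k=1..N. \<alpha> j * cnj (\<alpha> k) * f (x j \<bullet> \<xi> - x k \<bullet> \<xi>))" for \<xi>
    \<comment> \<open>Distinct points may have equal projections on \<open>\<xi>\<close>, so the
      criterion that admits repeated points is applied.\<close>
    have S: "S \<xi> \<in> \<real>\<^sub>\<ge>\<^sub>0" for \<xi>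
      unfolding S_def by (rule positive_definite_sum_nonneg[OF pd]) simp
    have "(\<Sum>j=1..N. \<Sum>k=1..N. \<alpha> j * cnj (\<alpha> k) * \<Phi> (x j - x k)) = (\<integral>\<xi>. S \<xi> \<partial>uniform_sphere)"
      unfolding S_def \<Phi>_def inner_diff_left[symmetric] using int
      by (simp add: Bochner_Integration.integral_sum)
    also have "\<dots> = (\<integral>\<xi>. complex_of_real (Re (S \<xi>)) \<partial>uniform_sphere)"
      using S by (intro Bochner_Integration.integral_cong refl) (simp add: complex_nonneg_Reals_iff complex_eq_iff)
    also have "\<dots> = of_real (\<integral>\<xi>. Re (S \<xi>) \<partial>uniform_sphere)" by simp
    also have "\<dots> \<in> \<real>\<^sub>\<ge>\<^sub>0"
      using S by (auto simp: complex_nonneg_Reals_iff intro!: integral_nonneg_AE)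
    finally show "(\<Sum>j=1..N. \<Sum>k=1..N. \<alpha> j * cnj (\<alpha> k) * \<Phi> (x j - x k)) \<in> \<real>\<^sub>\<ge>\<^sub>0" .
  qed
  moreover have "rotation (\<lambda>r. complex_of_real (F r)) = \<Phi>" using F by (rule ext)
  ultimately show ?thesis
    by (intro exI[of _ F]) (simp add: \<Phi>_def fabs)
qed

theorem theorem4p13:
  assumes "CARD('n::finite) \<ge> 2"
  shows
    "(\<forall>F :: real \<Rightarrow> real.
        positive_definite (rotation (\<lambda>r. complex_of_real (F r)) :: real^'n \<Rightarrow> complex) \<longrightarrow>
          times_continuously_differentiable_on ((CARD('n) - 2) div 2) F {0<..} \<and>
          (\<exists>f :: real \<Rightarrow> complex.
             fourier_distribution (rotation_dual (inv_fourier_distribution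
               (regular_distribution
                 (rotation (\<lambda>r. complex_of_real (F r)) :: real^'n \<Rightarrow> complex))))
               = regular_distribution f \<and>
             positive_definite f \<and>
             (\<forall>x :: real^'n.
                complex_of_real (F (norm x)) = (\<integral>\<xi>. f \<bar>x \<bullet> \<xi>\<bar> \<partial>uniform_sphere))))
     \<and>
     (\<forall>f :: real \<Rightarrow> complex.
        (\<forall>r. f (- r) = f r) \<and> positive_definite f \<longrightarrow>
          (\<exists>F :: real \<Rightarrow> real.
             (\<forall>x :: real^'n.
                rotation (\<lambda>r. complex_of_real (F r)) x = (\<integral>\<xi>. f \<bar>x \<bullet> \<xi>\<bar> \<partial>uniform_sphere)) \<and>
             positive_definite (rotation (\<lambda>r. complex_of_real (F r)) :: real^'n \<Rightarrow> complex)))"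
  using slicing_of_positive_definite[OF assms] positive_definite_of_slicing by blast

end
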